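(* Let $(D,\mu)$ be a measure space, let $m\ge 1$ be an integer, let $\mathbb I$ be an at most countable index set, and let $a=(a_1,\dots,a_m)^\top$ and $b=(b_k)_{k\in\mathbb I}^\top$ be families of complex-valued square-integrable functions on $D$. Assume that $I:=\int_D a(x)a(x)^*\,d\mu(x)$ and $J:=\int_D b(x)b(x)^*\,d\mu(x)$ are positive definite, and that $J$ has finite trace $$\operatorname{Tr}(J)=\sum_{k\in\mathbb I}\|b_k\|_{L_2(D,\mu)}^2<\infty .$$ Put $M:=\operatorname{Tr}(J)/\lambda_{\max}(J)$. Then, for any integer $n\ge m$, there exist points $x_1,\dots,x_n\in D$ and weights $w_1,\dots,w_n>0$ such that $$\lambda_{\min}\Big(\sum_{i=1}^n w_i\,a(x_i)a(x_i)^*\Big)\ \ge\ \Big(1-\sqrt{\tfrac{m-1}{n}}\Big)^2\lambda_{\min}(I)$$ and $$\lambda_{\max}\Big(\sum_{i=1}^n w_i\,b(x_i)b(x_i)^*\Big)\ \le\ \Big(1+\sqrt{\tfrac{M-1}{n}}\Big)^2\lambda_{\max}(J).$$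
   Context: $L_2(D,\mu)$ consists of genuine complex-valued functions (not equivalence classes), so point evaluations make sense. $v^*$ is the conjugate transpose. Integrals of matrices are taken entrywise. Matrices indexed by $\mathbb I\times\mathbb I$ are regarded as operators on $\ell_2(\mathbb I)$; "positive definite" means self-adjoint with $v^*Jv>0$ for all nonzero $v\in\ell_2(\mathbb I)$ (and similarly for $I$ on $\mathbb C^m$). $\lambda_{\min}$ and $\lambda_{\max}$ denote smallest and largest eigenvalues. The points $x_i$ are understood to be such that $b(x_i)=(b_k(x_i))_{k\in\mathbb I}\in\ell_2(\mathbb I)$, so that $\sum_i w_i b(x_i)b(x_i)^*$ is a bounded finite-rank operator on $\ell_2(\mathbb I)$. *)

theory Defs
  imports "HOL-Analysis.Analysis"
begin

text \<open>
  A matrix indexed by \<open>K \<times> K\<close> is a function of two indices, a vector indexed by \<open>K\<close> a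
  function of one index. Only the values at indices in \<open>K\<close> matter; in particular \<open>v\<close> is a nonzero
  vector iff \<open>\<exists>k\<in>K. v k \<noteq> 0\<close>. For finite \<open>K\<close> every vector is in \<open>ell2 K\<close> and all the
  infinite sums below are ordinary finite ones, so that \<open>ell2 {1..m}\<close> is the space of complex
  \<open>m\<close>-tuples with the usual matrix-vector product.
\<close>

definition ell2 :: "'k set \<Rightarrow> ('k \<Rightarrow> complex) set" where
  "ell2 K = {v. (\<lambda>k. (cmod (v k))\<^sup>2) summable_on K}"

definition mat_app :: "'k set \<Rightarrow> ('k \<Rightarrow> 'k \<Rightarrow> complex) \<Rightarrow> ('k \<Rightarrow> complex) \<Rightarrow> 'k \<Rightarrow> complex" where
  "mat_app K A v = (\<lambda>k. \<Sum>\<^sub>\<infinity>l\<in>K. A k l * v l)"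

definition quad_form :: "'k set \<Rightarrow> ('k \<Rightarrow> 'k \<Rightarrow> complex) \<Rightarrow> ('k \<Rightarrow> complex) \<Rightarrow> complex" where
  "quad_form K A v = (\<Sum>\<^sub>\<infinity>k\<in>K. cnj (v k) * mat_app K A v k)"

text \<open>
  Meant for matrices that define a bounded operator on \<open>ell2 K\<close>, as \<open>integral_gram\<close> below does
  when its trace is finite (its entries are then square-summable, by Cauchy-Schwarz). For these the
  sums in \<open>mat_app\<close> and \<open>quad_form\<close> converge absolutely, and the operator is self-adjoint
  iff the matrix equals its conjugate transpose.
\<close>

definition positive_definite :: "'k set \<Rightarrow> ('k \<Rightarrow> 'k \<Rightarrow> complex) \<Rightarrow> bool" where
  "positive_definite K A \<longleftrightarrow>
     (\<forall>k\<in>K. \<forall>l\<in>K. A k l = cnj (A l k)) \<and>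
     (\<forall>v\<in>ell2 K. (\<exists>k\<in>K. v k \<noteq> 0) \<longrightarrow> quad_form K A v \<in> \<real> \<and> Re (quad_form K A v) > 0)"

definition is_eigenvalue :: "'k set \<Rightarrow> ('k \<Rightarrow> 'k \<Rightarrow> complex) \<Rightarrow> complex \<Rightarrow> bool" where
  "is_eigenvalue K A c \<longleftrightarrow>
     (\<exists>v\<in>ell2 K. (\<exists>k\<in>K. v k \<noteq> 0) \<and> (\<forall>k\<in>K. mat_app K A v k = c * v k))"

text \<open>
  These are used for self-adjoint matrices only, whose eigenvalues are all real. On the reals
  \<open>LEAST\<close> and \<open>GREATEST\<close> denote an attained minimum and maximum.
\<close>

definition lambda_min :: "'k set \<Rightarrow> ('k \<Rightarrow> 'k \<Rightarrow> complex) \<Rightarrow> real" where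
  "lambda_min K A = (LEAST r. is_eigenvalue K A (complex_of_real r))"

definition lambda_max :: "'k set \<Rightarrow> ('k \<Rightarrow> 'k \<Rightarrow> complex) \<Rightarrow> real" where
  "lambda_max K A = (GREATEST r. is_eigenvalue K A (complex_of_real r))"

definition square_integrable :: "'x measure \<Rightarrow> ('x \<Rightarrow> complex) \<Rightarrow> bool" where
  "square_integrable \<mu> f \<longleftrightarrow>
     f \<in> borel_measurable \<mu> \<and> integrable \<mu> (\<lambda>x. (cmod (f x))\<^sup>2)"

text \<open>
  A family \<open>f\<close> of functions indexed by \<open>K\<close> gives at each point \<open>x\<close> the vector \<open>f(x)\<close> with entries
  \<open>f k x\<close>, and the \<open>(k, l)\<close> entry of \<open>f(x) f(x)\<^sup>*\<close> is \<open>f k x * cnj (f l x)\<close>.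
\<close>

definition integral_gram :: "'x measure \<Rightarrow> ('k \<Rightarrow> 'x \<Rightarrow> complex) \<Rightarrow> 'k \<Rightarrow> 'k \<Rightarrow> complex" where
  "integral_gram \<mu> f = (\<lambda>k l. LINT x|\<mu>. f k x * cnj (f l x))"

definition sample_gram ::
  "nat \<Rightarrow> (nat \<Rightarrow> real) \<Rightarrow> (nat \<Rightarrow> 'x) \<Rightarrow> ('k \<Rightarrow> 'x \<Rightarrow> complex) \<Rightarrow> 'k \<Rightarrow> 'k \<Rightarrow> complex" where
  "sample_gram n w x f =
     (\<lambda>k l. \<Sum>i = 1..n. complex_of_real (w i) * (f k (x i) * cnj (f l (x i))))"

end

theory Submission
  imports Defs "HOL-Library.Function_Algebras"
begin

text \<open>
  The points are chosen one after the other by the barrier argument of Batson, Spielman and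
  Srivastava, run simultaneously for both families. Write \<open>A\<close> and \<open>B\<close> for the sums of the rank-one
  matrices \<open>t a(x) a(x)\<^sup>*\<close> and \<open>t b(x) b(x)\<^sup>*\<close> over the points chosen so far. For the lower estimate
  the operator \<open>X = A - r I\<close> is kept positive, where \<open>r\<close> starts at a negative value and grows by \<open>\<delta>\<close> in
  each step; for the upper estimate the operator \<open>X = \<alpha> id + s J - B\<close> is kept positive, where \<open>s\<close>
  starts at zero and grows by \<open>\<delta>\<close> (with another value of \<open>\<delta>\<close>). The distance to the barrier is
  measured by the potential \<open>\<integral> v(x)\<^sup>* X\<^sup>-\<^sup>1 v(x) d\<mu>(x)\<close> with \<open>v = a\<close> or \<open>v = b\<close>, and the
  potential is kept below a constant \<open>\<epsilon>\<close>.

  Moving the barrier changes the potential. By the Sherman-Morrison formula the new rank-one term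
  undoes the change provided that \<open>1 / t\<close> is at most \<open>L(x)\<close>, respectively at least \<open>U(x)\<close>, for an
  explicit function of the point. The integrals of these functions are at least \<open>1 / \<delta> - \<epsilon>\<close> and at
  most \<open>1 / \<delta> + \<epsilon>\<close>. If the parameters make the first at least one and the second at most one, then
  some point has \<open>L(x) > 0\<close> and \<open>L(x) \<ge> U(x)\<close>, and one weight serves both families
  (\<open>interleave_barriers\<close>).

  Both barriers move along the Gram operator \<open>H\<close> of their own family, and not along the identity. A
  potential of at most \<open>\<epsilon>\<close> then yields \<open>X \<ge> H / \<epsilon>\<close> (\<open>H_le_potential\<close>). This keeps \<open>X\<close> positive when
  the lower barrier moves, and at the end it turns \<open>m\<close> and \<open>M\<close> into \<open>m - 1\<close> and \<open>M - 1\<close>: the lower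
  bound is \<open>(n \<delta> - m / \<epsilon> + 1 / \<epsilon>) I\<close> and the upper bound \<open>(Tr J / \<epsilon>) id + (n \<delta> - 1 / \<epsilon>) J\<close>.
  Optimising over \<open>\<epsilon>\<close> gives the constants of the theorem.

  Three situations need an extra idea. For \<open>m = 1\<close> and for \<open>M - 1 \<le> 1 / n\<close> the optimal barriers
  degenerate: in the second case the coefficient of \<open>J\<close> above would not be positive. There it
  suffices to follow a scalar, namely \<open>\<bar>a(x)\<bar>\<^sup>2\<close> for \<open>m = 1\<close>, and the trace of \<open>B\<close> for \<open>M\<close> close to one
  (\<open>upper_sampling_trace\<close>). Finally, for infinite index sets the upper barrier is run on a finite
  subset only, and the trace of the remaining block of \<open>B\<close> is controlled in addition. The price can
  be made as small as desired, and it is paid from a gain that does not depend on the subset: moving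
  the upper barrier lowers the potential by a fixed amount (\<open>upper_barrier_step\<close>), so that the
  barrier may advance by slightly less than the optimal \<open>\<delta>\<close>.

  The eigenvalues in the statement are related to quadratic forms by \<open>largest_eigenvalue_exists\<close>: the
  quadratic form of a Hilbert-Schmidt matrix is continuous for coordinatewise convergence on the unit
  ball of \<open>\<ell>\<^sub>2\<close>, which is compact for it, so a positive supremum is attained at an eigenvector.
\<close>

section \<open>Hermitian operators on a finite index set\<close>

definition vscale :: "complex \<Rightarrow> ('k \<Rightarrow> complex) \<Rightarrow> 'k \<Rightarrow> complex" where
  "vscale c u = (\<lambda>k. c * u k)"

text \<open>
  Solvability is proved by eliminating one index at a time. The pivot is the value of the quadratic
  form at the vector that solves the smaller system, hence nonzero.
\<close>

lemma definite_solvable: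
  fixes N :: "'k \<Rightarrow> 'k \<Rightarrow> complex"
  assumes "finite G"
    and "\<And>t. \<exists>k\<in>G. t k \<noteq> 0 \<Longrightarrow> (\<Sum>k\<in>G. cnj (t k) * (\<Sum>l\<in>G. N k l * t l)) \<noteq> (0::complex)"
  shows "\<exists>w. \<forall>k\<in>G. (\<Sum>l\<in>G. N k l * w l) = (u k :: complex)"
  using assms
proof (induction G arbitrary: u rule: finite_induct)
  case empty then show ?case by simp
next
  case (insert j G)
  have ext: "(\<Sum>l\<in>G. N k l * (if l = j then c else t l)) = (\<Sum>l\<in>G. N k l * t l)" for k c and t :: "'k \<Rightarrow> complex"
    using insert.hyps by (intro sum.cong) auto
  have ext': "(\<Sum>k\<in>G. cnj (if k = j then c else t k) * s k) = (\<Sum>k\<in>G. cnj (t k) * s k)" for c s and t :: "'k \<Rightarrow> complex"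
    using insert.hyps by (intro sum.cong) auto
  have def: "(\<Sum>k\<in>G. cnj (t k) * (\<Sum>l\<in>G. N k l * t l)) \<noteq> 0" if "\<exists>k\<in>G. t k \<noteq> 0" for t
  proof -
    have "\<exists>k\<in>insert j G. (if k = j then 0 else t k) \<noteq> 0" using that insert.hyps by auto
    from insert.prems[OF this] show ?thesis
      using insert.hyps by (simp add: ext ext')
  qed
  obtain z where z: "\<And>k. k \<in> G \<Longrightarrow> (\<Sum>l\<in>G. N k l * z l) = N k j"
    using insert.IH[OF def, of "\<lambda>k. N k j"] by blast
  obtain w where w: "\<And>k. k \<in> G \<Longrightarrow> (\<Sum>l\<in>G. N k l * w l) = u k"
    using insert.IH[OF def, of u] by blast
  define s where "s = N j j - (\<Sum>l\<in>G. N j l * z l)"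
  define t where "t = (\<lambda>k. if k = j then 1 else - z k)"
  have "(\<Sum>k\<in>insert j G. cnj (t k) * (\<Sum>l\<in>insert j G. N k l * t l)) = s"
  proof -
    have "(\<Sum>l\<in>insert j G. N k l * t l) = 0" if "k \<in> G" for k
      using insert.hyps z[OF that] by (simp add: t_def ext sum_negf)
    moreover have "(\<Sum>l\<in>insert j G. N j l * t l) = s"
      using insert.hyps by (simp add: t_def s_def ext sum_negf)
    ultimately show ?thesis using insert.hyps by (simp add: t_def)
  qed
  then have s0: "s \<noteq> 0" using insert.prems[of t] by (auto simp: t_def)
  define c where "c = (u j - (\<Sum>l\<in>G. N j l * w l)) / s"
  define y where "y = (\<lambda>k. if k = j then c else w k - c * z k)"
  have sp: "(\<Sum>l\<in>insert j G. N k l * y l) = N k j * c + (\<Sum>l\<in>G. N k l * w l) - c * (\<Sum>l\<in>G. N k l * z l)" for k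
    using insert.hyps by (simp add: y_def ext right_diff_distrib sum_subtractf sum_distrib_left algebra_simps)
  have "(\<Sum>l\<in>insert j G. N k l * y l) = u k" if "k \<in> insert j G" for k
  proof (cases "k = j")
    case True
    have "c * s = u j - (\<Sum>l\<in>G. N j l * w l)" using s0 by (simp add: c_def)
    then show ?thesis unfolding True sp s_def by (simp add: algebra_simps)
  next
    case False
    then have "k \<in> G" using that by simp
    then show ?thesis using z[of k] w[of k] unfolding sp by simp
  qed
  then show ?case by blast
qed

text \<open>
  Vectors are functions on the whole index type, and only their values on \<open>F\<close> count. Operators
  return vectors that vanish outside \<open>F\<close>, so that identities between operators are equations between
  functions; the identity operator is then \<open>restrict_fin\<close>.
\<close>

locale fin_index =
  fixes F :: "'k set"
  assumes finF: "finite F"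
begin

definition restrict_fin :: "('k \<Rightarrow> complex) \<Rightarrow> 'k \<Rightarrow> complex" where
  "restrict_fin u = (\<lambda>k. if k \<in> F then u k else 0)"

definition inner_fin :: "('k \<Rightarrow> complex) \<Rightarrow> ('k \<Rightarrow> complex) \<Rightarrow> complex" where
  "inner_fin u w = (\<Sum>k\<in>F. cnj (u k) * w k)"

definition normsq :: "('k \<Rightarrow> complex) \<Rightarrow> real" where
  "normsq u = (\<Sum>k\<in>F. (cmod (u k))\<^sup>2)"

definition op_of :: "('k \<Rightarrow> 'k \<Rightarrow> complex) \<Rightarrow> ('k \<Rightarrow> complex) \<Rightarrow> 'k \<Rightarrow> complex" where
  "op_of N u = (\<lambda>k. if k \<in> F then \<Sum>l\<in>F. N k l * u l else 0)"

definition linop :: "(('k \<Rightarrow> complex) \<Rightarrow> 'k \<Rightarrow> complex) \<Rightarrow> bool" where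
  "linop T \<longleftrightarrow> (\<exists>N. T = op_of N)"

definition hermitian_op :: "(('k \<Rightarrow> complex) \<Rightarrow> 'k \<Rightarrow> complex) \<Rightarrow> bool" where
  "hermitian_op T \<longleftrightarrow> linop T \<and> (\<forall>u w. inner_fin u (T w) = inner_fin (T u) w)"

definition qform :: "(('k \<Rightarrow> complex) \<Rightarrow> 'k \<Rightarrow> complex) \<Rightarrow> ('k \<Rightarrow> complex) \<Rightarrow> real" where
  "qform T u = Re (inner_fin u (T u))"

definition pos_semidef :: "(('k \<Rightarrow> complex) \<Rightarrow> 'k \<Rightarrow> complex) \<Rightarrow> bool" where
  "pos_semidef T \<longleftrightarrow> hermitian_op T \<and> (\<forall>u. 0 \<le> qform T u)"

text \<open>
  Positive definite operators are carried together with their inverse, so that positivity is preserved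
  as soon as the candidate inverse is seen to be positive semidefinite.
\<close>

definition inv_pair where
  "inv_pair X R \<longleftrightarrow> hermitian_op X \<and> pos_semidef R \<and> (\<forall>u. X (R u) = restrict_fin u) \<and> (\<forall>u. R (X u) = restrict_fin u)"

definition rank1 :: "('k \<Rightarrow> complex) \<Rightarrow> ('k \<Rightarrow> complex) \<Rightarrow> 'k \<Rightarrow> complex" where
  "rank1 g u = vscale (inner_fin g u) (restrict_fin g)"

lemma inner_fin_cnj: "cnj (inner_fin u w) = inner_fin w u"
  unfolding inner_fin_def by (simp add: mult.commute)

lemma inner_fin_add_right: "inner_fin u (w + z) = inner_fin u w + inner_fin u z"
  unfolding inner_fin_def by (simp add: sum.distrib algebra_simps)

lemma inner_fin_add_left: "inner_fin (w + z) u = inner_fin w u + inner_fin z u"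
  unfolding inner_fin_def by (simp add: sum.distrib algebra_simps)

lemma inner_fin_vscale_right: "inner_fin u (vscale c w) = c * inner_fin u w"
  unfolding inner_fin_def vscale_def by (simp add: sum_distrib_left algebra_simps)

lemma inner_fin_vscale_left: "inner_fin (vscale c w) u = cnj c * inner_fin w u"
  unfolding inner_fin_def vscale_def by (simp add: sum_distrib_left algebra_simps)

lemma inner_fin_restrict_fin [simp]: "inner_fin (restrict_fin u) w = inner_fin u w" "inner_fin u (restrict_fin w) = inner_fin u w"
  unfolding inner_fin_def restrict_fin_def by (auto intro: sum.cong)

lemma inner_fin_self: "inner_fin u u = of_real (normsq u)"
  unfolding inner_fin_def normsq_def by (simp add: complex_norm_square mult.commute del: of_real_power)

lemma normsq_nonneg [simp]: "0 \<le> normsq u"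
  unfolding normsq_def by (simp add: sum_nonneg)

lemma normsq_eq_0: "normsq u = 0 \<longleftrightarrow> restrict_fin u = 0"
  unfolding normsq_def restrict_fin_def using finF
  by (auto simp: sum_nonneg_eq_0_iff fun_eq_iff)

lemma inner_fin_unit:
  assumes "j \<in> F" shows "inner_fin (\<lambda>i. if i = j then 1 else 0) u = u j"
  unfolding inner_fin_def using assms finF
  by (simp add: if_distrib[of cnj] if_distrib[of "\<lambda>z. z * _"] cong: if_cong)

lemma normsq_unit:
  assumes "j \<in> F" shows "normsq (\<lambda>i. if i = j then 1 else 0) = 1"
  unfolding normsq_def using assms finF
  by (simp add: if_distrib[of cmod] if_distrib[of "\<lambda>z. z\<^sup>2"] cong: if_cong)

lemmas inner_fin_simps = inner_fin_add_right inner_fin_add_left inner_fin_vscale_right inner_fin_vscale_left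

lemma linop_op_of [simp]: "linop (op_of N)"
  unfolding linop_def by blast

lemma linop_add_arg:
  assumes "linop T" shows "T (u + w) = T u + T w"
  using assms unfolding linop_def op_of_def by (auto simp: fun_eq_iff sum.distrib algebra_simps)

lemma linop_vscale_arg:
  assumes "linop T" shows "T (vscale c u) = vscale c (T u)"
  using assms unfolding linop_def op_of_def vscale_def
  by (auto simp: fun_eq_iff sum_distrib_left algebra_simps)

lemma linop_restrict_fin_arg:
  assumes "linop T" shows "T (restrict_fin u) = T u" "restrict_fin (T u) = T u"
  using assms unfolding linop_def op_of_def restrict_fin_def by (auto simp: fun_eq_iff)

lemma linop_add [intro]:
  assumes "linop T" "linop S" shows "linop (\<lambda>u. T u + S u)"
proof -
  obtain N M where "T = op_of N" "S = op_of M" using assms unfolding linop_def by blast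
  then have "(\<lambda>u. T u + S u) = op_of (\<lambda>k l. N k l + M k l)"
    unfolding op_of_def by (auto simp: fun_eq_iff sum.distrib algebra_simps)
  then show ?thesis by simp
qed

lemma linop_vscale [intro]:
  assumes "linop T" shows "linop (\<lambda>u. vscale c (T u))"
proof -
  obtain N where "T = op_of N" using assms unfolding linop_def by blast
  then have "(\<lambda>u. vscale c (T u)) = op_of (\<lambda>k l. c * N k l)"
    unfolding op_of_def vscale_def by (auto simp: fun_eq_iff sum_distrib_left algebra_simps)
  then show ?thesis by simp
qed

lemma linop_comp:
  assumes "linop T" "linop S" shows "linop (\<lambda>u. T (S u))"
proof -
  obtain N M where NM: "T = op_of N" "S = op_of M" using assms unfolding linop_def by blast
  have "T (S u) = op_of (\<lambda>k l. \<Sum>j\<in>F. N k j * M j l) u" for u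
  proof
    fix k
    have "(\<Sum>j\<in>F. N k j * (\<Sum>l\<in>F. M j l * u l)) = (\<Sum>l\<in>F. (\<Sum>j\<in>F. N k j * M j l) * u l)"
      unfolding sum_distrib_left sum_distrib_right
      by (subst sum.swap) (simp add: mult.assoc)
    then show "T (S u) k = op_of (\<lambda>k l. \<Sum>j\<in>F. N k j * M j l) u k"
      unfolding NM op_of_def by auto
  qed
  then show ?thesis unfolding linop_def by (auto simp: fun_eq_iff)
qed

lemma linop_restrict_fin [intro]: "linop restrict_fin"
proof -
  have "restrict_fin = op_of (\<lambda>k l. if k = l then 1 else 0)"
    unfolding restrict_fin_def op_of_def using finF by (auto simp: fun_eq_iff if_distrib[of "\<lambda>z. z * _"] cong: if_cong)
  then show ?thesis by simp
qed

lemma rank1_op_of: "rank1 g = op_of (\<lambda>k l. g k * cnj (g l))"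
  unfolding rank1_def op_of_def inner_fin_def vscale_def restrict_fin_def
  by (auto simp: fun_eq_iff sum_distrib_left algebra_simps)

lemma linop_rank1 [intro]: "linop (rank1 g)"
  unfolding rank1_op_of by simp

lemma hermitian_opD: "hermitian_op T \<Longrightarrow> linop T" "hermitian_op T \<Longrightarrow> inner_fin (T u) w = inner_fin u (T w)"
  unfolding hermitian_op_def by auto

lemma hermitian_op_add [intro]: "hermitian_op T \<Longrightarrow> hermitian_op S \<Longrightarrow> hermitian_op (\<lambda>u. T u + S u)"
  unfolding hermitian_op_def by (auto simp: inner_fin_simps)

lemma hermitian_op_vscale [intro]: "hermitian_op T \<Longrightarrow> hermitian_op (\<lambda>u. vscale (of_real c) (T u))"
  unfolding hermitian_op_def by (auto simp: inner_fin_simps)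

lemma hermitian_op_restrict_fin [intro]: "hermitian_op restrict_fin"
  unfolding hermitian_op_def by auto

lemma hermitian_op_rank1 [intro]: "hermitian_op (rank1 g)"
  unfolding hermitian_op_def
  by (auto simp: rank1_def inner_fin_simps inner_fin_cnj)

lemma hermitian_op_op_of:
  assumes "\<And>k l. k \<in> F \<Longrightarrow> l \<in> F \<Longrightarrow> N k l = cnj (N l k)"
  shows "hermitian_op (op_of N)"
proof -
  have "inner_fin u (op_of N w) = inner_fin (op_of N u) w" for u w
  proof -
    have "inner_fin u (op_of N w) = (\<Sum>k\<in>F. \<Sum>l\<in>F. cnj (u k) * N k l * w l)"
      unfolding inner_fin_def op_of_def by (simp add: sum_distrib_left mult.assoc)
    also have "\<dots> = (\<Sum>l\<in>F. \<Sum>k\<in>F. cnj (u k) * N k l * w l)" by (rule sum.swap)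
    also have "\<dots> = (\<Sum>l\<in>F. \<Sum>k\<in>F. cnj (N l k) * cnj (u k) * w l)"
    proof (intro sum.cong refl)
      fix k l assume "k \<in> F" "l \<in> F"
      then show "cnj (u k) * N k l * w l = cnj (N l k) * cnj (u k) * w l"
        using assms[of k l] by simp
    qed
    also have "\<dots> = inner_fin (op_of N u) w"
      unfolding inner_fin_def op_of_def by (simp add: sum_distrib_right)
    finally show ?thesis .
  qed
  then show ?thesis unfolding hermitian_op_def by simp
qed

lemma qform_add: "qform (\<lambda>u. T u + S u) u = qform T u + qform S u"
  unfolding qform_def by (simp add: inner_fin_simps)

lemma qform_vscale: "qform (\<lambda>u. vscale (of_real c) (T u)) u = c * qform T u"
  unfolding qform_def by (simp add: inner_fin_simps)

lemma qform_restrict_fin: "qform restrict_fin u = normsq u"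
  unfolding qform_def by (simp add: inner_fin_self)

lemma qform_rank1: "qform (rank1 g) u = (cmod (inner_fin g u))\<^sup>2"
proof -
  have "inner_fin u (rank1 g u) = inner_fin g u * cnj (inner_fin g u)"
    unfolding rank1_def by (simp add: inner_fin_simps inner_fin_cnj)
  then show ?thesis unfolding qform_def by (simp add: complex_norm_square[symmetric])
qed

lemma hermitian_op_qform: "hermitian_op T \<Longrightarrow> inner_fin u (T u) = of_real (qform T u)"
proof -
  assume "hermitian_op T"
  then have "cnj (inner_fin u (T u)) = inner_fin u (T u)" by (simp add: inner_fin_cnj hermitian_opD)
  then show ?thesis unfolding qform_def by (simp add: Reals_cnj_iff)
qed

lemma pos_semidefD: "pos_semidef T \<Longrightarrow> hermitian_op T" "pos_semidef T \<Longrightarrow> 0 \<le> qform T u"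
  unfolding pos_semidef_def by auto

lemma qform_line:
  assumes "hermitian_op T"
  shows "qform T (u + vscale c w) = qform T u + 2 * Re (c * inner_fin u (T w)) + (cmod c)\<^sup>2 * qform T w"
proof -
  note L = linop_add_arg[OF hermitian_opD(1)[OF assms]] linop_vscale_arg[OF hermitian_opD(1)[OF assms]]
  have *: "inner_fin w (T u) = cnj (inner_fin u (T w))"
    using assms by (simp add: inner_fin_cnj hermitian_opD)
  have "inner_fin (u + vscale c w) (T (u + vscale c w)) = inner_fin u (T u) + c * inner_fin u (T w) + cnj (c * inner_fin u (T w)) + c * cnj c * inner_fin w (T w)"
    by (simp add: L inner_fin_simps * algebra_simps)
  then show ?thesis
    unfolding qform_def[of T] by (simp add: hermitian_op_qform[OF assms] complex_norm_square[symmetric] del: of_real_power complex_cnj_mult)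
qed

lemma pos_semidef_Cauchy_Schwarz:
  assumes "pos_semidef T"
  shows "(cmod (inner_fin u (T w)))\<^sup>2 \<le> qform T u * qform T w"
proof -
  \<comment> \<open>The discriminant argument, for multipliers that are real multiples of \<open>cnj z\<close>.\<close>
  define z where "z = inner_fin u (T w)"
  have key: "0 \<le> qform T u + 2 * Re (c * z) + (cmod c)\<^sup>2 * qform T w" for c
    using pos_semidefD(2)[OF assms] qform_line[OF pos_semidefD(1)[OF assms]] unfolding z_def by metis
  have w0: "0 \<le> qform T w" "0 \<le> qform T u" using pos_semidefD(2)[OF assms] by auto
  have key2: "0 \<le> qform T u - 2 * s * (cmod z)\<^sup>2 + s\<^sup>2 * (cmod z)\<^sup>2 * qform T w" for s :: real
  proof -
    have "Re (- (of_real s) * cnj z * z) = - s * (cmod z)\<^sup>2"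
      by (simp add: complex_norm_square[symmetric] mult.assoc mult.commute[of "cnj z"] del: of_real_power)
    moreover have "(cmod (- (of_real s) * cnj z))\<^sup>2 = s\<^sup>2 * (cmod z)\<^sup>2"
      by (simp add: norm_mult power_mult_distrib)
    ultimately show ?thesis using key[of "- (of_real s) * cnj z"] by simp
  qed
  show ?thesis
  proof (cases "qform T w = 0")
    case True
    show ?thesis
    proof (rule ccontr)
      assume "\<not> ?thesis"
      then have "(cmod z)\<^sup>2 > 0" using True unfolding z_def by simp
      then show False using key2[of "(qform T u + 1) / (cmod z)\<^sup>2"] True w0 by simp
    qed
  next
    case False
    then have p: "qform T w > 0" using w0 by simp
    have "0 \<le> qform T u - (cmod z)\<^sup>2 / qform T w"
      using key2[of "1 / qform T w"] p by (simp add: field_simps power2_eq_square)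
    then show ?thesis using p unfolding z_def by (simp add: field_simps)
  qed
qed

lemma Cauchy_Schwarz: "(cmod (inner_fin u w))\<^sup>2 \<le> normsq u * normsq w"
proof -
  have "pos_semidef restrict_fin" unfolding pos_semidef_def by (auto simp: qform_restrict_fin)
  from pos_semidef_Cauchy_Schwarz[OF this, of u w] show ?thesis by (simp add: qform_restrict_fin)
qed

lemma pos_semidef_vscale [intro]: "pos_semidef T \<Longrightarrow> 0 \<le> c \<Longrightarrow> pos_semidef (\<lambda>u. vscale (of_real c) (T u))"
  unfolding pos_semidef_def by (auto simp: qform_vscale)

text \<open>
  The solutions for the unit vectors form a right inverse. It is Hermitian because the operator is, and
  a left inverse because a definite operator is injective.
\<close>

lemma positive_definite_inverse:
  assumes "hermitian_op X" and pos: "\<And>u. normsq u > 0 \<Longrightarrow> qform X u > 0"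
  shows "\<exists>R. inv_pair X R"
proof -
  obtain N where N: "X = op_of N" using assms unfolding hermitian_op_def linop_def by blast
  have "(\<Sum>k\<in>F. cnj (t k) * (\<Sum>l\<in>F. N k l * t l)) \<noteq> 0" if "\<exists>k\<in>F. t k \<noteq> 0" for t
  proof -
    have "restrict_fin t \<noteq> 0" using that by (auto simp: restrict_fin_def fun_eq_iff)
    then have "normsq t > 0" using normsq_eq_0[of t] normsq_nonneg[of t] by linarith
    then have "inner_fin t (X t) \<noteq> 0" using pos[of t] unfolding qform_def by auto
    then show ?thesis unfolding N inner_fin_def op_of_def by simp
  qed
  note solv = definite_solvable[of F N, OF finF this]
  have "\<forall>j. \<exists>w. \<forall>k\<in>F. (\<Sum>l\<in>F. N k l * w l) = (if k = j then 1 else 0)"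
    using solv by simp
  then obtain W where W: "\<And>j k. k \<in> F \<Longrightarrow> (\<Sum>l\<in>F. N k l * W j l) = (if k = j then 1 else 0)" by metis
  define R where "R = op_of (\<lambda>l j. W j l)"
  have XR: "X (R u) = restrict_fin u" for u
  proof
    fix k
    show "X (R u) k = restrict_fin u k"
    proof (cases "k \<in> F")
      case True
      have "X (R u) k = (\<Sum>l\<in>F. \<Sum>j\<in>F. N k l * W j l * u j)"
        unfolding N R_def op_of_def using True by (simp add: sum_distrib_left mult.assoc)
      also have "\<dots> = (\<Sum>j\<in>F. (\<Sum>l\<in>F. N k l * W j l) * u j)"
        by (subst sum.swap) (simp add: sum_distrib_right)
      also have "\<dots> = (\<Sum>j\<in>F. (if k = j then u j else 0))"
        using W[OF True] by (intro sum.cong) auto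
      also have "\<dots> = u k" using True finF by simp
      finally show ?thesis using True by (simp add: restrict_fin_def)
    qed (simp add: N op_of_def restrict_fin_def)
  qed
  have lR: "linop R" unfolding R_def by simp
  have hR: "inner_fin u (R w) = inner_fin (R u) w" for u w
  proof -
    have "inner_fin (R u) w = inner_fin (R u) (X (R w))" by (simp add: XR)
    also have "\<dots> = inner_fin (X (R u)) (R w)" using assms(1) by (simp add: hermitian_opD)
    also have "\<dots> = inner_fin u (R w)" by (simp add: XR)
    finally show ?thesis by simp
  qed
  have inj: "restrict_fin u = 0" if "X u = 0" for u
  proof -
    have "qform X u = 0" using that unfolding qform_def inner_fin_def by simp
    then have "normsq u = 0" using pos[of u] normsq_nonneg[of u] by linarith
    then show ?thesis by (simp add: normsq_eq_0)
  qed
  have RX: "R (X u) = restrict_fin u" for u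
  proof -
    note lX = hermitian_opD(1)[OF assms(1)]
    have "X (R (X u) + vscale (-1) u) = 0"
      by (simp add: linop_add_arg[OF lX] linop_vscale_arg[OF lX] XR linop_restrict_fin_arg[OF lX]) (simp add: vscale_def fun_eq_iff)
    from inj[OF this] have "restrict_fin (R (X u)) = restrict_fin u"
      by (auto simp: restrict_fin_def vscale_def fun_eq_iff split: if_splits)
    then show ?thesis using linop_restrict_fin_arg[OF lR] by simp
  qed
  have "0 \<le> qform R u" for u
  proof -
    have "qform R u = qform X (R u)"
      unfolding qform_def by (simp add: XR) (metis hR inner_fin_cnj complex_cnj(1) complex.sel(1) cnj.sel(1))
    moreover have "0 \<le> qform X (R u)"
    proof (cases "normsq (R u) = 0")
      case True
      then have "R u = 0" using linop_restrict_fin_arg[OF lR] normsq_eq_0 by simp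
      then show ?thesis unfolding qform_def inner_fin_def by simp
    next
      case False
      then show ?thesis using pos[of "R u"] normsq_nonneg[of "R u"] by linarith
    qed
    ultimately show ?thesis by simp
  qed
  then have "inv_pair X R" unfolding inv_pair_def pos_semidef_def hermitian_op_def[of R] using assms(1) lR hR XR RX by auto
  then show ?thesis by blast
qed

end

context fin_index begin

lemma inv_pair_qform: assumes "inv_pair X R" shows "qform R (X u) = qform X u"
  using assms unfolding inv_pair_def qform_def
  by (metis hermitian_opD(2) inner_fin_restrict_fin(2) pos_semidefD(1))

lemma inv_pair_pos_semidef: "inv_pair X R \<Longrightarrow> pos_semidef X"
  using inv_pair_qform[of X R] unfolding inv_pair_def pos_semidef_def by metis

lemma inv_pair_pos:
  assumes "inv_pair X R" "normsq u > 0" shows "qform X u > 0"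
proof -
  have X: "pos_semidef X" using inv_pair_pos_semidef[OF assms(1)] .
  have "(cmod (inner_fin (R u) (X u)))\<^sup>2 \<le> qform X (R u) * qform X u"
    by (rule pos_semidef_Cauchy_Schwarz[OF X])
  moreover have "inner_fin (R u) (X u) = of_real (normsq u)"
    using assms(1) unfolding inv_pair_def by (metis hermitian_opD(2) inner_fin_restrict_fin(1) inner_fin_self)
  ultimately have "0 < qform X (R u) * qform X u" using assms(2)
    by (smt (verit) norm_of_real zero_less_power abs_of_pos)
  then show ?thesis using pos_semidefD(2)[OF X] by (metis less_eq_real_def mult_zero_right)
qed

text \<open>
  This is the Sherman-Morrison formula. For negative \<open>\<tau>\<close> the positivity of the new inverse comes from
  the Cauchy-Schwarz inequality for the form of \<open>S\<close>.
\<close>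

lemma inv_pair_rank1_update:
  fixes \<tau> :: real
  assumes "inv_pair Y S" and pos: "0 < 1 + \<tau> * qform S g"
  shows "inv_pair (\<lambda>u. Y u + vscale (of_real \<tau>) (rank1 g u))
                  (\<lambda>u. S u + vscale (of_real (- \<tau> / (1 + \<tau> * qform S g))) (rank1 (S g) u))"
    (is "inv_pair ?Y ?S")
proof -
  have hY: "hermitian_op Y" and pS: "pos_semidef S" and YS: "\<And>u. Y (S u) = restrict_fin u" and SY: "\<And>u. S (Y u) = restrict_fin u"
    using assms(1) unfolding inv_pair_def by auto
  have hS: "hermitian_op S" using pS pos_semidefD by blast
  define s where "s = qform S g"
  \<comment> \<open>The coefficient is determined by \<open>c + \<tau> + c \<tau> s = 0\<close>, which is all that both products need.\<close>
  define c where "c = - \<tau> / (1 + \<tau> * s)"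
  have c: "c * (1 + \<tau> * s) = - \<tau>" using pos by (simp add: c_def s_def)
  have c': "of_real c + of_real \<tau> + of_real (c * \<tau> * s) = (0::complex)"
  proof -
    have "c + \<tau> + c * \<tau> * s = 0" using c by (simp add: algebra_simps)
    then show ?thesis by (metis of_real_0 of_real_add)
  qed
  note lin = linop_add_arg[OF hermitian_opD(1)] linop_vscale_arg[OF hermitian_opD(1)] linop_restrict_fin_arg[OF hermitian_opD(1)]
  have gSg: "inner_fin g (S g) = of_real s" unfolding s_def by (rule hermitian_op_qform[OF hS])
  have Sgr: "restrict_fin (S g) = S g" using lin(4)[OF hS] .
  have e: "vscale (of_real \<tau>) (vscale z (restrict_fin g)) + (vscale (of_real c) (vscale z (restrict_fin g)) + vscale (of_real \<tau>) (vscale (of_real c * (z * of_real s)) (restrict_fin g))) = 0" for z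
  proof
    fix k
    have "(vscale (of_real \<tau>) (vscale z (restrict_fin g)) + (vscale (of_real c) (vscale z (restrict_fin g)) + vscale (of_real \<tau>) (vscale (of_real c * (z * of_real s)) (restrict_fin g)))) k
      = (of_real c + of_real \<tau> + of_real (c * \<tau> * s)) * (z * restrict_fin g k)"
      unfolding vscale_def by (simp add: algebra_simps)
    then show "(vscale (of_real \<tau>) (vscale z (restrict_fin g)) + (vscale (of_real c) (vscale z (restrict_fin g)) + vscale (of_real \<tau>) (vscale (of_real c * (z * of_real s)) (restrict_fin g)))) k = 0 k"
      by (simp only: c' mult_zero_left zero_fun_apply)
  qed
  have A: "?Y (?S u) = restrict_fin u" for u
  proof -
    have "?Y (?S u) = restrict_fin u + (vscale (of_real \<tau>) (vscale (inner_fin g (S u)) (restrict_fin g)) + (vscale (of_real c) (vscale (inner_fin g (S u)) (restrict_fin g)) + vscale (of_real \<tau>) (vscale (of_real c * (inner_fin g (S u) * of_real s)) (restrict_fin g))))"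
      unfolding s_def[symmetric] c_def[symmetric]
      by (simp add: lin hY hS YS rank1_def inner_fin_simps Sgr gSg hermitian_opD(2)[OF hS])
        (simp add: vscale_def fun_eq_iff algebra_simps)
    then show ?thesis by (simp add: e)
  qed
  have e2: "vscale (of_real \<tau>) (vscale z (S g)) + (vscale (of_real c) (vscale z (S g)) + vscale (of_real c) (vscale (of_real \<tau> * (z * of_real s)) (S g))) = 0" for z
  proof
    fix k
    have "(vscale (of_real \<tau>) (vscale z (S g)) + (vscale (of_real c) (vscale z (S g)) + vscale (of_real c) (vscale (of_real \<tau> * (z * of_real s)) (S g)))) k
      = (of_real c + of_real \<tau> + of_real (c * \<tau> * s)) * (z * S g k)"
      unfolding vscale_def by (simp add: algebra_simps)
    then show "(vscale (of_real \<tau>) (vscale z (S g)) + (vscale (of_real c) (vscale z (S g)) + vscale (of_real c) (vscale (of_real \<tau> * (z * of_real s)) (S g)))) k = 0 k"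
      by (simp only: c' mult_zero_left zero_fun_apply)
  qed
  have B: "?S (?Y u) = restrict_fin u" for u
  proof -
    have "?S (?Y u) = restrict_fin u + (vscale (of_real \<tau>) (vscale (inner_fin g u) (S g)) + (vscale (of_real c) (vscale (inner_fin g u) (S g)) + vscale (of_real c) (vscale (of_real \<tau> * (inner_fin g u * of_real s)) (S g))))"
      unfolding s_def[symmetric] c_def[symmetric]
      by (simp add: lin hY hS SY rank1_def inner_fin_simps Sgr gSg hermitian_opD(2)[OF hS])
        (simp add: vscale_def fun_eq_iff algebra_simps)
    then show ?thesis by (simp add: e2)
  qed
  have "0 \<le> qform ?S u" for u
  proof -
    have q: "qform ?S u = qform S u + c * (cmod (inner_fin (S g) u))\<^sup>2"
      unfolding c_def s_def by (simp only: qform_add qform_vscale qform_rank1)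
    have cs: "(cmod (inner_fin (S g) u))\<^sup>2 \<le> s * qform S u"
      using pos_semidef_Cauchy_Schwarz[OF pS, of g u] hermitian_opD(2)[OF hS, of g u] unfolding s_def by simp
    have nn: "0 \<le> qform S u" using pos_semidefD(2)[OF pS] .
    show ?thesis
    proof (cases "0 \<le> c")
      case True then show ?thesis unfolding q using nn by simp
    next
      case False
      have "c * (cmod (inner_fin (S g) u))\<^sup>2 \<ge> c * (s * qform S u)"
        using cs False by (intro mult_left_mono_neg) auto
      moreover have "qform S u + c * (s * qform S u) = qform S u * (1 + c * s)" by (simp add: algebra_simps)
      moreover have "1 + c * s = 1 / (1 + \<tau> * s)" using pos
        by (simp add: c_def s_def field_simps)
      moreover have "0 \<le> 1 / (1 + \<tau> * s)" using pos unfolding s_def by simp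
      ultimately show ?thesis unfolding q using nn by (smt (verit) mult_nonneg_nonneg)
    qed
  qed
  then show ?thesis
    unfolding inv_pair_def pos_semidef_def
    using A B hermitian_op_add[OF hY hermitian_op_vscale[OF hermitian_op_rank1]] hermitian_op_add[OF hS hermitian_op_vscale[OF hermitian_op_rank1]]
    by (intro conjI allI)
qed

end

section \<open>Gram operators and the potential\<close>

locale gram = fin_index F for F :: "'k set" +
  fixes \<mu> :: "'x measure" and v :: "'k \<Rightarrow> 'x \<Rightarrow> complex"
  assumes sqi: "\<And>k. k \<in> F \<Longrightarrow> square_integrable \<mu> (v k)"
begin

abbreviation vec :: "'x \<Rightarrow> 'k \<Rightarrow> complex" where "vec x \<equiv> \<lambda>k. v k x"

definition H :: "('k \<Rightarrow> complex) \<Rightarrow> 'k \<Rightarrow> complex" where "H = op_of (integral_gram \<mu> v)"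

text \<open>
  This is the trace of \<open>T H\<close>; for the inverse of a positive operator it is the barrier potential. In
  the form of an integral it is visibly linear, and monotone in the quadratic form of \<open>T\<close>.
\<close>

definition \<phi> :: "(('k \<Rightarrow> complex) \<Rightarrow> 'k \<Rightarrow> complex) \<Rightarrow> real" where
  "\<phi> T = (LINT x|\<mu>. qform T (vec x))"

end

lemma gram_hermitian: "integral_gram \<mu> b k l = cnj (integral_gram \<mu> b l k)"
proof -
  have "cnj (integral_gram \<mu> b l k) = (LINT x|\<mu>. cnj (b l x * cnj (b k x)))"
    unfolding integral_gram_def by (simp only: Bochner_Integration.integral_cnj)
  then show ?thesis unfolding integral_gram_def by (simp add: mult.commute)
qed

lemma square_integrable_product:
  assumes "square_integrable \<mu> f" "square_integrable \<mu> g"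
  shows "integrable \<mu> (\<lambda>x. f x * cnj (g x))"
proof (rule Bochner_Integration.integrable_bound)
  show "integrable \<mu> (\<lambda>x. (cmod (f x))\<^sup>2 + (cmod (g x))\<^sup>2)"
    using assms unfolding square_integrable_def by auto
  have [measurable]: "f \<in> borel_measurable \<mu>" "g \<in> borel_measurable \<mu>"
    using assms unfolding square_integrable_def by auto
  have "cnj \<in> borel_measurable borel"
    by (intro borel_measurable_continuous_onI continuous_on_cnj continuous_on_id)
  then have [measurable]: "(\<lambda>x. cnj (g x)) \<in> borel_measurable \<mu>"
    by (rule measurable_compose[rotated]) measurable
  show "(\<lambda>x. f x * cnj (g x)) \<in> borel_measurable \<mu>" by measurable
  show "AE x in \<mu>. norm (f x * cnj (g x)) \<le> norm ((cmod (f x))\<^sup>2 + (cmod (g x))\<^sup>2)"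
  proof (intro AE_I2)
    fix x
    have "2 * (cmod (f x) * cmod (g x)) \<le> (cmod (f x))\<^sup>2 + (cmod (g x))\<^sup>2"
      using sum_squares_bound[of "cmod (f x)" "cmod (g x)"] by simp
    moreover have "0 \<le> cmod (f x) * cmod (g x)" by simp
    ultimately have "cmod (f x) * cmod (g x) \<le> (cmod (f x))\<^sup>2 + (cmod (g x))\<^sup>2" by linarith
    then show "norm (f x * cnj (g x)) \<le> norm ((cmod (f x))\<^sup>2 + (cmod (g x))\<^sup>2)"
      by (simp add: norm_mult)
  qed
qed

context gram begin

lemma prod_integrable:
  "k \<in> F \<Longrightarrow> l \<in> F \<Longrightarrow> integrable \<mu> (\<lambda>x. v k x * cnj (v l x))"
  using sqi by (intro square_integrable_product)

lemma form_integrable: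
  "integrable \<mu> (\<lambda>x. inner_fin (vec x) (op_of N (vec x)))"
  "(LINT x|\<mu>. inner_fin (vec x) (op_of N (vec x))) = (\<Sum>k\<in>F. \<Sum>l\<in>F. N k l * integral_gram \<mu> v l k)"
proof -
  have e: "inner_fin (vec x) (op_of N (vec x)) = (\<Sum>k\<in>F. \<Sum>l\<in>F. N k l * (v l x * cnj (v k x)))" for x
    unfolding inner_fin_def op_of_def by (simp add: sum_distrib_left algebra_simps)
  have "has_bochner_integral \<mu> (\<lambda>x. \<Sum>k\<in>F. \<Sum>l\<in>F. N k l * (v l x * cnj (v k x)))
          (\<Sum>k\<in>F. \<Sum>l\<in>F. N k l * integral_gram \<mu> v l k)"
    unfolding integral_gram_def
    by (intro has_bochner_integral_sum has_bochner_integral_mult_right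
        has_bochner_integral_integrable prod_integrable)
  then show "integrable \<mu> (\<lambda>x. inner_fin (vec x) (op_of N (vec x)))"
    "(LINT x|\<mu>. inner_fin (vec x) (op_of N (vec x))) = (\<Sum>k\<in>F. \<Sum>l\<in>F. N k l * integral_gram \<mu> v l k)"
    unfolding e has_bochner_integral_iff by auto
qed

lemma qform_integrable:
  assumes "linop T" shows "integrable \<mu> (\<lambda>x. qform T (vec x))"
  using assms form_integrable(1) unfolding linop_def qform_def by auto

lemma \<phi>_add: "linop T \<Longrightarrow> linop S \<Longrightarrow> \<phi> (\<lambda>u. T u + S u) = \<phi> T + \<phi> S"
  unfolding \<phi>_def qform_add by (simp add: qform_integrable)

lemma \<phi>_vscale: "\<phi> (\<lambda>u. vscale (of_real c) (T u)) = c * \<phi> T"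
  unfolding \<phi>_def qform_vscale by simp

lemma \<phi>_nonneg: "(\<And>u. 0 \<le> qform T u) \<Longrightarrow> 0 \<le> \<phi> T"
  unfolding \<phi>_def by (simp add: integral_nonneg)

lemma \<phi>_rank1: "\<phi> (rank1 g) = qform H g"
proof -
  note g = rank1_op_of[of g]
  have "\<phi> (rank1 g) = Re (LINT x|\<mu>. inner_fin (vec x) (rank1 g (vec x)))"
    unfolding \<phi>_def qform_def by (intro integral_Re) (simp add: g form_integrable)
  also have "\<dots> = Re (\<Sum>k\<in>F. \<Sum>l\<in>F. g k * cnj (g l) * integral_gram \<mu> v l k)"
    unfolding g form_integrable(2) ..
  also have "(\<Sum>k\<in>F. \<Sum>l\<in>F. g k * cnj (g l) * integral_gram \<mu> v l k) = inner_fin g (H g)"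
    unfolding inner_fin_def H_def op_of_def
    by (subst sum.swap) (simp add: sum_distrib_left algebra_simps)
  finally show ?thesis unfolding qform_def .
qed

lemma qform_H: "qform H u = (LINT x|\<mu>. (cmod (inner_fin u (vec x)))\<^sup>2)"
  using \<phi>_rank1[of u] unfolding \<phi>_def by (simp add: qform_rank1)

lemma qform_H_integrable: "integrable \<mu> (\<lambda>x. (cmod (inner_fin u (vec x)))\<^sup>2)"
  using qform_integrable[OF linop_rank1, of u] by (simp add: qform_rank1)

lemma H_unit:
  assumes "k \<in> F" "l \<in> F"
  shows "H (\<lambda>i. if i = l then 1 else 0) k = integral_gram \<mu> v k l"
  unfolding H_def op_of_def using assms finF
  by (simp add: if_distrib[of "\<lambda>z. _ * z"] cong: if_cong)

lemma pos_semidef_H: "pos_semidef H"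
proof -
  have "hermitian_op H" unfolding H_def by (rule hermitian_op_op_of) (rule gram_hermitian)
  then show ?thesis unfolding pos_semidef_def by (simp add: qform_H integral_nonneg)
qed

text \<open>
  This is the trace of the identity; it makes the dimension enter the initial potential of the lower
  barrier.
\<close>

lemma \<phi>_inverse_H:
  assumes "linop R" "\<And>u. R (H u) = restrict_fin u"
  shows "\<phi> R = card F"
proof -
  obtain N where N: "R = op_of N" using assms(1) unfolding linop_def by blast
  have d: "(\<Sum>l\<in>F. N k l * integral_gram \<mu> v l k) = 1" if k: "k \<in> F" for k
  proof -
    have "R (H (\<lambda>j. if j = k then 1 else 0)) k = 1"
      unfolding assms(2) using k by (simp add: restrict_fin_def)
    moreover have "H (\<lambda>j. if j = k then 1 else 0) = (\<lambda>l. if l \<in> F then integral_gram \<mu> v l k else 0)"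
      unfolding H_def op_of_def using k finF by (auto simp: fun_eq_iff if_distrib cong: if_cong)
    ultimately show ?thesis using k unfolding N op_of_def by simp
  qed
  have "\<phi> R = Re (LINT x|\<mu>. inner_fin (vec x) (R (vec x)))"
    unfolding \<phi>_def qform_def by (intro integral_Re) (simp add: N form_integrable)
  also have "\<dots> = Re (\<Sum>k\<in>F. 1)" unfolding N form_integrable(2) using d by simp
  finally show ?thesis by simp
qed

end

section \<open>Moving a barrier along the Gram operator\<close>

locale pd_gram = gram F \<mu> v for F :: "'k set" and \<mu> :: "'x measure" and v +
  assumes neF: "F \<noteq> {}" and hpd: "\<And>u. normsq u > 0 \<Longrightarrow> qform H u > 0"
begin

lemma lin_H: "linop H" "hermitian_op H"
  using pos_semidef_H pos_semidefD hermitian_opD by auto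

text \<open>
  If the integral vanished, then \<open>S v(x)\<close>, and with it \<open>v(x)\<close>, would vanish almost everywhere,
  which a positive definite Gram operator excludes.
\<close>

lemma \<phi>_SHS_pos:
  assumes "inv_pair Y S"
  shows "0 < \<phi> (\<lambda>u. S (H (S u)))"
proof -
  have hY: "hermitian_op Y" and pS: "pos_semidef S" and YS: "\<And>u. Y (S u) = restrict_fin u"
    using assms(1) unfolding inv_pair_def by auto
  have q: "qform (\<lambda>u. S (H (S u))) u = qform H (S u)" for u
    unfolding qform_def using hermitian_opD(2)[OF pos_semidefD(1)[OF pS]] by simp
  have nn: "0 \<le> qform H u" for u using pos_semidefD(2)[OF pos_semidef_H] .
  show ?thesis
  proof (rule ccontr)
    assume "\<not> ?thesis"
    then have "(LINT x|\<mu>. qform H (S (vec x))) = 0"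
      using \<phi>_nonneg[of "\<lambda>u. S (H (S u))"] q nn unfolding \<phi>_def q by (meson order_antisym not_less)
    moreover have "integrable \<mu> (\<lambda>x. qform H (S (vec x)))"
      using qform_integrable[OF linop_comp[OF hermitian_opD(1)[OF pos_semidefD(1)[OF pS]] linop_comp[OF lin_H(1) hermitian_opD(1)[OF pos_semidefD(1)[OF pS]]]]]
      unfolding q .
    ultimately have ae: "AE x in \<mu>. qform H (S (vec x)) = 0"
      using nn by (simp add: integral_nonneg_eq_0_iff_AE)
    obtain k where k: "k \<in> F" using neF by blast
    let ?e = "\<lambda>j. if j = k then 1 else 0"
    have ne: "normsq ?e = 1" by (rule normsq_unit[OF k])
    have "AE x in \<mu>. (cmod (inner_fin ?e (vec x)))\<^sup>2 = 0"
      using ae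
    proof (rule AE_mp, intro AE_I2 impI)
      fix x assume "qform H (S (vec x)) = 0"
      then have "normsq (S (vec x)) = 0" using hpd[of "S (vec x)"] normsq_nonneg[of "S (vec x)"] by linarith
      then have "S (vec x) = 0"
        using linop_restrict_fin_arg(2)[OF hermitian_opD(1)[OF pos_semidefD(1)[OF pS]]] by (simp add: normsq_eq_0)
      then have "restrict_fin (vec x) = Y 0" using YS by metis
      also have "Y 0 = 0" using hermitian_opD(1)[OF hY] unfolding linop_def op_of_def by auto
      finally have "normsq (vec x) = 0" by (simp add: normsq_eq_0)
      then show "(cmod (inner_fin ?e (vec x)))\<^sup>2 = 0"
        using Cauchy_Schwarz[of ?e "vec x"] by simp
    qed
    then have "qform H ?e = 0" unfolding qform_H by (simp add: integral_eq_zero_AE)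
    then show False using hpd[of ?e] ne by simp
  qed
qed

end

context pd_gram begin

lemma resolvent_identity:
  assumes "inv_pair X R" "inv_pair Y S" and Y: "\<And>u. Y u = X u + vscale (of_real d) (H u)"
  shows "R u = S u + vscale (of_real d) (R (H (S u)))"
    and "R u = S u + vscale (of_real d) (S (H (R u)))"
proof -
  have R: "linop R" "\<And>u. X (R u) = restrict_fin u" "\<And>u. R (X u) = restrict_fin u"
    and S: "linop S" "\<And>u. Y (S u) = restrict_fin u" "\<And>u. S (Y u) = restrict_fin u"
    using assms(1,2) unfolding inv_pair_def pos_semidef_def hermitian_op_def by blast+
  note lin = linop_add_arg linop_vscale_arg linop_restrict_fin_arg
  have "R u = R (Y (S u))" by (simp add: S(2) lin[OF R(1)])
  also have "\<dots> = S u + vscale (of_real d) (R (H (S u)))"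
    unfolding Y by (simp add: lin[OF R(1)] R lin[OF S(1)])
  finally show "R u = S u + vscale (of_real d) (R (H (S u)))" .
  have "R u = S (Y (R u))" by (simp add: S(3) lin[OF R(1)])
  also have "\<dots> = S u + vscale (of_real d) (S (H (R u)))"
    unfolding Y by (simp add: lin[OF S(1)] R)
  finally show "R u = S u + vscale (of_real d) (S (H (R u)))" .
qed

lemma inv_pairD:
  assumes "inv_pair X R"
  shows "linop X" "hermitian_op X" "linop R" "hermitian_op R" "pos_semidef R"
  using assms unfolding inv_pair_def pos_semidef_def hermitian_op_def by auto

lemma qform_SHS:
  assumes "hermitian_op S" shows "qform (\<lambda>u. S (H (S u))) u = qform H (S u)"
  unfolding qform_def using hermitian_opD(2)[OF assms] by simp

lemma qform_SHRHS:
  assumes "hermitian_op S" shows "qform (\<lambda>u. S (H (R (H (S u))))) u = qform R (H (S u))"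
  unfolding qform_def using hermitian_opD(2)[OF assms] hermitian_opD(2)[OF lin_H(2)] by simp

text \<open>
  The resolvent identity \<open>R - S = d R H S = d S H R\<close>, integrated. The symmetric words \<open>S H S\<close> and
  \<open>S H R H S\<close> are the ones whose quadratic forms are visibly nonnegative.
\<close>

lemma potential_shift:
  assumes "inv_pair X R" "inv_pair Y S" and Y: "\<And>u. Y u = X u + vscale (of_real d) (H u)"
  shows "\<phi> R = \<phi> S + d * \<phi> (\<lambda>u. R (H (S u)))"
    and "\<phi> R = \<phi> S + d * \<phi> (\<lambda>u. S (H (R u)))"
    and "\<phi> (\<lambda>u. R (H (S u))) = \<phi> (\<lambda>u. S (H (S u))) + d * \<phi> (\<lambda>u. S (H (R (H (S u)))))"
proof -
  note lR = inv_pairD(3)[OF assms(1)] and lS = inv_pairD(3)[OF assms(2)] and lH = lin_H(1)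
  note res = resolvent_identity[OF assms]
  have l1: "linop (\<lambda>u. R (H (S u)))" by (rule linop_comp[OF lR linop_comp[OF lH lS]])
  have l2: "linop (\<lambda>u. S (H (R u)))" by (rule linop_comp[OF lS linop_comp[OF lH lR]])
  have l3: "linop (\<lambda>u. S (H (S u)))" by (rule linop_comp[OF lS linop_comp[OF lH lS]])
  have l4: "linop (\<lambda>u. S (H (R (H (S u)))))" by (rule linop_comp[OF lS linop_comp[OF lH l1]])
  have "\<phi> R = \<phi> (\<lambda>u. S u + vscale (of_real d) (R (H (S u))))"
    by (rule arg_cong[of _ _ \<phi>], rule ext, rule res(1))
  also have "\<dots> = \<phi> S + d * \<phi> (\<lambda>u. R (H (S u)))"
    using \<phi>_add[OF lS linop_vscale[OF l1]] \<phi>_vscale by simp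
  finally show "\<phi> R = \<phi> S + d * \<phi> (\<lambda>u. R (H (S u)))" .
  have "\<phi> R = \<phi> (\<lambda>u. S u + vscale (of_real d) (S (H (R u))))"
    by (rule arg_cong[of _ _ \<phi>], rule ext, rule res(2))
  also have "\<dots> = \<phi> S + d * \<phi> (\<lambda>u. S (H (R u)))"
    using \<phi>_add[OF lS linop_vscale[OF l2]] \<phi>_vscale by simp
  finally show "\<phi> R = \<phi> S + d * \<phi> (\<lambda>u. S (H (R u)))" .
  have "\<phi> (\<lambda>u. R (H (S u))) = \<phi> (\<lambda>u. S (H (S u)) + vscale (of_real d) (S (H (R (H (S u))))))"
    by (rule arg_cong[of _ _ \<phi>], rule ext, rule res(2))
  also have "\<dots> = \<phi> (\<lambda>u. S (H (S u))) + d * \<phi> (\<lambda>u. S (H (R (H (S u)))))"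
    using \<phi>_add[OF l3 linop_vscale[OF l4]] \<phi>_vscale by simp
  finally show "\<phi> (\<lambda>u. R (H (S u))) = \<phi> (\<lambda>u. S (H (S u))) + d * \<phi> (\<lambda>u. S (H (R (H (S u)))))" .
qed

lemma \<phi>_rank1_update:
  assumes "inv_pair Y S"
  shows "\<phi> (\<lambda>u. S u + vscale (of_real c) (rank1 (S g) u)) = \<phi> S + c * qform H (S g)"
  using \<phi>_add[OF inv_pairD(3)[OF assms] linop_vscale[OF linop_rank1]] \<phi>_vscale \<phi>_rank1 by simp

text \<open>
  By the resolvent identity the potential drops by \<open>d\<close> times the integral of \<open>R H S\<close>, and
  \<open>R H S - S H S = d S H R H S\<close> is positive semidefinite. The remaining drop compensates the growth
  caused by the next point.
\<close>

lemma upper_shift: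
  assumes XR: "inv_pair X R" and d: "0 < (d::real)"
  shows "\<exists>S. inv_pair (\<lambda>u. X u + vscale (of_real d) (H u)) S \<and> \<phi> S + d * \<phi> (\<lambda>u. S (H (S u))) \<le> \<phi> R"
proof -
  let ?Y = "\<lambda>u. X u + vscale (of_real d) (H u)"
  have "\<exists>S. inv_pair ?Y S"
  proof (rule positive_definite_inverse)
    show "hermitian_op ?Y" using hermitian_op_add[OF inv_pairD(2)[OF XR] hermitian_op_vscale[OF lin_H(2)]] .
    fix u assume "0 < normsq u"
    then show "0 < qform ?Y u"
      using inv_pair_pos[OF XR, of u] hpd[of u] d unfolding qform_add qform_vscale by (simp add: add_pos_pos)
  qed
  then obtain S where S: "inv_pair ?Y S" by blast
  have "0 \<le> \<phi> (\<lambda>u. S (H (R (H (S u)))))"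
    by (rule \<phi>_nonneg) (simp add: qform_SHRHS[OF inv_pairD(4)[OF S]] pos_semidefD(2)[OF inv_pairD(5)[OF XR]])
  then have "d * \<phi> (\<lambda>u. S (H (S u))) \<le> d * \<phi> (\<lambda>u. R (H (S u)))"
    using potential_shift(3)[OF XR S refl] d by (intro mult_left_mono) auto
  then show ?thesis using potential_shift(1)[OF XR S refl] S by auto
qed

text \<open>
  By the Sherman-Morrison formula the term \<open>- t g g\<^sup>*\<close> raises the potential by
  \<open>t q / (1 - t s)\<close>, where \<open>q\<close> and \<open>s\<close> are the forms of \<open>S H S\<close> and \<open>S\<close> at \<open>g\<close>; the condition says that
  this is at most \<open>D\<close>, the amount by which moving the barrier has lowered it.
\<close>

lemma upper_update:
  assumes S: "inv_pair Y S" and D: "0 < D" and t: "0 < t"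
    and small: "t * (qform H (S g) / D + qform S g) \<le> 1"
  shows "\<exists>R. inv_pair (\<lambda>u. Y u + vscale (of_real (- t)) (rank1 g u)) R \<and> \<phi> R \<le> \<phi> S + D"
proof -
  define q where "q = qform H (S g)"
  define s where "s = qform S g"
  have q0: "0 \<le> q" and s0: "0 \<le> s"
    using pos_semidefD(2)[OF pos_semidef_H] pos_semidefD(2)[OF inv_pairD(5)[OF S]] unfolding q_def s_def by auto
  have sm: "t * q \<le> D * (1 - t * s)"
    using small D unfolding q_def[symmetric] s_def[symmetric] by (simp add: field_simps)
  have "0 < 1 - t * s"
  proof (cases "q = 0")
    case True
    then have "normsq (S g) = 0" using hpd[of "S g"] normsq_nonneg[of "S g"] unfolding q_def by linarith
    then have "S g = 0" using linop_restrict_fin_arg(2)[OF inv_pairD(3)[OF S]] by (simp add: normsq_eq_0)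
    then have "s = 0" unfolding s_def qform_def inner_fin_def by simp
    then show ?thesis by simp
  next
    case False
    then have "0 < t * q" using q0 t by simp
    then have "0 < D * (1 - t * s)" using sm by linarith
    then show ?thesis using D by (simp add: zero_less_mult_iff)
  qed
  then have pos: "0 < 1 + (- t) * qform S g" unfolding s_def by simp
  note up = inv_pair_rank1_update[OF S pos]
  have "\<phi> (\<lambda>u. S u + vscale (of_real (- (- t) / (1 + - t * qform S g))) (rank1 (S g) u)) = \<phi> S + t * q / (1 - t * s)"
    by (subst \<phi>_rank1_update[OF S]) (simp add: q_def s_def)
  moreover have "t * q / (1 - t * s) \<le> D"
    using sm pos unfolding s_def by (simp add: field_simps)
  ultimately show ?thesis by - (intro exI conjI, rule up, linarith)
qed

text \<open>
  With \<open>p\<close> and \<open>g\<close> for the integrals of \<open>R H S\<close> and \<open>S H R H S\<close>, the resolvent identity gives a growth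
  of the potential by \<open>d p\<close> and the value \<open>p + d g\<close> for the integral of \<open>S H S\<close>. The claim thus becomes
  \<open>g / p \<ge> d p\<close>; it follows from the Cauchy-Schwarz inequality
  \<open>p\<^sup>2 \<le> g \<cdot> \<phi> R\<close> and \<open>d \<cdot> \<phi> R < 1\<close>.
\<close>

lemma lower_shift:
  assumes XR: "inv_pair X R" and d: "0 < (d::real)" and R1: "d * \<phi> R < 1"
    and XH: "\<And>u. qform H u \<le> \<phi> R * qform X u" and R0: "0 < \<phi> R"
  shows "\<exists>S. inv_pair (\<lambda>u. X u + vscale (of_real (- d)) (H u)) S \<and> \<phi> R < \<phi> S \<and>
     1 / d - \<phi> R \<le> \<phi> (\<lambda>u. S (H (S u))) / (\<phi> S - \<phi> R) - \<phi> S"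
proof -
  let ?Y = "\<lambda>u. X u + vscale (of_real (- d)) (H u)"
  have "\<exists>S. inv_pair ?Y S"
  proof (rule positive_definite_inverse)
    show "hermitian_op ?Y" using hermitian_op_add[OF inv_pairD(2)[OF XR] hermitian_op_vscale[OF lin_H(2)]] .
    fix u assume u: "0 < normsq u"
    have "d * qform H u \<le> d * (\<phi> R * qform X u)" using XH[of u] d by (intro mult_left_mono) auto
    also have "\<dots> < 1 * qform X u"
      unfolding mult.assoc[symmetric] using inv_pair_pos[OF XR u] R1 by (intro mult_strict_right_mono) auto
    finally show "0 < qform ?Y u" unfolding qform_add qform_vscale by simp
  qed
  then obtain S where S: "inv_pair ?Y S" by blast
  note lR = inv_pairD(3)[OF XR] and lS = inv_pairD(3)[OF S] and lH = lin_H(1)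
  note hR = inv_pairD(4)[OF XR] and hS = inv_pairD(4)[OF S] and hH = lin_H(2)
  define p where "p = \<phi> (\<lambda>u. R (H (S u)))"
  define g where "g = \<phi> (\<lambda>u. S (H (R (H (S u)))))"
  have E: "\<phi> S - \<phi> R = d * p" using potential_shift(1)[OF XR S refl] unfolding p_def by simp
  have p2: "\<phi> (\<lambda>u. S (H (R u))) = p"
    using potential_shift(2)[OF XR S refl] E d by simp
  have SHS: "\<phi> (\<lambda>u. S (H (S u))) = p + d * g"
    using potential_shift(3)[OF XR S refl] unfolding p_def g_def by simp
  have p0: "0 < p"
  proof -
    have SX: "X u = X u + vscale (of_real (- d)) (H u) + vscale (of_real d) (H u)" for u
      by (simp add: vscale_def fun_eq_iff)
    have "\<phi> (\<lambda>u. S (H (R u))) = \<phi> (\<lambda>u. R (H (R u))) + d * \<phi> (\<lambda>u. R (H (S (H (R u)))))"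
      by (rule potential_shift(3)[OF S XR SX])
    moreover have "0 \<le> \<phi> (\<lambda>u. R (H (S (H (R u)))))"
      by (rule \<phi>_nonneg) (simp add: qform_SHRHS[OF hR] pos_semidefD(2)[OF inv_pairD(5)[OF S]])
    ultimately show ?thesis using \<phi>_SHS_pos[OF XR] p2 d
      by (smt (verit) mult_nonneg_nonneg)
  qed
  \<comment> \<open>The form of \<open>R\<close> at \<open>H S v(x) - c v(x)\<close>, integrated.\<close>
  have CS: "0 \<le> g - 2 * c * p + c\<^sup>2 * \<phi> R" for c :: real
  proof -
    have lin: "linop (\<lambda>u. S (H (R (H (S u)))))" "linop (\<lambda>u. S (H (R u)))"
      using linop_comp[OF lS linop_comp[OF lH linop_comp[OF lR linop_comp[OF lH lS]]]]
        linop_comp[OF lS linop_comp[OF lH lR]] by auto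
    have e: "qform R (H (S u) + vscale (of_real (- c)) u) =
        qform (\<lambda>u. S (H (R (H (S u))))) u - 2 * c * qform (\<lambda>u. S (H (R u))) u + c\<^sup>2 * qform R u" for u
      unfolding qform_line[OF hR] qform_SHRHS[OF hS]
      by (simp add: qform_def hermitian_opD(2)[OF hS] hermitian_opD(2)[OF hH])
    have "0 \<le> (LINT x|\<mu>. qform (\<lambda>u. S (H (R (H (S u))))) (vec x) - 2 * c * qform (\<lambda>u. S (H (R u))) (vec x) + c\<^sup>2 * qform R (vec x))"
      unfolding e[symmetric] using pos_semidefD(2)[OF inv_pairD(5)[OF XR]] by (simp add: integral_nonneg)
    also have "\<dots> = g - 2 * c * p + c\<^sup>2 * \<phi> R"
      using qform_integrable[OF lin(1)] qform_integrable[OF lin(2)] qform_integrable[OF lR]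
      unfolding g_def p2[symmetric] \<phi>_def by simp
    finally show ?thesis .
  qed
  have "p\<^sup>2 \<le> g * \<phi> R"
  proof -
    have "0 \<le> g - p\<^sup>2 / \<phi> R"
      using CS[of "p / \<phi> R"] R0 by (simp add: field_simps power2_eq_square)
    then show ?thesis using R0 by (simp add: field_simps)
  qed
  then have "p / \<phi> R \<le> g / p" using R0 p0 by (simp add: field_simps power2_eq_square)
  moreover have "d * p \<le> p / \<phi> R"
    using mult_right_mono[OF less_imp_le[OF R1], of p] R0 p0 by (simp add: field_simps)
  moreover have "(p + d * g) / (d * p) = 1 / d + g / p" using d p0 by (simp add: field_simps)
  ultimately have "1 / d - \<phi> R \<le> \<phi> (\<lambda>u. S (H (S u))) / (\<phi> S - \<phi> R) - \<phi> S"
    unfolding E SHS using E by linarith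
  moreover have "\<phi> R < \<phi> S" using E p0 d by (smt (verit) mult_pos_pos)
  ultimately show ?thesis using S by blast
qed

lemma lower_update:
  assumes S: "inv_pair Y S" and E: "0 < E" and t: "0 < t"
    and large: "1 \<le> t * (qform H (S g) / E - qform S g)"
  shows "\<exists>R. inv_pair (\<lambda>u. Y u + vscale (of_real t) (rank1 g u)) R \<and> \<phi> R \<le> \<phi> S - E"
proof -
  define q where "q = qform H (S g)"
  define s where "s = qform S g"
  have s0: "0 \<le> s"
    using pos_semidefD(2)[OF inv_pairD(5)[OF S]] unfolding s_def by auto
  have lg: "E * (1 + t * s) \<le> t * q"
    using large E unfolding q_def[symmetric] s_def[symmetric] by (simp add: field_simps)
  have pos: "0 < 1 + t * qform S g" using s0 t unfolding s_def[symmetric] by (simp add: add_pos_nonneg)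
  note up = inv_pair_rank1_update[OF S pos]
  have "\<phi> (\<lambda>u. S u + vscale (of_real (- t / (1 + t * qform S g))) (rank1 (S g) u)) = \<phi> S - t * q / (1 + t * s)"
    by (subst \<phi>_rank1_update[OF S]) (simp add: q_def s_def)
  moreover have "E \<le> t * q / (1 + t * s)"
    using lg pos unfolding s_def by (simp add: field_simps)
  ultimately show ?thesis by - (intro exI conjI, rule up, linarith)
qed

text \<open>
  A bound on the potential bounds the operator from below by a multiple of the Gram operator: apply the
  Cauchy-Schwarz inequality for \<open>R\<close> to \<open>\<langle>v(x), u\<rangle> = \<langle>v(x), R X u\<rangle>\<close> and integrate over \<open>x\<close>.
\<close>

lemma H_le_potential:
  assumes XR: "inv_pair X R"
  shows "qform H u \<le> \<phi> R * qform X u"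
proof -
  have pR: "pos_semidef R" using inv_pairD(5)[OF XR] .
  have RX: "R (X w) = restrict_fin w" for w using XR unfolding inv_pair_def by simp
  have "qform H u \<le> (LINT x|\<mu>. qform R (vec x) * qform X u)"
    unfolding qform_H
  proof (rule integral_mono)
    show "integrable \<mu> (\<lambda>x. (cmod (inner_fin u (vec x)))\<^sup>2)" by (rule qform_H_integrable)
    show "integrable \<mu> (\<lambda>x. qform R (vec x) * qform X u)"
      using qform_integrable[OF inv_pairD(3)[OF XR]] by simp
    fix x
    have "cmod (inner_fin u (vec x)) = cmod (inner_fin (vec x) (R (X u)))"
      unfolding RX using inner_fin_cnj[of u "vec x"] by (metis complex_mod_cnj inner_fin_restrict_fin(2))
    then show "(cmod (inner_fin u (vec x)))\<^sup>2 \<le> qform R (vec x) * qform X u"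
      using pos_semidef_Cauchy_Schwarz[OF pR, of "vec x" "X u"] inv_pair_qform[OF XR] by simp
  qed
  then show ?thesis unfolding \<phi>_def by simp
qed

end

context gram begin

text \<open>
  The operator kept positive after the points and weights of a list, most recent first, have been
  used: the lower barrier has \<open>c = - \<delta>\<close> and \<open>s = 1\<close>, the upper one \<open>c = \<delta>\<close> and \<open>s = - 1\<close>.
\<close>

primrec barrier :: "(('k \<Rightarrow> complex) \<Rightarrow> 'k \<Rightarrow> complex) \<Rightarrow> real \<Rightarrow> real \<Rightarrow> (real \<times> 'x) list
    \<Rightarrow> ('k \<Rightarrow> complex) \<Rightarrow> 'k \<Rightarrow> complex" where
  "barrier X c s [] = X"
| "barrier X c s (p # h) =
     (\<lambda>u. barrier X c s h u + vscale (of_real c) (H u) + vscale (of_real (s * fst p)) (rank1 (vec (snd p)) u))"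

definition energy :: "(real \<times> 'x) list \<Rightarrow> ('k \<Rightarrow> complex) \<Rightarrow> real" where
  "energy h u = (\<Sum>p\<leftarrow>h. fst p * (cmod (inner_fin u (vec (snd p))))\<^sup>2)"

lemma qform_barrier:
  "qform (barrier X c s h) u = qform X u + of_nat (length h) * c * qform H u + s * energy h u"
proof (induction h)
  case Nil then show ?case by (simp add: energy_def)
next
  case (Cons p h)
  have "cmod (inner_fin (vec (snd p)) u) = cmod (inner_fin u (vec (snd p)))"
    by (metis complex_mod_cnj inner_fin_cnj)
  then have *: "qform (barrier X c s (p # h)) u
      = qform (barrier X c s h) u + c * qform H u + (s * fst p) * (cmod (inner_fin u (vec (snd p))))\<^sup>2"
    unfolding barrier.simps qform_add qform_vscale qform_rank1 by simp
  show ?case by (subst *, subst Cons.IH) (simp add: energy_def algebra_simps)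
qed

end

context pd_gram begin

lemma potential_pos:
  assumes "inv_pair X R" shows "0 < \<phi> R"
proof -
  obtain k where k: "k \<in> F" using neF by blast
  let ?e = "\<lambda>j. if j = k then 1 else 0"
  have "normsq ?e = 1" by (rule normsq_unit[OF k])
  then have "0 < qform H ?e" "0 < qform X ?e" using hpd[of ?e] inv_pair_pos[OF assms, of ?e] by auto
  then show ?thesis using H_le_potential[OF assms, of ?e]
    by (smt (verit) mult_nonpos_nonneg)
qed

lemma lower_barrier_step:
  assumes "inv_pair X R" "\<phi> R \<le> \<epsilon>" "0 < \<delta>" "\<delta> * \<epsilon> < 1"
  shows "\<exists>L. integrable \<mu> L \<and> 1 / \<delta> - \<epsilon> \<le> (LINT x|\<mu>. L x) \<and>
    (\<forall>x t. 0 < t \<longrightarrow> 1 \<le> t * L x \<longrightarrow>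
      (\<exists>R. inv_pair (\<lambda>u. X u + vscale (of_real (- \<delta>)) (H u) + vscale (of_real t) (rank1 (vec x) u)) R \<and> \<phi> R \<le> \<epsilon>))"
proof -
  have "\<delta> * \<phi> R < 1" using mult_left_mono[OF assms(2), of \<delta>] assms(3,4) by linarith
  from lower_shift[OF assms(1,3) this H_le_potential[OF assms(1)] potential_pos[OF assms(1)]]
  obtain S where S: "inv_pair (\<lambda>u. X u + vscale (of_real (- \<delta>)) (H u)) S" and E: "\<phi> R < \<phi> S"
    and int: "1 / \<delta> - \<phi> R \<le> \<phi> (\<lambda>u. S (H (S u))) / (\<phi> S - \<phi> R) - \<phi> S" by blast
  define L where "L = (\<lambda>x. qform H (S (vec x)) / (\<phi> S - \<phi> R) - qform S (vec x))"
  note lS = inv_pairD(3)[OF S]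
  have i1: "integrable \<mu> (\<lambda>x. qform H (S (vec x)))"
    using qform_integrable[OF linop_comp[OF lS linop_comp[OF lin_H(1) lS]]]
    unfolding qform_SHS[OF inv_pairD(4)[OF S]] .
  have e1: "(LINT x|\<mu>. qform H (S (vec x))) = \<phi> (\<lambda>u. S (H (S u)))"
    unfolding \<phi>_def qform_SHS[OF inv_pairD(4)[OF S]] ..
  have "integrable \<mu> L" unfolding L_def using i1 qform_integrable[OF lS] by simp
  moreover have "(LINT x|\<mu>. L x) = \<phi> (\<lambda>u. S (H (S u))) / (\<phi> S - \<phi> R) - \<phi> S"
    unfolding L_def using i1 qform_integrable[OF lS] e1 by (simp add: \<phi>_def)
  moreover have "\<exists>R. inv_pair (\<lambda>u. X u + vscale (of_real (- \<delta>)) (H u) + vscale (of_real t) (rank1 (vec x) u)) R \<and> \<phi> R \<le> \<epsilon>"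
    if "0 < t" "1 \<le> t * L x" for x t
    using lower_update[OF S _ that(1), of "\<phi> S - \<phi> R" "vec x"] that(2) E assms(2)
    unfolding L_def by force
  ultimately show ?thesis using int assms(2) by (intro exI[of _ L]) auto
qed

text \<open>
  The last term of the bound for the integral is the gain mentioned at the beginning. It is independent
  of the dimension: with \<open>f\<close> a unit vector and \<open>S \<ge> 1 / C\<close>, two applications of the Cauchy-Schwarz
  inequality for \<open>H\<close> give \<open>\<phi> (S H S) \<ge> (f\<^sup>* H S H f)\<^sup>2 / (f\<^sup>* H f)\<^sup>2\<close>, and
  \<open>f\<^sup>* H S H f \<ge> \<bar>H f\<bar>\<^sup>2 / C \<ge> (f\<^sup>* H f)\<^sup>2 / C\<close>.
\<close>

lemma upper_barrier_step:
  assumes X: "inv_pair X R" and "\<phi> R \<le> \<epsilon>" and d: "0 < \<delta>"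
    and bound: "\<And>u. qform X u + \<delta> * qform H u \<le> C * normsq u" and f: "normsq f = 1"
  shows "\<exists>U. integrable \<mu> U \<and> (\<forall>x. 0 \<le> U x) \<and>
    (LINT x|\<mu>. U x) \<le> 1 / \<delta> + \<epsilon> - \<delta> * (qform H f / C)\<^sup>2 \<and>
    (\<forall>x t. 0 < t \<longrightarrow> t * U x \<le> 1 \<longrightarrow>
      (\<exists>R. inv_pair (\<lambda>u. X u + vscale (of_real \<delta>) (H u) + vscale (of_real (- t)) (rank1 (vec x) u)) R \<and> \<phi> R \<le> \<epsilon>))"
proof -
  define Y where "Y = (\<lambda>u. X u + vscale (of_real \<delta>) (H u))"
  obtain S where S: "inv_pair Y S" and shift: "\<phi> S + \<delta> * \<phi> (\<lambda>u. S (H (S u))) \<le> \<phi> R"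
    using upper_shift[OF X d] unfolding Y_def by blast
  note lS = inv_pairD(3)[OF S] and hS = inv_pairD(4)[OF S] and pS = inv_pairD(5)[OF S]
  have SHS: "0 < \<phi> (\<lambda>u. S (H (S u)))" by (rule \<phi>_SHS_pos[OF S])
  define D where "D = \<phi> R - \<phi> S"
  have D: "\<delta> * \<phi> (\<lambda>u. S (H (S u))) \<le> D" using shift unfolding D_def by simp
  have D0: "0 < D" using D d SHS by (smt (verit) mult_pos_pos)
  define U where "U = (\<lambda>x. qform H (S (vec x)) / D + qform S (vec x))"
  have i1: "integrable \<mu> (\<lambda>x. qform H (S (vec x)))"
    using qform_integrable[OF linop_comp[OF lS linop_comp[OF lin_H(1) lS]]]
    unfolding qform_SHS[OF hS] .
  have e1: "(LINT x|\<mu>. qform H (S (vec x))) = \<phi> (\<lambda>u. S (H (S u)))"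
    unfolding \<phi>_def qform_SHS[OF hS] ..
  have iU: "integrable \<mu> U" unfolding U_def using i1 qform_integrable[OF lS] by simp
  have "(LINT x|\<mu>. U x) = \<phi> (\<lambda>u. S (H (S u))) / D + \<phi> S"
    unfolding U_def using i1 qform_integrable[OF lS] e1 by (simp add: \<phi>_def)
  also have "\<dots> \<le> 1 / \<delta> + \<phi> S" using D D0 d by (simp add: field_simps)
  finally have intU: "(LINT x|\<mu>. U x) \<le> 1 / \<delta> + \<epsilon> - \<delta> * \<phi> (\<lambda>u. S (H (S u)))"
    using shift assms(2) by linarith
  have U0: "0 \<le> U x" for x unfolding U_def using pos_semidefD(2)[OF pos_semidef_H] pos_semidefD(2)[OF pS] D0 by simp
  have step: "\<exists>R. inv_pair (\<lambda>u. Y u + vscale (of_real (- t)) (rank1 (vec x) u)) R \<and> \<phi> R \<le> \<epsilon>"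
    if "0 < t" "t * U x \<le> 1" for x t
    using upper_update[OF S D0 that(1) that(2)[unfolded U_def]] assms(2) unfolding D_def by auto
  define h where "h = qform H f"
  have h0: "0 < h" using hpd[of f] f unfolding h_def by simp
  have "qform X f + \<delta> * h \<le> C" using bound[of f] f unfolding h_def by simp
  moreover have "0 < \<delta> * h" using d h0 by simp
  ultimately have C0: "0 < C" using pos_semidefD(2)[OF inv_pair_pos_semidef[OF X], of f] by linarith
  define w where "w = S (H f)"
  have s1: "normsq z \<le> C * qform S z" for z
  proof (cases "normsq z = 0")
    case True then show ?thesis using pos_semidefD(2)[OF pS, of z] C0 by simp
  next
    case False
    then have z: "0 < normsq z" using normsq_nonneg[of z] by linarith
    have "(cmod (inner_fin (Y z) (S z)))\<^sup>2 \<le> qform S (Y z) * qform S z" by (rule pos_semidef_Cauchy_Schwarz[OF pS])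
    moreover have "inner_fin (Y z) (S z) = of_real (normsq z)"
      using hermitian_opD(2)[OF inv_pairD(2)[OF S], of z "S z"] S unfolding inv_pair_def by (simp add: inner_fin_self)
    moreover have "qform S (Y z) \<le> C * normsq z"
      unfolding inv_pair_qform[OF S] using bound[of z] unfolding Y_def qform_add qform_vscale .
    then have "qform S (Y z) * qform S z \<le> (C * normsq z) * qform S z"
      using pos_semidefD(2)[OF pS] by (intro mult_right_mono) auto
    ultimately have "normsq z * normsq z \<le> normsq z * (C * qform S z)" by (simp add: power2_eq_square algebra_simps)
    then show ?thesis using z by simp
  qed
  have "h\<^sup>2 \<le> normsq (H f)"
    using Cauchy_Schwarz[of f "H f"] f hermitian_op_qform[OF lin_H(2), of f] unfolding h_def by simp
  then have s2: "h\<^sup>2 \<le> C * qform S (H f)" using s1[of "H f"] by linarith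
  have "(cmod (inner_fin f (H w)))\<^sup>2 \<le> h * qform H w" unfolding h_def by (rule pos_semidef_Cauchy_Schwarz[OF pos_semidef_H])
  moreover have "inner_fin f (H w) = of_real (qform S (H f))"
    unfolding w_def using hermitian_opD(2)[OF lin_H(2), of f] hermitian_op_qform[OF hS] by metis
  ultimately have s3: "(qform S (H f))\<^sup>2 \<le> h * qform H w" by simp
  have "qform H w = (LINT x|\<mu>. (cmod (inner_fin w (vec x)))\<^sup>2)" by (rule qform_H)
  also have "\<dots> \<le> (LINT x|\<mu>. h * qform H (S (vec x)))"
  proof (rule integral_mono)
    show "integrable \<mu> (\<lambda>x. (cmod (inner_fin w (vec x)))\<^sup>2)" by (rule qform_H_integrable)
    show "integrable \<mu> (\<lambda>x. h * qform H (S (vec x)))" using i1 by simp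
    fix x
    have "inner_fin w (vec x) = inner_fin f (H (S (vec x)))"
      unfolding w_def by (simp add: hermitian_opD(2)[OF hS] hermitian_opD(2)[OF lin_H(2)])
    then show "(cmod (inner_fin w (vec x)))\<^sup>2 \<le> h * qform H (S (vec x))"
      unfolding h_def using pos_semidef_Cauchy_Schwarz[OF pos_semidef_H, of f "S (vec x)"] by simp
  qed
  also have "\<dots> = h * \<phi> (\<lambda>u. S (H (S u)))" using e1 by simp
  finally have s4: "qform H w \<le> h * \<phi> (\<lambda>u. S (H (S u)))" .
  have "(h\<^sup>2)\<^sup>2 \<le> (C * qform S (H f))\<^sup>2" using s2 by (intro power_mono) auto
  also have "\<dots> \<le> C\<^sup>2 * (h * qform H w)" using s3 by (simp add: power_mult_distrib mult_left_mono)
  also have "\<dots> \<le> C\<^sup>2 * (h * (h * \<phi> (\<lambda>u. S (H (S u)))))" using s4 h0 by (intro mult_left_mono) auto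
  finally have "h\<^sup>2 * h\<^sup>2 \<le> h\<^sup>2 * (C\<^sup>2 * \<phi> (\<lambda>u. S (H (S u))))" by (simp add: power2_eq_square algebra_simps)
  then have "h\<^sup>2 \<le> C\<^sup>2 * \<phi> (\<lambda>u. S (H (S u)))" by (rule mult_left_le_imp_le) (use h0 in simp)
  then have "(h / C)\<^sup>2 \<le> \<phi> (\<lambda>u. S (H (S u)))" using C0 by (simp add: power_divide field_simps)
  then have "\<delta> * (h / C)\<^sup>2 \<le> \<delta> * \<phi> (\<lambda>u. S (H (S u)))" using d by simp
  then show ?thesis
    using iU U0 intU step unfolding h_def Y_def by (intro exI[of _ U]) auto
qed

end

section \<open>Choosing a point for both barriers\<close>

text \<open>
  If every point of \<open>G\<close> with \<open>L(x) > 0\<close> had \<open>L(x) < U(x)\<close>, then \<open>L \<le> U\<close> almost everywhere while the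
  integrals force equality almost everywhere, hence \<open>L \<le> 0\<close> almost everywhere, against \<open>\<integral> L \<ge> 1\<close>. At
  a point with \<open>L(x) > 0\<close> and \<open>L(x) \<ge> U(x)\<close> the weight \<open>1 / L(x)\<close> is admissible for both.
\<close>

lemma interleave_barriers:
  fixes \<mu> :: "'x measure" and P Q :: "(real \<times> 'x) list \<Rightarrow> bool"
  assumes "Q []" "P []"
    and low: "\<And>h. Q h \<Longrightarrow> length h < n \<Longrightarrow> \<exists>L. integrable \<mu> L \<and> 1 \<le> (LINT x|\<mu>. L x) \<and>
      (\<forall>x\<in>G. \<forall>t. 0 < t \<longrightarrow> 1 \<le> t * L x \<longrightarrow> Q ((t, x) # h))"
    and upp: "\<And>h. P h \<Longrightarrow> length h < n \<Longrightarrow> \<exists>U. integrable \<mu> U \<and> (\<forall>x. 0 \<le> U x) \<and> (LINT x|\<mu>. U x) \<le> (1::real) \<and>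
      (\<forall>x\<in>G. \<forall>t. 0 < t \<longrightarrow> t * U x \<le> 1 \<longrightarrow> P ((t, x) # h))"
    and G: "AE x in \<mu>. x \<in> G"
  shows "\<exists>h. length h = n \<and> P h \<and> Q h \<and> (\<forall>p\<in>set h. 0 < fst p \<and> snd p \<in> G)"
proof -
  have "\<exists>h. length h = k \<and> P h \<and> Q h \<and> (\<forall>p\<in>set h. 0 < fst p \<and> snd p \<in> G)" if "k \<le> n" for k
    using that
  proof (induction k)
    case 0 then show ?case using assms(1,2) by auto
  next
    case (Suc k)
    then obtain h where h: "length h = k" "P h" "Q h" "\<forall>p\<in>set h. 0 < fst p \<and> snd p \<in> G" by auto
    obtain L where L: "integrable \<mu> L" "1 \<le> (LINT x|\<mu>. L x)"
      "\<And>x t. x \<in> G \<Longrightarrow> 0 < t \<Longrightarrow> 1 \<le> t * L x \<Longrightarrow> Q ((t, x) # h)"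
      using low[OF h(3)] h(1) Suc.prems by fastforce
    obtain U where U: "integrable \<mu> U" "\<And>x. 0 \<le> U x" "(LINT x|\<mu>. U x) \<le> 1"
      "\<And>x t. x \<in> G \<Longrightarrow> 0 < t \<Longrightarrow> t * U x \<le> 1 \<Longrightarrow> P ((t, x) # h)"
      using upp[OF h(2)] h(1) Suc.prems by fastforce
    have "\<exists>x\<in>G. 0 < L x \<and> U x \<le> L x"
    proof (rule ccontr)
      assume no: "\<not> ?thesis"
      have le: "AE x in \<mu>. L x \<le> U x"
        using G
      proof (rule AE_mp, intro AE_I2 impI)
        fix x assume "x \<in> G"
        then show "L x \<le> U x" using no U(2)[of x] by (cases "0 < L x") force+
      qed
      have "(LINT x|\<mu>. U x - L x) = (LINT x|\<mu>. U x) - (LINT x|\<mu>. L x)"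
        using L(1) U(1) by simp
      moreover have "0 \<le> (LINT x|\<mu>. U x - L x)"
        using le by (intro integral_nonneg_AE) (auto elim: eventually_mono)
      ultimately have "(LINT x|\<mu>. U x - L x) = 0" using L(2) U(3) by linarith
      moreover have "AE x in \<mu>. 0 \<le> U x - L x" using le by (auto elim: eventually_mono)
      ultimately have "AE x in \<mu>. U x - L x = 0"
        using integral_nonneg_eq_0_iff_AE[of \<mu> "\<lambda>x. U x - L x"] L(1) U(1) by simp
      with G have "AE x in \<mu>. L x \<le> 0"
      proof (rule AE_mp[OF AE_conjI], intro AE_I2 impI)
        fix x assume "x \<in> G \<and> U x - L x = 0"
        then show "L x \<le> 0" using no by (metis diff_eq_diff_eq eq_iff_diff_eq_0 not_le order_refl)
      qed
      then have "(LINT x|\<mu>. L x) \<le> (LINT x|\<mu>. 0)" using L(1) by (intro integral_mono_AE) auto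
      then show False using L(2) by simp
    qed
    then obtain x where x: "x \<in> G" "0 < L x" "U x \<le> L x" by blast
    have "P ((1 / L x, x) # h)" "Q ((1 / L x, x) # h)"
      using x by (auto intro!: U(4) L(3))
    then show ?case using h x by (intro exI[of _ "(1 / L x, x) # h"]) auto
  qed
  then show ?thesis by blast
qed

section \<open>Quadratic forms of Hilbert-Schmidt matrices\<close>

definition hilbert_schmidt :: "'k set \<Rightarrow> ('k \<Rightarrow> 'k \<Rightarrow> complex) \<Rightarrow> bool" where
  "hilbert_schmidt K A \<longleftrightarrow> (\<lambda>(k, l). (cmod (A k l))\<^sup>2) summable_on (K \<times> K)"

definition sqnorm :: "'k set \<Rightarrow> ('k \<Rightarrow> complex) \<Rightarrow> real" where
  "sqnorm K v = (\<Sum>\<^sub>\<infinity>k\<in>K. (cmod (v k))\<^sup>2)"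

definition ell2_form :: "'k set \<Rightarrow> ('k \<Rightarrow> 'k \<Rightarrow> complex) \<Rightarrow> ('k \<Rightarrow> complex) \<Rightarrow> ('k \<Rightarrow> complex) \<Rightarrow> complex" where
  "ell2_form K A u v = (\<Sum>\<^sub>\<infinity>(k, l)\<in>K \<times> K. cnj (u k) * A k l * v l)"

lemma infsum_single:
  assumes "j \<in> K" "\<And>k. k \<in> K \<Longrightarrow> k \<noteq> j \<Longrightarrow> f k = 0"
  shows "infsum f K = f j" "f summable_on K"
proof -
  have "infsum f K = infsum f {j}" "f summable_on K \<longleftrightarrow> f summable_on {j}"
    by (rule infsum_cong_neutral summable_on_cong_neutral; use assms in auto)+
  then show "infsum f K = f j" "f summable_on K" by auto
qed

lemma summable_on_product_nonneg:
  fixes f g :: "'k \<Rightarrow> real"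
  assumes "f summable_on K" "g summable_on L" "\<And>k. k \<in> K \<Longrightarrow> 0 \<le> f k" "\<And>k. k \<in> L \<Longrightarrow> 0 \<le> g k"
  shows "(\<lambda>(k, l). f k * g l) summable_on (K \<times> L)"
proof (rule summable_on_SigmaI)
  show "((\<lambda>l. case (k, l) of (k, l) \<Rightarrow> f k * g l) has_sum (f k * infsum g L)) L" for k
    using has_sum_cmult_right[OF has_sum_infsum[OF assms(2)]] by simp
  show "(\<lambda>k. f k * infsum g L) summable_on K"
    by (rule summable_on_cmult_left[OF assms(1)])
qed (use assms in auto)

lemma hilbert_schmidtI:
  assumes "g summable_on K" "\<And>k. k \<in> K \<Longrightarrow> 0 \<le> g k"
    and "\<And>k l. k \<in> K \<Longrightarrow> l \<in> K \<Longrightarrow> (cmod (A k l))\<^sup>2 \<le> g k * g l"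
  shows "hilbert_schmidt K A"
  unfolding hilbert_schmidt_def
  by (rule summable_on_comparison_test[OF summable_on_product_nonneg[OF assms(1,1,2,2)]])
     (use assms(3) in auto)

text \<open>
  The parameter \<open>e\<close> is free so that, off a large finite set of pairs, both terms can be made small
  uniformly over the unit ball.
\<close>

lemma ell2_form_summand_bound:
    fixes e :: real assumes "0 < e"
  shows "cmod (a * b * c) \<le> e * (cmod b)\<^sup>2 / 2 + ((cmod a)\<^sup>2 * (cmod c)\<^sup>2) / (2 * e)"
proof -
  define x where "x = cmod a * cmod c"
  have "0 \<le> (e * cmod b - x)\<^sup>2 / (2 * e)" using assms by simp
  also have "\<dots> = e * (cmod b)\<^sup>2 / 2 + x\<^sup>2 / (2 * e) - cmod b * x"
    using assms by (simp add: power2_eq_square field_simps)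
  finally show ?thesis unfolding x_def by (simp add: norm_mult power_mult_distrib mult_ac)
qed

lemma ell2_form_abs_summable:
  assumes "hilbert_schmidt K A" "u \<in> ell2 K" "v \<in> ell2 K"
  shows "(\<lambda>p. cmod (case p of (k, l) \<Rightarrow> cnj (u k) * A k l * v l)) summable_on (K \<times> K)"
proof (rule Infinite_Sum.abs_summable_on_comparison_test')
  have "(\<lambda>(k, l). (cmod (u k))\<^sup>2 * (cmod (v l))\<^sup>2) summable_on (K \<times> K)"
    using assms(2,3) unfolding ell2_def by (intro summable_on_product_nonneg) auto
  then have "(\<lambda>p. (case p of (k, l) \<Rightarrow> (cmod (A k l))\<^sup>2) * (1/2) + (case p of (k, l) \<Rightarrow> (cmod (u k))\<^sup>2 * (cmod (v l))\<^sup>2) * (1/2)) summable_on (K \<times> K)"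
    using assms(1) unfolding hilbert_schmidt_def by (intro summable_on_add summable_on_cmult_left)
  then show "(\<lambda>p. (case p of (k, l) \<Rightarrow> (cmod (A k l))\<^sup>2) * (1/2) + (case p of (k, l) \<Rightarrow> (cmod (u k))\<^sup>2 * (cmod (v l))\<^sup>2) * (1/2)) summable_on (K \<times> K)" .
  show "norm (case p of (k, l) \<Rightarrow> cnj (u k) * A k l * v l) \<le> (case p of (k, l) \<Rightarrow> (cmod (A k l))\<^sup>2) * (1/2) + (case p of (k, l) \<Rightarrow> (cmod (u k))\<^sup>2 * (cmod (v l))\<^sup>2) * (1/2)" for p
    using ell2_form_summand_bound[of 1 "cnj (u (fst p))" "A (fst p) (snd p)" "v (snd p)"]
    by (simp add: case_prod_beta)
qed

lemma ell2_form_summable: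
  assumes "hilbert_schmidt K A" "u \<in> ell2 K" "v \<in> ell2 K"
  shows "(\<lambda>(k, l). cnj (u k) * A k l * v l) summable_on (K \<times> K)"
  using abs_summable_summable[OF ell2_form_abs_summable[OF assms]] .

lemma ell2_form_iterated:
  assumes "hilbert_schmidt K A" "u \<in> ell2 K" "v \<in> ell2 K"
  shows "ell2_form K A u v = (\<Sum>\<^sub>\<infinity>k\<in>K. cnj (u k) * mat_app K A v k)"
proof -
  have "ell2_form K A u v = (\<Sum>\<^sub>\<infinity>k\<in>K. \<Sum>\<^sub>\<infinity>l\<in>K. cnj (u k) * A k l * v l)"
    unfolding ell2_form_def using infsum_Sigma'_banach[OF ell2_form_summable[OF assms]] by simp
  then show ?thesis unfolding mat_app_def by (simp add: infsum_cmult_right' mult.assoc)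
qed

lemma ell2_form_add:
  assumes "hilbert_schmidt K A" "u \<in> ell2 K" "u' \<in> ell2 K" "v \<in> ell2 K"
  shows "ell2_form K A (\<lambda>k. u k + u' k) v = ell2_form K A u v + ell2_form K A u' v"
    and "ell2_form K A v (\<lambda>k. u k + u' k) = ell2_form K A v u + ell2_form K A v u'"
proof -
  have e: "(\<lambda>(k, l). cnj (u k + u' k) * A k l * v l) = (\<lambda>p. (case p of (k, l) \<Rightarrow> cnj (u k) * A k l * v l) + (case p of (k, l) \<Rightarrow> cnj (u' k) * A k l * v l))"
    "(\<lambda>(k, l). cnj (v k) * A k l * (u l + u' l)) = (\<lambda>p. (case p of (k, l) \<Rightarrow> cnj (v k) * A k l * u l) + (case p of (k, l) \<Rightarrow> cnj (v k) * A k l * u' l))"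
    by (auto simp: fun_eq_iff algebra_simps)
  show "ell2_form K A (\<lambda>k. u k + u' k) v = ell2_form K A u v + ell2_form K A u' v"
    "ell2_form K A v (\<lambda>k. u k + u' k) = ell2_form K A v u + ell2_form K A v u'"
    unfolding ell2_form_def e
    by (rule infsum_add[OF ell2_form_summable[OF assms(1,2,4)] ell2_form_summable[OF assms(1,3,4)]],
        rule infsum_add[OF ell2_form_summable[OF assms(1,4,2)] ell2_form_summable[OF assms(1,4,3)]])
qed

lemma ell2_form_scale:
  "ell2_form K A (\<lambda>k. c * u k) v = cnj c * ell2_form K A u v"
  "ell2_form K A v (\<lambda>k. c * u k) = c * ell2_form K A v u"
proof -
  have e: "(\<lambda>(k, l). cnj (c * u k) * A k l * v l) = (\<lambda>p. cnj c * (case p of (k, l) \<Rightarrow> cnj (u k) * A k l * v l))"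
   "(\<lambda>(k, l). cnj (v k) * A k l * (c * u l)) = (\<lambda>p. c * (case p of (k, l) \<Rightarrow> cnj (v k) * A k l * u l))"
    by (auto simp: fun_eq_iff algebra_simps)
  show "ell2_form K A (\<lambda>k. c * u k) v = cnj c * ell2_form K A u v" "ell2_form K A v (\<lambda>k. c * u k) = c * ell2_form K A v u"
    unfolding ell2_form_def e by (rule infsum_cmult_right')+
qed

lemma ell2_form_cnj:
  assumes "\<And>k l. k \<in> K \<Longrightarrow> l \<in> K \<Longrightarrow> A k l = cnj (A l k)"
  shows "ell2_form K A u v = cnj (ell2_form K A v u)"
proof -
  have "cnj (ell2_form K A v u) = (\<Sum>\<^sub>\<infinity>p\<in>K \<times> K. cnj (case p of (k, l) \<Rightarrow> cnj (v k) * A k l * u l))"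
    unfolding ell2_form_def by simp
  also have "\<dots> = (\<Sum>\<^sub>\<infinity>p\<in>K \<times> K. (\<lambda>(k, l). cnj (u k) * A k l * v l) (prod.swap p))"
  proof (rule infsum_cong)
    fix p assume "p \<in> K \<times> K"
    then have "A (snd p) (fst p) = cnj (A (fst p) (snd p))" by (intro assms) auto
    then show "cnj (case p of (k, l) \<Rightarrow> cnj (v k) * A k l * u l) = (\<lambda>(k, l). cnj (u k) * A k l * v l) (prod.swap p)"
      by (simp add: case_prod_beta)
  qed
  also have "\<dots> = ell2_form K A u v"
    unfolding ell2_form_def
    by (rule infsum_reindex_bij_betw) (auto simp: bij_betw_def inj_on_def product_swap)
  finally show ?thesis by simp
qed

lemma filterlim_square_finite_subsets:
  "filterlim (\<lambda>F. F \<times> F) (finite_subsets_at_top (K \<times> K)) (finite_subsets_at_top K)"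
  unfolding filterlim_iff eventually_finite_subsets_at_top
proof (intro allI impI)
  fix P assume "\<exists>X. finite X \<and> X \<subseteq> K \<times> K \<and> (\<forall>Y. finite Y \<and> X \<subseteq> Y \<and> Y \<subseteq> K \<times> K \<longrightarrow> P Y)"
  then obtain X where X0: "finite X \<and> X \<subseteq> K \<times> K \<and> (\<forall>Y. finite Y \<and> X \<subseteq> Y \<and> Y \<subseteq> K \<times> K \<longrightarrow> P Y)"
    by (rule exE)
  then have X: "finite X" "X \<subseteq> K \<times> K" and XP: "\<And>Y. finite Y \<Longrightarrow> X \<subseteq> Y \<Longrightarrow> Y \<subseteq> K \<times> K \<Longrightarrow> P Y"
    by simp_all
  have "P (Y \<times> Y)" if Y: "finite Y" "fst ` X \<union> snd ` X \<subseteq> Y" "Y \<subseteq> K" for Y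
  proof (rule XP)
    show "X \<subseteq> Y \<times> Y"
    proof
      fix p assume "p \<in> X"
      then have "fst p \<in> Y" "snd p \<in> Y" using Y(2) by auto
      then show "p \<in> Y \<times> Y" by (simp add: mem_Times_iff)
    qed
  qed (use Y in auto)
  moreover have "finite (fst ` X \<union> snd ` X)" using X(1) by simp
  moreover have "fst ` X \<union> snd ` X \<subseteq> K" using X(2) by auto
  ultimately show "\<exists>X. finite X \<and> X \<subseteq> K \<and> (\<forall>Y. finite Y \<and> X \<subseteq> Y \<and> Y \<subseteq> K \<longrightarrow> P (Y \<times> Y))"
    by (intro exI[of _ "fst ` X \<union> snd ` X"] conjI allI impI) simp_all
qed

text \<open>
  Along finite squares the double sums converge to the form, so bounds for finitely supported vectors
  extend to all of \<open>\<ell>\<^sub>2\<close>.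
\<close>

lemma ell2_form_le_of_finite:
  assumes A: "hilbert_schmidt K A" and v: "v \<in> ell2 K"
    and le: "\<And>F w. finite F \<Longrightarrow> F \<subseteq> K \<Longrightarrow>
       Re (\<Sum>k\<in>F. \<Sum>l\<in>F. cnj (w k) * A k l * w l) \<le> C * (\<Sum>k\<in>F. (cmod (w k))\<^sup>2)"
  shows "Re (ell2_form K A v v) \<le> C * sqnorm K v"
proof (rule tendsto_le)
  have "(sum (\<lambda>k. (cmod (v k))\<^sup>2) \<longlongrightarrow> sqnorm K v) (finite_subsets_at_top K)"
    unfolding sqnorm_def by (rule infsum_tendsto) (use v in \<open>simp add: ell2_def\<close>)
  then show "((\<lambda>F. C * (\<Sum>k\<in>F. (cmod (v k))\<^sup>2)) \<longlongrightarrow> C * sqnorm K v) (finite_subsets_at_top K)"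
    by (intro tendsto_intros)
  have "(sum (\<lambda>(k, l). cnj (v k) * A k l * v l) \<longlongrightarrow> ell2_form K A v v) (finite_subsets_at_top (K \<times> K))"
    unfolding ell2_form_def by (rule infsum_tendsto[OF ell2_form_summable[OF A v v]])
  from filterlim_compose[OF this filterlim_square_finite_subsets]
  have "((\<lambda>F. \<Sum>k\<in>F. \<Sum>l\<in>F. cnj (v k) * A k l * v l) \<longlongrightarrow> ell2_form K A v v) (finite_subsets_at_top K)"
    by (simp add: sum.cartesian_product)
  then show "((\<lambda>F. Re (\<Sum>k\<in>F. \<Sum>l\<in>F. cnj (v k) * A k l * v l)) \<longlongrightarrow> Re (ell2_form K A v v)) (finite_subsets_at_top K)"
    by (rule tendsto_Re)
  show "\<forall>\<^sub>F F in finite_subsets_at_top K. Re (\<Sum>k\<in>F. \<Sum>l\<in>F. cnj (v k) * A k l * v l) \<le> C * (\<Sum>k\<in>F. (cmod (v k))\<^sup>2)"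
    using le by (intro eventually_finite_subsets_at_top_weakI) auto
qed simp

lemma sqnorm_pos:
  assumes "v \<in> ell2 K" "k \<in> K" "v k \<noteq> 0"
  shows "0 < sqnorm K v"
proof -
  have "(\<Sum>k\<in>{k}. (cmod (v k))\<^sup>2) \<le> sqnorm K v"
    unfolding sqnorm_def using assms unfolding ell2_def by (intro finite_sum_le_infsum) auto
  then show ?thesis using assms(3) by simp (metis less_le_trans zero_less_norm_iff zero_less_power)
qed

lemma eigenvalue_le:
  assumes A: "hilbert_schmidt K A" and r: "is_eigenvalue K A (complex_of_real r)"
    and le: "\<And>F w. finite F \<Longrightarrow> F \<subseteq> K \<Longrightarrow>
       Re (\<Sum>k\<in>F. \<Sum>l\<in>F. cnj (w k) * A k l * w l) \<le> C * (\<Sum>k\<in>F. (cmod (w k))\<^sup>2)"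
  shows "r \<le> C"
proof -
  obtain v k where v: "v \<in> ell2 K" "k \<in> K" "v k \<noteq> 0"
    "\<And>k. k \<in> K \<Longrightarrow> mat_app K A v k = complex_of_real r * v k"
    using r unfolding is_eigenvalue_def by blast
  have e: "(\<Sum>\<^sub>\<infinity>k\<in>K. complex_of_real ((cmod (v k))\<^sup>2)) = complex_of_real (sqnorm K v)"
    unfolding sqnorm_def
    by (intro infsumI has_sum_of_real has_sum_infsum) (use v(1) in \<open>simp add: ell2_def\<close>)
  have "ell2_form K A v v = (\<Sum>\<^sub>\<infinity>k\<in>K. complex_of_real r * complex_of_real ((cmod (v k))\<^sup>2))"
    unfolding ell2_form_iterated[OF A v(1,1)] using v(4)
    by (intro infsum_cong) (simp add: complex_norm_square mult_ac del: of_real_power)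
  also have "\<dots> = complex_of_real r * complex_of_real (sqnorm K v)"
    unfolding infsum_cmult_right' e ..
  finally have "r * sqnorm K v \<le> C * sqnorm K v"
    using ell2_form_le_of_finite[OF A v(1) le] by simp
  then show ?thesis using sqnorm_pos[OF v(1-3)] by simp
qed

section \<open>Existence of extreme eigenvalues\<close>

text \<open>
  The unit ball as a set of functions that vanish off \<open>K\<close>, which makes it a closed subset of a product
  of compact discs.
\<close>

definition ell2_ball :: "'k set \<Rightarrow> ('k \<Rightarrow> complex) set" where
  "ell2_ball K = {v. (\<forall>k. k \<notin> K \<longrightarrow> v k = 0) \<and> (\<forall>F. finite F \<longrightarrow> F \<subseteq> K \<longrightarrow> (\<Sum>k\<in>F. (cmod (v k))\<^sup>2) \<le> 1)}"

lemma compact_ell2_ball: "compact (ell2_ball K)"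
proof -
  let ?S = "\<lambda>k. if k \<in> K then cball (0::complex) 1 else {0}"
  have "compactin (product_topology (\<lambda>k. euclidean) UNIV) (PiE UNIV ?S)"
    by (subst compactin_PiE) auto
  then have 1: "compact (PiE UNIV ?S)"
    by (simp add: euclidean_product_topology)
  let ?C = "\<Inter>F\<in>{F. finite F \<and> F \<subseteq> K}. {v. (\<Sum>k\<in>F. (cmod (v k))\<^sup>2) \<le> 1}"
  have "closed ?C"
    by (intro closed_INT ballI closed_Collect_le continuous_intros
        continuous_on_subset[OF continuous_on_product_coordinates]) auto
  then have "compact (PiE UNIV ?S \<inter> ?C)" using 1 by (rule compact_Int_closed[rotated])
  moreover have "ell2_ball K = PiE UNIV ?S \<inter> ?C"
  proof (intro equalityI subsetI)
    fix v assume v: "v \<in> ell2_ball K"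
    have "cmod (v k) \<le> 1" if "k \<in> K" for k
    proof -
      have "\<forall>F. finite F \<longrightarrow> F \<subseteq> K \<longrightarrow> (\<Sum>k\<in>F. (cmod (v k))\<^sup>2) \<le> 1" using v unfolding ell2_ball_def by simp
      from this[rule_format, of "{k}"] that have "(cmod (v k))\<^sup>2 \<le> 1" by simp
      then show ?thesis by (simp add: power2_le_iff_abs_le[of 1, simplified] abs_square_le_1)
    qed
    then show "v \<in> PiE UNIV ?S \<inter> ?C" using v unfolding ell2_ball_def by auto
  next
    fix v assume "v \<in> PiE UNIV ?S \<inter> ?C"
    then show "v \<in> ell2_ball K" unfolding ell2_ball_def by (auto simp: PiE_def Pi_def split: if_splits)
  qed
  ultimately show ?thesis by simp
qed

lemma ell2_ball_ell2:
  assumes "v \<in> ell2_ball K" shows "v \<in> ell2 K" "sqnorm K v \<le> 1"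
proof -
  have b: "(\<Sum>k\<in>F. (cmod (v k))\<^sup>2) \<le> 1" if "finite F" "F \<subseteq> K" for F
    using assms that unfolding ell2_ball_def by auto
  have s: "(\<lambda>k. (cmod (v k))\<^sup>2) summable_on K"
    by (rule nonneg_bdd_above_summable_on) (auto intro!: bdd_aboveI2[where M = 1] b)
  then show "v \<in> ell2 K" unfolding ell2_def by simp
  show "sqnorm K v \<le> 1" unfolding sqnorm_def by (rule infsum_le_finite_sums[OF s b])
qed

text \<open>
  On the ball the form is a uniform limit of finite double sums, and these depend on finitely many
  coordinates.
\<close>

lemma continuous_ell2_form:
  assumes A: "hilbert_schmidt K A"
  shows "continuous_on (ell2_ball K) (\<lambda>v. ell2_form K A v v)"
proof (rule uniform_limit_theorem)
  let ?a = "\<lambda>(k, l). (cmod (A k l))\<^sup>2"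
  let ?t = "\<lambda>v (k, l). cnj (v k) * A k l * v l"
  show "\<forall>\<^sub>F E in finite_subsets_at_top (K \<times> K). continuous_on (ell2_ball K) (\<lambda>v. sum (?t v) E)"
    by (intro always_eventually allI)
      (auto simp: case_prod_beta intro!: continuous_intros continuous_on_subset[OF continuous_on_product_coordinates])
  show "uniform_limit (ell2_ball K) (\<lambda>E v. sum (?t v) E) (\<lambda>v. ell2_form K A v v) (finite_subsets_at_top (K \<times> K))"
  proof (rule uniform_limitI)
    fix e :: real assume e: "0 < e"
    have sA: "?a summable_on (K \<times> K)" using A unfolding hilbert_schmidt_def .
    have "(sum ?a \<longlongrightarrow> infsum ?a (K \<times> K)) (finite_subsets_at_top (K \<times> K))"
      by (rule infsum_tendsto[OF sA])
    then have "\<forall>\<^sub>F E in finite_subsets_at_top (K \<times> K). dist (sum ?a E) (infsum ?a (K \<times> K)) < e\<^sup>2 / 4"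
      using e by (intro tendstoD) auto
    moreover have "\<forall>\<^sub>F E in finite_subsets_at_top (K \<times> K). finite E \<and> E \<subseteq> K \<times> K"
      by (rule eventually_finite_subsets_at_top_weakI) simp
    ultimately show "\<forall>\<^sub>F E in finite_subsets_at_top (K \<times> K). \<forall>v\<in>ell2_ball K. dist (sum (?t v) E) (ell2_form K A v v) < e"
    proof eventually_elim
      case (elim E)
      show ?case
      proof
        fix v assume v: "v \<in> ell2_ball K"
        note v2 = ell2_ball_ell2[OF v]
        let ?D = "K \<times> K - E"
        let ?b = "\<lambda>(k, l). (cmod (v k))\<^sup>2 * (cmod (v l))\<^sup>2"
        note st = ell2_form_summable[OF A v2(1) v2(1)]
        have sa: "?a summable_on ?D" using sA by (rule summable_on_subset) auto
        have sv: "(\<lambda>k. (cmod (v k))\<^sup>2) summable_on K" using v2(1) unfolding ell2_def by simp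
        have sb0: "?b summable_on (K \<times> K)"
          by (rule summable_on_product_nonneg[OF sv sv]) auto
        have sb: "?b summable_on ?D" using sb0 by (rule summable_on_subset) auto
        have ib: "infsum ?b ?D \<le> 1"
        proof -
          have "infsum ?b ?D \<le> infsum ?b (K \<times> K)"
            by (rule infsum_mono2[OF sb sb0]) auto
          also have "\<dots> = (\<Sum>\<^sub>\<infinity>k\<in>K. \<Sum>\<^sub>\<infinity>l\<in>K. (cmod (v k))\<^sup>2 * (cmod (v l))\<^sup>2)"
            using infsum_Sigma'_banach[OF sb0] by simp
          also have "\<dots> = sqnorm K v * sqnorm K v"
            unfolding sqnorm_def infsum_cmult_right' infsum_cmult_left' ..
          also have "\<dots> \<le> 1" using v2(2) unfolding sqnorm_def
            by (intro mult_le_one infsum_nonneg) auto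
          finally show ?thesis .
        qed
        have ia: "infsum ?a ?D < e\<^sup>2 / 4"
        proof -
          have "infsum ?a ?D = infsum ?a (K \<times> K) - sum ?a E"
            using infsum_Diff[OF sA, of E] elim by simp
          then show ?thesis using elim(1) unfolding dist_real_def by linarith
        qed
        have sn: "(\<lambda>p. cmod (?t v p)) summable_on ?D"
          using ell2_form_abs_summable[OF A v2(1) v2(1)] by (rule summable_on_subset) auto
        have "ell2_form K A v v - sum (?t v) E = infsum (?t v) ?D"
          unfolding ell2_form_def using infsum_Diff[OF st, of E] elim by simp
        then have "dist (sum (?t v) E) (ell2_form K A v v) = cmod (infsum (?t v) ?D)"
          by (simp only: dist_norm norm_minus_commute[of "sum (?t v) E"])
        also have "\<dots> \<le> infsum (\<lambda>p. cmod (?t v p)) ?D"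
          by (rule norm_infsum_bound[OF sn])
        also have "\<dots> \<le> infsum (\<lambda>p. ?a p * (1 / e) + ?b p * (e / 4)) ?D"
        proof (rule infsum_mono[OF sn])
          show "(\<lambda>p. ?a p * (1 / e) + ?b p * (e / 4)) summable_on ?D"
            by (intro summable_on_add summable_on_cmult_left sa sb)
          show "cmod (?t v p) \<le> ?a p * (1 / e) + ?b p * (e / 4)" for p
            using ell2_form_summand_bound[of "2 / e" "cnj (v (fst p))" "A (fst p) (snd p)" "v (snd p)"] e
            by (simp add: case_prod_beta field_simps)
        qed
        also have "\<dots> = infsum ?a ?D * (1 / e) + infsum ?b ?D * (e / 4)"
          by (subst infsum_add[OF summable_on_cmult_left[OF sa] summable_on_cmult_left[OF sb]])
             (simp only: infsum_cmult_left')
        also have "\<dots> < e"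
        proof -
          have "infsum ?a ?D * (1 / e) < e\<^sup>2 / 4 * (1 / e)" using ia e by (intro mult_strict_right_mono) auto
          moreover have "infsum ?b ?D * (e / 4) \<le> 1 * (e / 4)" using ib e by (intro mult_right_mono) auto
          moreover have "e\<^sup>2 / 4 * (1 / e) = e / 4" using e by (simp add: power2_eq_square)
          ultimately show ?thesis using e by linarith
        qed
        finally show "dist (sum (?t v) E) (ell2_form K A v v) < e" .
      qed
    qed
  qed
qed simp

lemma quadratic_min_zero:
  fixes d :: complex
  assumes "\<And>z. 0 \<le> 2 * Re (cnj z * d) + (cmod z)\<^sup>2 * c"
  shows "d = 0"
proof (rule ccontr)
  assume "d \<noteq> 0"
  then have d: "0 < (cmod d)\<^sup>2" by simp
  define t where "t = 1 / (\<bar>c\<bar> + 1)"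
  have t: "0 < t" "t * c < 1" unfolding t_def by (auto simp: field_simps)
  have "Re (cnj (- of_real t * d) * d) = - t * (cmod d)\<^sup>2"
    by (simp add: cmod_power2, simp add: power2_eq_square algebra_simps)
  moreover have "(cmod (- of_real t * d))\<^sup>2 = t\<^sup>2 * (cmod d)\<^sup>2"
    by (simp add: norm_mult power_mult_distrib)
  ultimately have "0 \<le> (t * (cmod d)\<^sup>2) * (t * c - 2)"
    using assms[of "- of_real t * d"] by (simp add: power2_eq_square algebra_simps)
  moreover have "(t * (cmod d)\<^sup>2) * (t * c - 2) < 0"
    using t d by (intro mult_pos_neg) auto
  ultimately show False by linarith
qed

text \<open>
  A maximiser \<open>v\<close> of the form over the ball has norm one since the supremum \<open>s\<close> is positive. Then \<open>v\<close>
  minimises \<open>s \<bar>u\<bar>\<^sup>2 - u\<^sup>* A u\<close> over all \<open>u\<close>, and varying one coordinate at a time gives the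
  eigenvalue equation.
\<close>

lemma largest_eigenvalue_exists:
  assumes A: "hilbert_schmidt K A"
    and hermitian_op: "\<And>k l. k \<in> K \<Longrightarrow> l \<in> K \<Longrightarrow> A k l = cnj (A l k)"
    and pos: "u0 \<in> ell2 K" "0 < Re (ell2_form K A u0 u0)"
  shows "\<exists>r>0. is_eigenvalue K A (complex_of_real r) \<and> (\<forall>u\<in>ell2 K. Re (ell2_form K A u u) \<le> r * sqnorm K u)"
proof -
  let ?q = "\<lambda>v. Re (ell2_form K A v v)"
  have "(\<lambda>_. 0) \<in> ell2_ball K" unfolding ell2_ball_def by simp
  then obtain v where v: "v \<in> ell2_ball K" and vmax: "\<And>u. u \<in> ell2_ball K \<Longrightarrow> ?q u \<le> ?q v"
    using continuous_attains_sup[OF compact_ell2_ball _ continuous_on_Re[OF continuous_ell2_form[OF A]]] by blast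
  note v2 = ell2_ball_ell2[OF v]
  define s where "s = ?q v"
  have form_cong: "ell2_form K A u u = ell2_form K A u' u'" if "\<And>k. k \<in> K \<Longrightarrow> u k = u' k" for u u'
    unfolding ell2_form_def using that by (intro infsum_cong) auto
  have bound: "?q u \<le> s * sqnorm K u" if u: "u \<in> ell2 K" for u
  proof (cases "\<exists>k\<in>K. u k \<noteq> 0")
    case False
    then have "ell2_form K A u u = 0" "sqnorm K u = 0"
      unfolding ell2_form_def sqnorm_def by (auto intro!: infsum_0)
    then show ?thesis by simp
  next
    case True
    then have N: "0 < sqnorm K u" using sqnorm_pos[OF u] by blast
    define c where "c = 1 / sqrt (sqnorm K u)"
    have c: "0 < c" "c\<^sup>2 * sqnorm K u = 1" using N unfolding c_def by (auto simp: power_divide)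
    define u' where "u' = (\<lambda>k. if k \<in> K then of_real c * u k else 0)"
    have "u' \<in> ell2_ball K"
      unfolding ell2_ball_def
    proof (intro CollectI conjI allI impI)
      fix F assume F: "finite F" "F \<subseteq> K"
      have "(\<Sum>k\<in>F. (cmod (u' k))\<^sup>2) = c\<^sup>2 * (\<Sum>k\<in>F. (cmod (u k))\<^sup>2)"
        unfolding sum_distrib_left u'_def using F c(1)
        by (intro sum.cong) (auto simp: norm_mult power_mult_distrib)
      also have "\<dots> \<le> c\<^sup>2 * sqnorm K u"
        unfolding sqnorm_def using u F unfolding ell2_def
        by (intro mult_left_mono finite_sum_le_infsum) auto
      finally show "(\<Sum>k\<in>F. (cmod (u' k))\<^sup>2) \<le> 1" using c by simp
    qed (simp add: u'_def)
    then have "?q u' \<le> s" using vmax unfolding s_def by blast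
    moreover have "ell2_form K A u' u' = ell2_form K A (\<lambda>k. of_real c * u k) (\<lambda>k. of_real c * u k)"
      by (rule form_cong) (simp add: u'_def)
    then have "ell2_form K A u' u' = of_real (c\<^sup>2) * ell2_form K A u u"
      unfolding ell2_form_scale by (simp add: power2_eq_square)
    then have "?q u' = c\<^sup>2 * ?q u" by simp
    ultimately have "c\<^sup>2 * ?q u \<le> c\<^sup>2 * (s * sqnorm K u)" using c(2) by (simp add: algebra_simps)
    then show ?thesis using c(1) by simp
  qed
  have s0: "0 < s"
  proof (rule ccontr)
    assume "\<not> 0 < s"
    then have "s * sqnorm K u0 \<le> 0"
      unfolding sqnorm_def by (intro mult_nonpos_nonneg infsum_nonneg) auto
    then show False using bound[OF pos(1)] pos(2) by linarith
  qed
  have vN: "sqnorm K v = 1"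
    using bound[OF v2(1)] v2(2) s0 unfolding s_def
    by (smt (verit) mult_left_le mult_le_cancel_left1 sum_squares_gt_zero_iff)
  have ev: "mat_app K A v j = of_real s * v j" if j: "j \<in> K" for j
  proof -
    define e where "e = (\<lambda>k. if k = j then 1 else (0::complex))"
    have e2: "e \<in> ell2 K" unfolding ell2_def e_def
      using infsum_single(2)[OF j, of "\<lambda>k. (cmod (if k = j then 1 else 0))\<^sup>2"] by simp
    have ze2: "(\<lambda>k. z * e k) \<in> ell2 K" for z
      using e2 unfolding ell2_def by (simp add: norm_mult power_mult_distrib summable_on_cmult_right)
    have fe: "ell2_form K A e u = mat_app K A u j" if "u \<in> ell2 K" for u
      unfolding ell2_form_iterated[OF A e2 that]
      using infsum_single(1)[OF j, of "\<lambda>k. cnj (e k) * mat_app K A u k"] by (simp add: e_def)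
    have sv: "(\<lambda>k. (cmod (v k))\<^sup>2) summable_on K" using v2(1) unfolding ell2_def by simp
    have "0 \<le> 2 * Re (cnj z * (of_real s * v j - mat_app K A v j)) + (cmod z)\<^sup>2 * (s - Re (mat_app K A e j))" for z
    proof -
      let ?u = "\<lambda>k. v k + z * e k"
      let ?d = "\<lambda>k. if k = j then (cmod (v j + z))\<^sup>2 - (cmod (v j))\<^sup>2 else 0"
      have eq: "(cmod (?u k))\<^sup>2 = (cmod (v k))\<^sup>2 + ?d k" for k by (simp add: e_def)
      have sd: "infsum ?d K = ?d j" "?d summable_on K"
        by (rule infsum_single[OF j, of ?d]; simp)+
      have u2: "?u \<in> ell2 K"
        by (simp only: ell2_def mem_Collect_eq eq) (rule summable_on_add[OF sv sd(2)])
      have "sqnorm K ?u = sqnorm K v + ((cmod (v j + z))\<^sup>2 - (cmod (v j))\<^sup>2)"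
        unfolding sqnorm_def eq using infsum_add[OF sv sd(2)] sd(1) by simp
      also have "(cmod (v j + z))\<^sup>2 - (cmod (v j))\<^sup>2 = 2 * Re (cnj z * v j) + (cmod z)\<^sup>2"
        unfolding cmod_power2 by (simp add: power2_eq_square algebra_simps)
      finally have N: "sqnorm K ?u = 1 + (2 * Re (cnj z * v j) + (cmod z)\<^sup>2)" using vN by simp
      have "ell2_form K A ?u ?u = ell2_form K A v v + z * ell2_form K A v e + cnj z * ell2_form K A e v + cnj z * z * ell2_form K A e e"
        by (simp add: ell2_form_add[OF A v2(1) ze2 u2] ell2_form_add[OF A v2(1) ze2 v2(1)] ell2_form_add[OF A v2(1) ze2 ze2] ell2_form_add[OF A v2(1) ze2 e2]
            ell2_form_scale algebra_simps)
      also have "ell2_form K A v e = cnj (ell2_form K A e v)" by (rule ell2_form_cnj[OF hermitian_op])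
      finally have "?q ?u = s + 2 * Re (cnj z * mat_app K A v j) + (cmod z)\<^sup>2 * Re (mat_app K A e j)"
        unfolding fe[OF v2(1)] fe[OF e2] s_def cmod_power2
        by (simp add: power2_eq_square algebra_simps)
      moreover have "?q ?u \<le> s * sqnorm K ?u" by (rule bound[OF u2])
      ultimately show ?thesis unfolding N by (simp add: algebra_simps)
    qed
    from quadratic_min_zero[OF this] show ?thesis by simp
  qed
  have "\<exists>k\<in>K. v k \<noteq> 0"
  proof (rule ccontr)
    assume "\<not> ?thesis"
    then have "sqnorm K v = 0" unfolding sqnorm_def by (auto intro!: infsum_0)
    then show False using vN by simp
  qed
  then have "is_eigenvalue K A (complex_of_real s)"
    unfolding is_eigenvalue_def using v2(1) ev by blast
  then show ?thesis using s0 bound by blast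
qed

section \<open>Integrals of countable sums\<close>

lemma infsum_eq_suminf:
  fixes h :: "'k \<Rightarrow> real"
  assumes K: "countable K" and nn: "\<And>k. k \<in> K \<Longrightarrow> 0 \<le> h k"
  defines "g \<equiv> \<lambda>n. if n \<in> to_nat_on K ` K then h (from_nat_into K n) else 0"
  shows "h summable_on K \<longleftrightarrow> summable g" "h summable_on K \<Longrightarrow> infsum h K = suminf g"
proof -
  let ?N = "to_nat_on K ` K"
  have bij: "bij_betw (to_nat_on K) K ?N"
    using K by (auto simp: bij_betw_def)
  have g0: "0 \<le> g n" for n
    using nn from_nat_into_to_nat_on[OF K] unfolding g_def by auto
  have "h summable_on K \<longleftrightarrow> (\<lambda>k. g (to_nat_on K k)) summable_on K"
    by (rule summable_on_cong) (simp add: g_def from_nat_into_to_nat_on[OF K])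
  also have "\<dots> \<longleftrightarrow> g summable_on ?N" by (rule summable_on_reindex_bij_betw[OF bij])
  also have "\<dots> \<longleftrightarrow> g summable_on UNIV"
    by (rule summable_on_cong_neutral) (auto simp: g_def)
  finally have e1: "h summable_on K \<longleftrightarrow> g summable_on UNIV" .
  then show "h summable_on K \<longleftrightarrow> summable g"
    using summable_on_UNIV_nonneg_real_iff[OF g0] by simp
  have "infsum h K = infsum (\<lambda>k. g (to_nat_on K k)) K"
    by (rule infsum_cong) (simp add: g_def from_nat_into_to_nat_on[OF K])
  also have "\<dots> = infsum g ?N" by (rule infsum_reindex_bij_betw[OF bij])
  also have "\<dots> = infsum g UNIV"
    by (rule infsum_cong_neutral) (auto simp: g_def)
  finally have e2: "infsum h K = infsum g UNIV" .
  assume "h summable_on K"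
  then have "g sums infsum g UNIV" using e1 has_sum_imp_sums has_sum_infsum by blast
  then show "infsum h K = suminf g" using e2 sums_unique by metis
qed

lemma integral_suminf_nonneg:
  fixes f :: "nat \<Rightarrow> 'x \<Rightarrow> real"
  assumes int: "\<And>n. integrable \<mu> (f n)" and nn: "\<And>n x. 0 \<le> f n x"
    and sm: "summable (\<lambda>n. LINT x|\<mu>. f n x)"
  shows "AE x in \<mu>. summable (\<lambda>n. f n x)"
    and "integrable \<mu> (\<lambda>x. \<Sum>n. f n x)"
    and "(LINT x|\<mu>. (\<Sum>n. f n x)) = (\<Sum>n. (LINT x|\<mu>. f n x))"
proof -
  have [measurable]: "f n \<in> borel_measurable \<mu>" for n using int by blast
  have "(\<integral>\<^sup>+ x. (\<Sum>n. ennreal (f n x)) \<partial>\<mu>) = (\<Sum>n. \<integral>\<^sup>+ x. ennreal (f n x) \<partial>\<mu>)"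
    by (rule nn_integral_suminf) measurable
  also have "\<dots> = (\<Sum>n. ennreal (LINT x|\<mu>. f n x))"
    using int nn by (intro suminf_cong nn_integral_eq_integral) auto
  also have "\<dots> = ennreal (\<Sum>n. (LINT x|\<mu>. f n x))"
    using sm nn by (intro suminf_ennreal2 integral_nonneg) auto
  finally have "(\<integral>\<^sup>+ x. (\<Sum>n. ennreal (f n x)) \<partial>\<mu>) \<noteq> \<infinity>" by simp
  then have "AE x in \<mu>. (\<Sum>n. ennreal (f n x)) \<noteq> \<infinity>"
    by (intro nn_integral_PInf_AE) measurable
  then show ae: "AE x in \<mu>. summable (\<lambda>n. f n x)"
    by (rule eventually_mono) (rule summable_suminf_not_top, use nn in auto)
  have ae': "AE x in \<mu>. summable (\<lambda>n. norm (f n x))" using ae nn by simp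
  have sm': "summable (\<lambda>n. LINT x|\<mu>. norm (f n x))" using sm nn by simp
  show "integrable \<mu> (\<lambda>x. \<Sum>n. f n x)" by (rule integrable_suminf[OF int ae' sm'])
  show "(LINT x|\<mu>. (\<Sum>n. f n x)) = (\<Sum>n. (LINT x|\<mu>. f n x))" by (rule integral_suminf[OF int ae' sm'])
qed

text \<open>
  Monotone convergence for sums over a countable index set. Where the sum diverges \<open>infsum\<close> is zero,
  so the integrability claim rests on convergence almost everywhere and on measurability of the set
  of convergence.
\<close>

lemma integral_infsum_nonneg:
  fixes f :: "'k \<Rightarrow> 'x \<Rightarrow> real"
  assumes K: "countable K"
    and int: "\<And>k. k \<in> K \<Longrightarrow> integrable \<mu> (f k)" and nn: "\<And>k x. k \<in> K \<Longrightarrow> 0 \<le> f k x"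
    and sm: "(\<lambda>k. LINT x|\<mu>. f k x) summable_on K"
  shows "AE x in \<mu>. (\<lambda>k. f k x) summable_on K"
    and "integrable \<mu> (\<lambda>x. \<Sum>\<^sub>\<infinity>k\<in>K. f k x)"
    and "(LINT x|\<mu>. (\<Sum>\<^sub>\<infinity>k\<in>K. f k x)) = (\<Sum>\<^sub>\<infinity>k\<in>K. (LINT x|\<mu>. f k x))"
proof -
  define g where "g = (\<lambda>n. if n \<in> to_nat_on K ` K then f (from_nat_into K n) else (\<lambda>_. 0))"
  have fr: "n \<in> to_nat_on K ` K \<Longrightarrow> from_nat_into K n \<in> K" for n
    using from_nat_into_to_nat_on[OF K] by auto
  have g: "integrable \<mu> (g n)" "0 \<le> g n x" for n x
    using int nn fr unfolding g_def by auto
  have gx: "(\<lambda>n. g n x) = (\<lambda>n. if n \<in> to_nat_on K ` K then f (from_nat_into K n) x else 0)" for x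
    unfolding g_def by auto
  have gi: "(\<lambda>n. LINT x|\<mu>. g n x) = (\<lambda>n. if n \<in> to_nat_on K ` K then LINT x|\<mu>. f (from_nat_into K n) x else 0)"
    unfolding g_def by auto
  have pt: "(\<lambda>k. f k x) summable_on K \<longleftrightarrow> summable (\<lambda>n. g n x)"
    "(\<lambda>k. f k x) summable_on K \<Longrightarrow> infsum (\<lambda>k. f k x) K = (\<Sum>n. g n x)" for x
    unfolding gx using infsum_eq_suminf[OF K, of "\<lambda>k. f k x"] nn by auto
  have "0 \<le> (LINT x|\<mu>. f k x)" if "k \<in> K" for k
    using nn[OF that] by (simp add: integral_nonneg)
  from infsum_eq_suminf[OF K, of "\<lambda>k. LINT x|\<mu>. f k x", OF this]
  have it: "summable (\<lambda>n. LINT x|\<mu>. g n x)" "infsum (\<lambda>k. LINT x|\<mu>. f k x) K = (\<Sum>n. (LINT x|\<mu>. g n x))"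
    unfolding gi using sm by auto
  note G = integral_suminf_nonneg[OF g it(1)]
  show ae: "AE x in \<mu>. (\<lambda>k. f k x) summable_on K" using G(1) unfolding pt(1) .
  have [measurable]: "g n \<in> borel_measurable \<mu>" for n using g(1) by blast
  have eqz: "infsum (\<lambda>k. f k x) K = (if (\<Sum>n. ennreal (g n x)) = \<infinity> then 0 else \<Sum>n. g n x)" for x
  proof (cases "summable (\<lambda>n. g n x)")
    case True
    then have "(\<Sum>n. ennreal (g n x)) = ennreal (\<Sum>n. g n x)"
      by (intro suminf_ennreal2 g(2))
    then have "(\<Sum>n. ennreal (g n x)) \<noteq> \<infinity>" by (simp only: infinity_ennreal_def ennreal_neq_top not_False_eq_True)
    moreover have "(\<lambda>k. f k x) summable_on K" by (rule pt(1)[THEN iffD2]) (rule True)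
    ultimately show ?thesis using pt(2)[of x] by (simp only: if_False)
  next
    case False
    then have "(\<Sum>n. ennreal (g n x)) = \<infinity>"
      using summable_suminf_not_top[of "\<lambda>n. g n x", OF g(2)] by (auto simp only: infinity_ennreal_def)
    moreover have "infsum (\<lambda>k. f k x) K = 0"
      by (rule infsum_not_exists) (use False pt(1) in blast)
    ultimately show ?thesis by (simp only: if_True simp_thms)
  qed
  have meas: "(\<lambda>x. infsum (\<lambda>k. f k x) K) \<in> borel_measurable \<mu>"
  proof -
    have "(\<lambda>x. if (\<Sum>n. ennreal (g n x)) = \<infinity> then 0 else \<Sum>n. g n x) \<in> borel_measurable \<mu>"
      by (intro measurable_If borel_measurable_suminf measurable_const) measurable
    then show ?thesis by (simp only: eqz)
  qed
  have aeq: "AE x in \<mu>. (\<Sum>n. g n x) = infsum (\<lambda>k. f k x) K"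
    using ae by (rule eventually_mono) (simp add: pt(2))
  show "integrable \<mu> (\<lambda>x. \<Sum>\<^sub>\<infinity>k\<in>K. f k x)"
    by (rule integrable_cong_AE_imp[OF G(2) meas]) (use aeq in simp)
  have "(LINT x|\<mu>. (\<Sum>\<^sub>\<infinity>k\<in>K. f k x)) = (LINT x|\<mu>. (\<Sum>n. g n x))"
    by (rule integral_cong_AE[OF borel_measurable_integrable[OF G(2)] meas aeq, symmetric])
  then show "(LINT x|\<mu>. (\<Sum>\<^sub>\<infinity>k\<in>K. f k x)) = (\<Sum>\<^sub>\<infinity>k\<in>K. (LINT x|\<mu>. f k x))"
    using G(3) it(2) by simp
qed

section \<open>Extreme eigenvalues and finitely supported vectors\<close>

lemma ell2_form_finite_support:
  fixes w :: "'k \<Rightarrow> complex"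
  assumes "finite F" "F \<subseteq> K"
  defines "u \<equiv> \<lambda>k. if k \<in> F then w k else 0"
  shows "u \<in> ell2 K"
    and "ell2_form K A u u = (\<Sum>k\<in>F. \<Sum>l\<in>F. cnj (w k) * A k l * w l)"
    and "sqnorm K u = (\<Sum>k\<in>F. (cmod (w k))\<^sup>2)"
proof -
  have "(\<lambda>k. (cmod (u k))\<^sup>2) summable_on K \<longleftrightarrow> (\<lambda>k. (cmod (w k))\<^sup>2) summable_on F"
    by (rule summable_on_cong_neutral) (use assms in auto)
  then show "u \<in> ell2 K" using assms(1) by (simp add: ell2_def)
  have "sqnorm K u = (\<Sum>\<^sub>\<infinity>k\<in>F. (cmod (w k))\<^sup>2)" unfolding sqnorm_def
    by (rule infsum_cong_neutral) (use assms in auto)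
  then show "sqnorm K u = (\<Sum>k\<in>F. (cmod (w k))\<^sup>2)" using assms(1) by simp
  have "ell2_form K A u u = (\<Sum>\<^sub>\<infinity>(k, l)\<in>F \<times> F. cnj (w k) * A k l * w l)" unfolding ell2_form_def
    by (rule infsum_cong_neutral) (use assms in \<open>auto split: if_splits\<close>)
  also have "\<dots> = (\<Sum>(k, l)\<in>F \<times> F. cnj (w k) * A k l * w l)" using assms(1) by (intro infsum_finite) auto
  finally show "ell2_form K A u u = (\<Sum>k\<in>F. \<Sum>l\<in>F. cnj (w k) * A k l * w l)"
    by (simp add: sum.cartesian_product)
qed

lemma lambda_max_attained:
  assumes A: "hilbert_schmidt K A"
    and hermitian_op: "\<And>k l. k \<in> K \<Longrightarrow> l \<in> K \<Longrightarrow> A k l = cnj (A l k)"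
    and pos: "j \<in> K" "0 < Re (A j j)"
  shows "0 < lambda_max K A" "is_eigenvalue K A (complex_of_real (lambda_max K A))"
    and "\<And>F w. finite F \<Longrightarrow> F \<subseteq> K \<Longrightarrow>
       Re (\<Sum>k\<in>F. \<Sum>l\<in>F. cnj (w k) * A k l * w l) \<le> lambda_max K A * (\<Sum>k\<in>F. (cmod (w k))\<^sup>2)"
proof -
  let ?e = "\<lambda>k. if k \<in> {j} then 1 else 0"
  note e = ell2_form_finite_support(1)[where F = "{j}" and K = K and w = "\<lambda>_. 1"]
    ell2_form_finite_support(2)[where F = "{j}" and K = K and w = "\<lambda>_. 1" and A = A]
  have e3: "?e \<in> ell2 K" "0 < Re (ell2_form K A ?e ?e)" using e pos by auto
  have "\<exists>r>0. is_eigenvalue K A (complex_of_real r) \<and> (\<forall>u\<in>ell2 K. Re (ell2_form K A u u) \<le> r * sqnorm K u)"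
    by (rule largest_eigenvalue_exists[OF A hermitian_op e3])
  then obtain r where r: "0 < r" "is_eigenvalue K A (complex_of_real r)"
    "\<And>u. u \<in> ell2 K \<Longrightarrow> Re (ell2_form K A u u) \<le> r * sqnorm K u" by blast
  have le: "Re (\<Sum>k\<in>F. \<Sum>l\<in>F. cnj (w k) * A k l * w l) \<le> r * (\<Sum>k\<in>F. (cmod (w k))\<^sup>2)"
    if "finite F" "F \<subseteq> K" for F w
    using r(3)[OF ell2_form_finite_support(1)[OF that, of w]] ell2_form_finite_support(2)[OF that, where w = w and A = A]
      ell2_form_finite_support(3)[OF that, where w = w] by simp
  have "lambda_max K A = r"
    unfolding lambda_max_def by (rule Greatest_equality) (fact r(2), rule eigenvalue_le[OF A _ le])
  then show "0 < lambda_max K A" "is_eigenvalue K A (complex_of_real (lambda_max K A))"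
    "\<And>F w. finite F \<Longrightarrow> F \<subseteq> K \<Longrightarrow>
       Re (\<Sum>k\<in>F. \<Sum>l\<in>F. cnj (w k) * A k l * w l) \<le> lambda_max K A * (\<Sum>k\<in>F. (cmod (w k))\<^sup>2)"
    using r le by auto
qed

text \<open>
  The hypotheses on \<open>g\<close> hold for Gram matrices. A Gram matrix with vanishing diagonal is zero and has
  zero as its only eigenvalue; otherwise \<open>lambda_max\<close> is attained.
\<close>

lemma lambda_max_le:
  assumes g: "g summable_on K" and g0: "\<And>k. k \<in> K \<Longrightarrow> 0 \<le> g k" and diag: "\<And>k. k \<in> K \<Longrightarrow> Re (A k k) = g k"
    and cs: "\<And>k l. k \<in> K \<Longrightarrow> l \<in> K \<Longrightarrow> (cmod (A k l))\<^sup>2 \<le> g k * g l"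
    and hermitian_op: "\<And>k l. k \<in> K \<Longrightarrow> l \<in> K \<Longrightarrow> A k l = cnj (A l k)"
    and ne: "K \<noteq> {}"
    and le: "\<And>F w. finite F \<Longrightarrow> F \<subseteq> K \<Longrightarrow>
       Re (\<Sum>k\<in>F. \<Sum>l\<in>F. cnj (w k) * A k l * w l) \<le> C * (\<Sum>k\<in>F. (cmod (w k))\<^sup>2)"
  shows "lambda_max K A \<le> C"
proof (cases "\<exists>j\<in>K. 0 < g j")
  case True
  then obtain j where j: "j \<in> K" "0 < Re (A j j)" using diag by auto
  have A: "hilbert_schmidt K A" by (rule hilbert_schmidtI[OF g g0 cs])
  show ?thesis by (rule eigenvalue_le[OF A lambda_max_attained(2)[OF A hermitian_op j] le])
next
  case False
  then have "g k = 0" if "k \<in> K" for k using g0[OF that] that by force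
  then have A0: "A k l = 0" if "k \<in> K" "l \<in> K" for k l using cs[OF that] that by simp
  have ma: "mat_app K A v k = 0" if "k \<in> K" for v k
    unfolding mat_app_def using A0 that by (intro infsum_0) auto
  obtain j where j: "j \<in> K" using ne by blast
  have "is_eigenvalue K A (complex_of_real 0)"
    unfolding is_eigenvalue_def
    using ell2_form_finite_support(1)[of "{j}" K "\<lambda>_. 1"] j ma
    by (intro bexI[of _ "\<lambda>k. if k \<in> {j} then 1 else 0"]) auto
  moreover have "y \<le> 0" if "is_eigenvalue K A (complex_of_real y)" for y
    using that ma unfolding is_eigenvalue_def by force
  ultimately have "lambda_max K A = 0"
    unfolding lambda_max_def by (rule Greatest_equality)
  moreover have "0 \<le> C" using le[of "{j}" "\<lambda>_. 1"] j A0 by simp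
  ultimately show ?thesis by simp
qed

text \<open>
  The smallest eigenvalue is found as the largest one of \<open>s - A\<close>, with the shift \<open>s\<close> so large that this
  matrix has a positive diagonal entry.
\<close>

lemma lambda_min_attained:
  assumes K: "finite K" "K \<noteq> {}"
    and hermitian_op: "\<And>k l. k \<in> K \<Longrightarrow> l \<in> K \<Longrightarrow> A k l = cnj (A l k)"
  shows "Re (\<Sum>k\<in>K. \<Sum>l\<in>K. cnj (w k) * A k l * w l) \<ge> lambda_min K A * (\<Sum>k\<in>K. (cmod (w k))\<^sup>2)"
    and "(\<And>w. Re (\<Sum>k\<in>K. \<Sum>l\<in>K. cnj (w k) * A k l * w l) \<ge> c * (\<Sum>k\<in>K. (cmod (w k))\<^sup>2)) \<Longrightarrow> c \<le> lambda_min K A"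
proof -
  obtain j where j: "j \<in> K" using K by blast
  define s where "s = Re (A j j) + 1"
  define B where "B = (\<lambda>k l. (if k = l then complex_of_real s else 0) - A k l)"
  have B: "hilbert_schmidt K B" unfolding hilbert_schmidt_def using K by simp
  have hB: "B k l = cnj (B l k)" if "k \<in> K" "l \<in> K" for k l
    using hermitian_op[OF that] unfolding B_def by simp
  have pB: "0 < Re (B j j)" unfolding B_def s_def by simp
  have app: "mat_app K B v k = of_real s * v k - mat_app K A v k" if "k \<in> K" for v k
    unfolding mat_app_def B_def using K that
    by (simp add: left_diff_distrib sum_subtractf if_distrib[of "\<lambda>z. z * _"] cong: if_cong)
  have eig: "is_eigenvalue K A (complex_of_real r) \<longleftrightarrow> is_eigenvalue K B (complex_of_real (s - r))" for r
    unfolding is_eigenvalue_def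
    by (intro bex_cong refl conj_cong ball_cong) (auto simp: app left_diff_distrib)
  have fB: "Re (\<Sum>k\<in>K. \<Sum>l\<in>K. cnj (w k) * B k l * w l) = s * (\<Sum>k\<in>K. (cmod (w k))\<^sup>2) - Re (\<Sum>k\<in>K. \<Sum>l\<in>K. cnj (w k) * A k l * w l)" for w
  proof -
    have "(\<Sum>k\<in>K. \<Sum>l\<in>K. cnj (w k) * B k l * w l) = (\<Sum>k\<in>K. of_real s * (cnj (w k) * w k)) - (\<Sum>k\<in>K. \<Sum>l\<in>K. cnj (w k) * A k l * w l)"
      unfolding B_def sum_subtractf[symmetric]
    proof (intro sum.cong refl)
      fix k assume k: "k \<in> K"
      have "(\<Sum>l\<in>K. cnj (w k) * ((if k = l then of_real s else 0) - A k l) * w l)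
        = (\<Sum>l\<in>K. (if k = l then cnj (w k) * of_real s * w l else 0) - cnj (w k) * A k l * w l)"
        by (intro sum.cong) (auto simp: algebra_simps)
      then show "(\<Sum>l\<in>K. cnj (w k) * ((if k = l then of_real s else 0) - A k l) * w l) = of_real s * (cnj (w k) * w k) - (\<Sum>l\<in>K. cnj (w k) * A k l * w l)"
        using k K by (simp add: sum_subtractf)
    qed
    moreover have "(\<Sum>k\<in>K. of_real s * (cnj (w k) * w k)) = complex_of_real (s * (\<Sum>k\<in>K. (cmod (w k))\<^sup>2))"
      by (simp add: sum_distrib_left complex_norm_square mult_ac del: of_real_power)
    ultimately show ?thesis by simp
  qed
  define r where "r = s - lambda_max K B"
  have mB2: "is_eigenvalue K B (complex_of_real (lambda_max K B))"
    by (rule lambda_max_attained(2)[OF B hB j pB])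
  have mB3: "Re (\<Sum>k\<in>F. \<Sum>l\<in>F. cnj (w k) * B k l * w l) \<le> lambda_max K B * (\<Sum>k\<in>F. (cmod (w k))\<^sup>2)"
    if "finite F" "F \<subseteq> K" for F w
    by (rule lambda_max_attained(3)[OF B hB j pB that])
  have ev: "is_eigenvalue K A (complex_of_real r)" unfolding eig r_def using mB2 by simp
  have low: "r \<le> y" if "is_eigenvalue K A (complex_of_real y)" for y
    using eigenvalue_le[OF B that[unfolded eig] mB3] unfolding r_def by linarith
  have r: "lambda_min K A = r" unfolding lambda_min_def by (rule Least_equality) (fact ev, rule low)
  show "Re (\<Sum>k\<in>K. \<Sum>l\<in>K. cnj (w k) * A k l * w l) \<ge> lambda_min K A * (\<Sum>k\<in>K. (cmod (w k))\<^sup>2)"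
    using mB3[OF K(1) subset_refl, of w] unfolding fB r r_def by (simp add: algebra_simps)
  assume c: "\<And>w. Re (\<Sum>k\<in>K. \<Sum>l\<in>K. cnj (w k) * A k l * w l) \<ge> c * (\<Sum>k\<in>K. (cmod (w k))\<^sup>2)"
  have "lambda_max K B \<le> s - c"
  proof (rule eigenvalue_le[OF B mB2])
    fix F and w :: "'a \<Rightarrow> complex" assume F: "finite F" "F \<subseteq> K"
    define w' where "w' = (\<lambda>k. if k \<in> F then w k else 0)"
    have K2: "K = F \<union> (K - F)" using F by blast
    have e: "(\<Sum>k\<in>K. \<Sum>l\<in>K. cnj (w' k) * B k l * w' l) = (\<Sum>k\<in>F. \<Sum>l\<in>F. cnj (w k) * B k l * w l)"
      "(\<Sum>k\<in>K. (cmod (w' k))\<^sup>2) = (\<Sum>k\<in>F. (cmod (w k))\<^sup>2)"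
      unfolding w'_def using F K
      by (auto intro!: sum.mono_neutral_cong_right sum.neutral)
    show "Re (\<Sum>k\<in>F. \<Sum>l\<in>F. cnj (w k) * B k l * w l) \<le> (s - c) * (\<Sum>k\<in>F. (cmod (w k))\<^sup>2)"
      unfolding e[symmetric] fB using c[of w'] by (simp add: algebra_simps)
  qed
  then show "c \<le> lambda_min K A" unfolding r r_def by simp
qed

context fin_index begin

lemma inv_pair_vscale:
  assumes "inv_pair X R" "0 < (c::real)"
  shows "inv_pair (\<lambda>u. vscale (of_real c) (X u)) (\<lambda>u. vscale (of_real (1 / c)) (R u))"
proof -
  have X: "hermitian_op X" and R: "pos_semidef R" and XR: "\<And>u. X (R u) = restrict_fin u" and RX: "\<And>u. R (X u) = restrict_fin u"
    using assms(1) unfolding inv_pair_def by auto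
  note lX = hermitian_opD(1)[OF X] and lR = hermitian_opD(1)[OF pos_semidefD(1)[OF R]]
  have c: "vscale (of_real c) (vscale (of_real (1 / c)) u) = u" "vscale (of_real (1 / c)) (vscale (of_real c) u) = u" for u
    using assms(2) by (auto simp: vscale_def fun_eq_iff)
  show ?thesis unfolding inv_pair_def
  proof (intro conjI allI)
    show "hermitian_op (\<lambda>u. vscale (of_real c) (X u))" by (rule hermitian_op_vscale[OF X])
    show "pos_semidef (\<lambda>u. vscale (of_real (1 / c)) (R u))" by (rule pos_semidef_vscale[OF R]) (use assms(2) in simp)
    show "vscale (of_real c) (X (vscale (of_real (1 / c)) (R u))) = restrict_fin u" for u
      unfolding linop_vscale_arg[OF lX] XR by (rule c)
    show "vscale (of_real (1 / c)) (R (vscale (of_real c) (X u))) = restrict_fin u" for u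
      unfolding linop_vscale_arg[OF lR] RX by (rule c)
  qed
qed

lemma inv_pair_restrict_fin: "inv_pair restrict_fin restrict_fin"
proof -
  have "restrict_fin (restrict_fin u) = restrict_fin u" for u by (simp add: restrict_fin_def fun_eq_iff)
  moreover have "pos_semidef restrict_fin" unfolding pos_semidef_def by (auto simp: qform_restrict_fin)
  ultimately show ?thesis unfolding inv_pair_def by auto
qed

end

lemma (in gram) qform_H_sum:
  "qform H w = Re (\<Sum>k\<in>F. \<Sum>l\<in>F. cnj (w k) * integral_gram \<mu> v k l * w l)"
  unfolding qform_def inner_fin_def H_def op_of_def by (simp add: sum_distrib_left mult.assoc)

text \<open>
  The predicate \<open>Q\<close> is the invariant of the list of chosen points, in the form in which
  \<open>interleave_barriers\<close> uses it: the barrier invariant in general, and the final estimate itself when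
  there is only one function.
\<close>

lemma (in pd_gram) lower_sampling:
  assumes n: "card F \<le> n"
  shows "\<exists>Q. Q [] \<and>
    (\<forall>h. Q h \<longrightarrow> (\<exists>L. integrable \<mu> L \<and> 1 \<le> (LINT x|\<mu>. L x) \<and>
       (\<forall>x t. 0 < t \<longrightarrow> 1 \<le> t * L x \<longrightarrow> Q ((t, x) # h)))) \<and>
    (\<forall>h u. Q h \<longrightarrow> length h = n \<longrightarrow>
       n * (1 - sqrt ((real (card F) - 1) / n))\<^sup>2 * qform H u \<le> energy h u)"
proof (cases "card F = 1")
  case True
  then obtain j where j: "F = {j}" by (auto simp: card_1_singleton_iff)
  define D where "D = (LINT x|\<mu>. (cmod (v j x))\<^sup>2)"
  have innerj: "inner_fin u w = cnj (u j) * w j" and normsqj: "normsq u = (cmod (u j))\<^sup>2" for u w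
    unfolding inner_fin_def normsq_def by (simp_all add: j)
  have q: "qform H u = (cmod (u j))\<^sup>2 * D" for u
    unfolding qform_H D_def innerj by (simp add: norm_mult power_mult_distrib)
  have D: "0 < D" using hpd[of "\<lambda>_. 1"] unfolding q normsqj by simp
  have int: "integrable \<mu> (\<lambda>x. (cmod (v j x))\<^sup>2)" using sqi[of j] j unfolding square_integrable_def by auto
  define Q where "Q = (\<lambda>h. \<forall>u. length h * qform H u \<le> energy h u)"
  show ?thesis
  proof (intro exI[of _ Q] conjI allI impI)
    show "Q []" unfolding Q_def energy_def by simp
    fix h assume h: "Q h"
    have "Q ((t, x) # h)" if "0 < t" "1 \<le> t * ((cmod (v j x))\<^sup>2 / D)" for x t
      unfolding Q_def
    proof
      fix u
      have "D \<le> t * (cmod (v j x))\<^sup>2" using that D by (simp add: field_simps)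
      then have "(cmod (u j))\<^sup>2 * D \<le> (cmod (u j))\<^sup>2 * (t * (cmod (v j x))\<^sup>2)" by (intro mult_left_mono) auto
      moreover have "energy ((t, x) # h) u = (cmod (u j))\<^sup>2 * (t * (cmod (v j x))\<^sup>2) + energy h u"
        unfolding energy_def innerj by (simp add: norm_mult power_mult_distrib)
      moreover have "length h * ((cmod (u j))\<^sup>2 * D) \<le> energy h u" using h unfolding Q_def q by blast
      moreover have "length ((t, x) # h) * qform H u = length h * ((cmod (u j))\<^sup>2 * D) + (cmod (u j))\<^sup>2 * D"
        unfolding q by (simp add: algebra_simps)
      ultimately show "length ((t, x) # h) * qform H u \<le> energy ((t, x) # h) u" by linarith
    qed
    moreover have "1 \<le> (LINT x|\<mu>. (cmod (v j x))\<^sup>2 / D)" using D unfolding D_def by simp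
    ultimately show "\<exists>L. integrable \<mu> L \<and> 1 \<le> (LINT x|\<mu>. L x) \<and>
       (\<forall>x t. 0 < t \<longrightarrow> 1 \<le> t * L x \<longrightarrow> Q ((t, x) # h))"
      using int by (intro exI[of _ "\<lambda>x. (cmod (v j x))\<^sup>2 / D"]) auto
  next
    fix h u assume "Q h" "length h = n"
    then show "n * (1 - sqrt ((real (card F) - 1) / n))\<^sup>2 * qform H u \<le> energy h u"
      using True unfolding Q_def by auto
  qed
next
  case False
  moreover have "card F \<noteq> 0" using neF finF by simp
  ultimately have m: "2 \<le> card F" by linarith
  define m where "m = real (card F)"
  have m2: "2 \<le> m" "m \<le> n" using m n unfolding m_def by auto
  \<comment> \<open>The choice of \<open>\<epsilon>\<close> maximises \<open>n \<delta> - (m - 1) / \<epsilon>\<close> subject to \<open>1 / \<delta> - \<epsilon> = 1\<close>.\<close>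
  define q where "q = sqrt ((m - 1) / n)"
  have q: "0 < q" "q < 1" "q\<^sup>2 * n = m - 1"
    using m2 unfolding q_def by (auto simp: field_simps)
  define \<epsilon> where "\<epsilon> = q / (1 - q)"
  define \<delta> where "\<delta> = 1 - q"
  have "\<delta> * \<epsilon> = q" using q unfolding \<epsilon>_def \<delta>_def by simp
  moreover have "1 / \<delta> - \<epsilon> = 1"
    using q unfolding \<epsilon>_def \<delta>_def by (simp add: diff_divide_distrib[symmetric])
  ultimately have ed: "0 < \<epsilon>" "0 < \<delta>" "\<delta> * \<epsilon> < 1" "1 / \<delta> - \<epsilon> = 1"
    using q unfolding \<epsilon>_def \<delta>_def by auto
  obtain N where N: "inv_pair H N" using positive_definite_inverse[OF lin_H(2) hpd] by blast
  define X where "X = (\<lambda>u. vscale (of_real (m / \<epsilon>)) (H u))"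
  define Q where "Q = (\<lambda>h. \<exists>R. inv_pair (barrier X (- \<delta>) 1 h) R \<and> \<phi> R \<le> \<epsilon>)"
  show ?thesis
  proof (intro exI[of _ Q] conjI allI impI)
    have "\<phi> N = m" unfolding m_def using N by (intro \<phi>_inverse_H inv_pairD(3)) (auto simp: inv_pair_def)
    then have "\<phi> (\<lambda>u. vscale (of_real (1 / (m / \<epsilon>))) (N u)) = \<epsilon>" unfolding \<phi>_vscale using m2 by simp
    moreover have "inv_pair X (\<lambda>u. vscale (of_real (1 / (m / \<epsilon>))) (N u))"
      unfolding X_def by (rule inv_pair_vscale[OF N]) (use m2 ed in simp)
    ultimately show "Q []" unfolding Q_def barrier.simps by (metis order_refl)
  next
    fix h assume "Q h"
    then obtain R where R: "inv_pair (barrier X (- \<delta>) 1 h) R" "\<phi> R \<le> \<epsilon>" unfolding Q_def by blast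
    show "\<exists>L. integrable \<mu> L \<and> 1 \<le> (LINT x|\<mu>. L x) \<and>
       (\<forall>x t. 0 < t \<longrightarrow> 1 \<le> t * L x \<longrightarrow> Q ((t, x) # h))"
      using lower_barrier_step[OF R ed(2,3)] unfolding Q_def barrier.simps ed(4) mult_1 fst_conv snd_conv .
  next
    fix h u assume "Q h" and len: "length h = n"
    then obtain R where R: "inv_pair (barrier X (- \<delta>) 1 h) R" "\<phi> R \<le> \<epsilon>" unfolding Q_def by blast
    have "qform H u \<le> \<phi> R * qform (barrier X (- \<delta>) 1 h) u" by (rule H_le_potential[OF R(1)])
    also have "\<dots> \<le> \<epsilon> * qform (barrier X (- \<delta>) 1 h) u"
      using R(2) pos_semidefD(2)[OF inv_pair_pos_semidef[OF R(1)]] by (intro mult_right_mono) auto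
    also have "qform (barrier X (- \<delta>) 1 h) u = m / \<epsilon> * qform H u - n * \<delta> * qform H u + energy h u"
      unfolding qform_barrier len X_def qform_vscale by simp
    finally have "qform H u \<le> \<epsilon> * (m / \<epsilon> * qform H u - n * \<delta> * qform H u + energy h u)" .
    then have "qform H u / \<epsilon> \<le> m / \<epsilon> * qform H u - n * \<delta> * qform H u + energy h u"
      using ed(1) by (simp only: divide_le_eq mult.commute[of _ \<epsilon>] if_True simp_thms)
    moreover have "(n * \<delta> - (m - 1) / \<epsilon>) * qform H u = n * \<delta> * qform H u - m / \<epsilon> * qform H u + qform H u / \<epsilon>"
      by (simp add: left_diff_distrib diff_divide_distrib)
    ultimately have "(n * \<delta> - (m - 1) / \<epsilon>) * qform H u \<le> energy h u" by linarith
    moreover have "(m - 1) / \<epsilon> = n * q * (1 - q)"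
      unfolding q(3)[symmetric] \<epsilon>_def using q(1,2) by (simp add: power2_eq_square)
    then have "n * \<delta> - (m - 1) / \<epsilon> = n * (1 - q)\<^sup>2"
      unfolding \<delta>_def by (simp add: power2_eq_square algebra_simps)
    ultimately show "n * (1 - sqrt ((real (card F) - 1) / n))\<^sup>2 * qform H u \<le> energy h u"
      unfolding q_def m_def by simp
  qed
qed

lemma finite_Cauchy_Schwarz:
  fixes u w :: "'k \<Rightarrow> complex"
  shows "(cmod (\<Sum>k\<in>F. cnj (u k) * w k))\<^sup>2 \<le> (\<Sum>k\<in>F. (cmod (u k))\<^sup>2) * (\<Sum>k\<in>F. (cmod (w k))\<^sup>2)"
proof (cases "finite F")
  case True
  then interpret fin_index F by unfold_locales
  show ?thesis using Cauchy_Schwarz[of u w] unfolding inner_fin_def normsq_def .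
qed simp

text \<open>
  Following the trace \<open>\<Sum> t \<bar>b(x)\<bar>\<^sup>2\<close> alone bounds the matrix by \<open>n\<close> times the trace of \<open>J\<close>. The function
  \<open>U(x) = \<bar>b(x)\<bar>\<^sup>2 / T\<close> has integral one.
\<close>

lemma upper_sampling_trace:
  fixes b :: "'k \<Rightarrow> 'x \<Rightarrow> complex" and T :: real
  assumes K: "countable K" and b: "\<And>k. k \<in> K \<Longrightarrow> square_integrable \<mu> (b k)"
    and sm: "(\<lambda>k. LINT x|\<mu>. (cmod (b k x))\<^sup>2) summable_on K"
    and T: "T = (\<Sum>\<^sub>\<infinity>k\<in>K. (LINT x|\<mu>. (cmod (b k x))\<^sup>2))" "0 < T"
  defines "G \<equiv> {x \<in> space \<mu>. (\<lambda>k. b k x) \<in> ell2 K}"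
  shows "\<exists>P. P [] \<and>
    (\<forall>h. P h \<longrightarrow> (\<exists>U. integrable \<mu> U \<and> (\<forall>x. 0 \<le> U x) \<and> (LINT x|\<mu>. U x) \<le> (1::real) \<and>
       (\<forall>x\<in>G. \<forall>t. 0 < t \<longrightarrow> t * U x \<le> 1 \<longrightarrow> P ((t, x) # h)))) \<and>
    (\<forall>h F w. P h \<longrightarrow> finite F \<longrightarrow> F \<subseteq> K \<longrightarrow>
       (\<Sum>p\<leftarrow>h. fst p * (cmod (\<Sum>k\<in>F. cnj (w k) * b k (snd p)))\<^sup>2)
         \<le> length h * T * (\<Sum>k\<in>F. (cmod (w k))\<^sup>2))"
proof -
  define S where "S = (\<lambda>x. \<Sum>\<^sub>\<infinity>k\<in>K. (cmod (b k x))\<^sup>2)"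
  note int = integral_infsum_nonneg[of K \<mu> "\<lambda>k x. (cmod (b k x))\<^sup>2", OF K _ _ sm]
  have S: "integrable \<mu> S" "(LINT x|\<mu>. S x) = T"
    unfolding S_def T using int(2,3) b unfolding square_integrable_def by auto
  have S0: "0 \<le> S x" for x unfolding S_def by (intro infsum_nonneg) auto
  define P where "P = (\<lambda>h. (\<forall>p\<in>set h. 0 < fst p \<and> snd p \<in> G) \<and> (\<Sum>p\<leftarrow>h. fst p * S (snd p)) \<le> length h * T)"
  show ?thesis
  proof (intro exI[of _ P] conjI allI impI)
    show "P []" unfolding P_def by simp
    fix h assume h: "P h"
    have "P ((t, x) # h)" if "x \<in> G" "0 < t" "t * (S x / T) \<le> 1" for x t
    proof -
      have "t * S x \<le> T" using that(3) T(2) by (simp add: field_simps)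
      then show ?thesis using h that unfolding P_def by (simp add: algebra_simps add_mono)
    qed
    then show "\<exists>U. integrable \<mu> U \<and> (\<forall>x. 0 \<le> U x) \<and> (LINT x|\<mu>. U x) \<le> 1 \<and>
       (\<forall>x\<in>G. \<forall>t. 0 < t \<longrightarrow> t * U x \<le> 1 \<longrightarrow> P ((t, x) # h))"
      using S S0 T(2) by (intro exI[of _ "\<lambda>x. S x / T"]) auto
  next
    fix h F and w :: "'k \<Rightarrow> complex" assume h: "P h" and F: "finite F" "F \<subseteq> K"
    let ?W = "\<Sum>k\<in>F. (cmod (w k))\<^sup>2"
    have "(\<Sum>p\<leftarrow>h. fst p * (cmod (\<Sum>k\<in>F. cnj (w k) * b k (snd p)))\<^sup>2) \<le> (\<Sum>p\<leftarrow>h. fst p * S (snd p) * ?W)"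
    proof (rule sum_list_mono)
      fix p assume "p \<in> set h"
      then have p: "0 < fst p" "snd p \<in> G" using h unfolding P_def by auto
      have "(\<Sum>k\<in>F. (cmod (b k (snd p)))\<^sup>2) \<le> S (snd p)"
        unfolding S_def using p(2) F unfolding G_def ell2_def by (intro finite_sum_le_infsum) auto
      then have "?W * (\<Sum>k\<in>F. (cmod (b k (snd p)))\<^sup>2) \<le> ?W * S (snd p)"
        by (intro mult_left_mono sum_nonneg) auto
      then have "(cmod (\<Sum>k\<in>F. cnj (w k) * b k (snd p)))\<^sup>2 \<le> ?W * S (snd p)"
        using finite_Cauchy_Schwarz[of w "\<lambda>k. b k (snd p)" F] by linarith
      then show "fst p * (cmod (\<Sum>k\<in>F. cnj (w k) * b k (snd p)))\<^sup>2 \<le> fst p * S (snd p) * ?W"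
        using p(1) by (simp add: mult.assoc mult.commute[of ?W])
    qed
    also have "\<dots> = (\<Sum>p\<leftarrow>h. fst p * S (snd p)) * ?W" by (rule sum_list_mult_const)
    also have "\<dots> \<le> length h * T * ?W"
      using h unfolding P_def by (intro mult_right_mono sum_nonneg) auto
    finally show "(\<Sum>p\<leftarrow>h. fst p * (cmod (\<Sum>k\<in>F. cnj (w k) * b k (snd p)))\<^sup>2) \<le> length h * T * ?W" .
  qed
qed

lemma norm_square_add_le:
  assumes "0 < (s::real)"
  shows "(cmod (y + z))\<^sup>2 \<le> (1 + s) * (cmod y)\<^sup>2 + (1 + 1 / s) * (cmod z)\<^sup>2"
proof -
  have "(cmod (y + z))\<^sup>2 \<le> (cmod y + cmod z)\<^sup>2"
    by (intro power_mono norm_triangle_ineq) auto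
  also have "\<dots> = (cmod y)\<^sup>2 + (cmod z)\<^sup>2 + 2 * (cmod y * cmod z)" by (simp add: power2_sum)
  also have "0 \<le> (s * cmod y - cmod z)\<^sup>2 / s" using assms by simp
  then have "2 * (cmod y * cmod z) \<le> s * (cmod y)\<^sup>2 + 1 / s * (cmod z)\<^sup>2"
    using assms by (simp add: power2_eq_square field_simps)
  finally show ?thesis by (simp add: algebra_simps)
qed

text \<open>
  Here \<open>p\<close> stands for \<open>sqrt ((M - 1) / n)\<close> with \<open>M = T / \<Lambda>\<close>. The barrier is run on a finite set \<open>F\<close> of
  indices, and \<open>S(x) / \<kappa>\<close>, with \<open>S\<close> the squared norm of the remaining entries of \<open>b(x)\<close>, is added to the
  function that bounds \<open>1 / t\<close>. This keeps the trace of the remaining block below \<open>n \<kappa>\<close>. A positive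
  semidefinite block matrix is bounded by the sum of the bounds of its diagonal blocks, and that sum
  is the desired constant.
\<close>

lemma upper_sampling_barrier:
  fixes b :: "'k \<Rightarrow> 'x \<Rightarrow> complex" and T \<Lambda> p :: real and n :: nat
  assumes K: "countable K" and k0: "k0 \<in> K" and b: "\<And>k. k \<in> K \<Longrightarrow> square_integrable \<mu> (b k)"
    and sm: "(\<lambda>k. LINT x|\<mu>. (cmod (b k x))\<^sup>2) summable_on K"
    and T: "T = (\<Sum>\<^sub>\<infinity>k\<in>K. (LINT x|\<mu>. (cmod (b k x))\<^sup>2))"
    and pd: "\<And>F w. finite F \<Longrightarrow> F \<subseteq> K \<Longrightarrow> 0 < (\<Sum>k\<in>F. (cmod (w k))\<^sup>2) \<Longrightarrow>
       0 < Re (\<Sum>k\<in>F. \<Sum>l\<in>F. cnj (w k) * integral_gram \<mu> b k l * w l)"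
    and \<Lambda>: "0 < \<Lambda>" and le: "\<And>F w. finite F \<Longrightarrow> F \<subseteq> K \<Longrightarrow>
       Re (\<Sum>k\<in>F. \<Sum>l\<in>F. cnj (w k) * integral_gram \<mu> b k l * w l) \<le> \<Lambda> * (\<Sum>k\<in>F. (cmod (w k))\<^sup>2)"
    and p: "0 < p" "1 < n * p" and TM: "T = (1 + n * p\<^sup>2) * \<Lambda>"
  defines "G \<equiv> {x \<in> space \<mu>. (\<lambda>k. b k x) \<in> ell2 K}"
  shows "\<exists>P. P [] \<and>
    (\<forall>h. P h \<longrightarrow> length h < n \<longrightarrow> (\<exists>U. integrable \<mu> U \<and> (\<forall>x. 0 \<le> U x) \<and> (LINT x|\<mu>. U x) \<le> (1::real) \<and>
       (\<forall>x\<in>G. \<forall>t. 0 < t \<longrightarrow> t * U x \<le> 1 \<longrightarrow> P ((t, x) # h)))) \<and>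
    (\<forall>h F w. P h \<longrightarrow> length h = n \<longrightarrow> finite F \<longrightarrow> F \<subseteq> K \<longrightarrow>
       (\<Sum>p\<leftarrow>h. fst p * (cmod (\<Sum>k\<in>F. cnj (w k) * b k (snd p)))\<^sup>2)
         \<le> n * (1 + p)\<^sup>2 * \<Lambda> * (\<Sum>k\<in>F. (cmod (w k))\<^sup>2))"
proof -
  define J where "J = (\<lambda>k. LINT x|\<mu>. (cmod (b k x))\<^sup>2)"
  have n: "0 < real n" using p by (cases n) auto
  have np: "0 < n - 1 / p" using p by (simp add: field_simps)
  have J0: "0 \<le> J k" for k unfolding J_def by (simp add: integral_nonneg)
  have Jsm: "J summable_on K" using sm unfolding J_def .
  have TJ: "T = infsum J K" unfolding T J_def ..
  have diag: "integral_gram \<mu> b k k = of_real (J k)" for k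
  proof -
    have "(LINT x|\<mu>. b k x * cnj (b k x)) = (LINT x|\<mu>. complex_of_real ((cmod (b k x))\<^sup>2))"
      by (simp add: complex_norm_square del: of_real_power)
    then show ?thesis unfolding integral_gram_def J_def by (simp del: of_real_power)
  qed
  have Jk0: "0 < J k0" using pd[of "{k0}" "\<lambda>_. 1"] k0 by (simp add: diag)
  \<comment> \<open>Without truncation the optimum is \<open>1 / \<delta> = 1 - \<epsilon> = 1 / (1 + p)\<close>.\<close>
  define \<epsilon> where "\<epsilon> = p / (1 + p)"
  define \<alpha> where "\<alpha> = T / \<epsilon>"
  define C where "C = \<alpha> + n * (1 + p) * \<Lambda>"
  have T0: "0 < T" unfolding TM using \<Lambda> n by (simp add: add_pos_nonneg)
  have e0: "0 < \<epsilon>" "0 < \<alpha>" "0 < C"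
    using p \<Lambda> n T0 unfolding \<epsilon>_def \<alpha>_def C_def by (auto intro!: add_pos_pos)
  \<comment> \<open>A lower bound for the drop of the potential in each step; \<open>C\<close> bounds the operator at all times.\<close>
  define \<eta> where "\<eta> = (1 + p) / 2 * (J k0 / C)\<^sup>2"
  have eta: "0 < \<eta>" using p Jk0 e0 unfolding \<eta>_def by simp
  \<comment> \<open>The barrier advances by \<open>\<xi>\<close> less than in the optimum. The second term in the minimum pays half of
      \<open>\<eta>\<close> for this, and the third keeps the final coefficient of \<open>J\<close> nonnegative.\<close>
  define \<xi> where "\<xi> = min (1 / 2) (min (\<eta> / 4) ((1 + p) * (n - 1 / p) / n))"
  have xi: "0 < \<xi>" "\<xi> \<le> 1 / 2" "\<xi> \<le> \<eta> / 4" "\<xi> \<le> (1 + p) * (n - 1 / p) / n"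
  proof -
    have "0 < (1 + p) * (n - 1 / p) / n" using np n p by simp
    then show "0 < \<xi>" unfolding \<xi>_def using eta by simp
  qed (unfold \<xi>_def, linarith+)
  define \<delta> where "\<delta> = 1 + p - \<xi>"
  have d: "(1 + p) / 2 \<le> \<delta>" "0 < \<delta>" "\<delta> \<le> 1 + p" "1 / 2 \<le> \<delta>" unfolding \<delta>_def using xi p by auto
  have d2: "1 / \<delta> \<le> 1 / (1 + p) + \<eta> / 2"
  proof -
    have "1 / \<delta> - 1 / (1 + p) = \<xi> / (\<delta> * (1 + p))"
      using d p unfolding \<delta>_def by (simp add: field_simps)
    also have "\<dots> \<le> \<xi> / (1 / 2)"
    proof -
      have "1 / 2 * 1 \<le> \<delta> * (1 + p)" by (rule mult_mono) (use d p in auto)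
      then show ?thesis using xi by (intro divide_left_mono) auto
    qed
    finally show ?thesis using xi by simp
  qed
  define c where "c = n * \<delta> - 1 / \<epsilon>"
  have c: "0 \<le> c"
  proof -
    have "n * \<xi> \<le> (1 + p) * (n - 1 / p)" using xi(4) n by (simp add: field_simps)
    moreover have "c = (1 + p) * (n - 1 / p) - n * \<xi>"
      unfolding c_def \<delta>_def \<epsilon>_def using p by (simp add: field_simps)
    ultimately show ?thesis by simp
  qed
  \<comment> \<open>The advance saved on \<open>F\<close> equals the trace allowed off \<open>F\<close>.\<close>
  define \<kappa> where "\<kappa> = \<xi> * \<Lambda>"
  have kap: "0 < \<kappa>" using xi \<Lambda> unfolding \<kappa>_def by simp
  define CF where "CF = \<alpha> + c * \<Lambda>"
  have CF: "0 < CF" using e0 c \<Lambda> unfolding CF_def by (simp add: add_pos_nonneg)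
  have final: "CF + n * \<kappa> = n * (1 + p)\<^sup>2 * \<Lambda>"
    unfolding CF_def \<kappa>_def c_def \<delta>_def \<alpha>_def \<epsilon>_def TM using p by (simp add: field_simps power2_eq_square)
  \<comment> \<open>The other half of \<open>\<eta>\<close> pays for the entries off \<open>F\<close>.\<close>
  obtain F1 where F1: "finite F1" "F1 \<subseteq> K" "dist (sum J F1) (infsum J K) \<le> \<kappa> * \<eta> / 2"
    using infsum_finite_approximation[OF Jsm, of "\<kappa> * \<eta> / 2"] kap eta by auto
  define F where "F = insert k0 F1"
  have F: "finite F" "F \<subseteq> K" "k0 \<in> F" using F1 k0 unfolding F_def by auto
  define \<tau> where "\<tau> = infsum J (K - F)"
  have tau: "\<tau> = T - sum J F"
    unfolding \<tau>_def TJ using infsum_Diff[OF Jsm, of F] F by simp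
  have tau_le: "\<tau> \<le> \<kappa> * \<eta> / 2"
  proof -
    have "sum J F1 \<le> sum J F" unfolding F_def using F1(1) J0 by (intro sum_mono2) auto
    then show ?thesis using F1(3) unfolding tau TJ dist_real_def by linarith
  qed
  interpret g: pd_gram F \<mu> b
  proof
    show "finite F" by (rule F(1))
    show "square_integrable \<mu> (b k)" if "k \<in> F" for k using b that F(2) by auto
    show "F \<noteq> {}" using F by auto
    interpret gr: gram F \<mu> b by unfold_locales (use F b in auto)
    show "0 < gr.qform gr.H u" if "0 < gr.normsq u" for u
      using pd[OF F(1,2), of u] that unfolding gr.qform_H_sum gr.normsq_def .
  qed
  have HL: "g.qform g.H u \<le> \<Lambda> * g.normsq u" for u
    unfolding g.qform_H_sum g.normsq_def by (rule le[OF F(1,2)])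
  \<comment> \<open>The drop is measured at \<open>k0\<close>, an index chosen before \<open>F\<close>, so that \<open>\<eta>\<close> does not depend on \<open>F\<close>.\<close>
  define e where "e = (\<lambda>k. if k = k0 then 1 else (0::complex))"
  have e: "g.normsq e = 1" "g.qform g.H e = J k0"
  proof -
    show "g.normsq e = 1" unfolding e_def by (rule g.normsq_unit[OF F(3)])
    have "g.inner_fin e u = u k0" for u unfolding e_def by (rule g.inner_fin_unit[OF F(3)])
    then show "g.qform g.H e = J k0" unfolding g.qform_H J_def by simp
  qed
  define S where "S = (\<lambda>x. \<Sum>\<^sub>\<infinity>k\<in>K - F. (cmod (b k x))\<^sup>2)"
  have cKF: "countable (K - F)" using K by auto
  have smKF: "(\<lambda>k. LINT x|\<mu>. (cmod (b k x))\<^sup>2) summable_on (K - F)"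
    using sm by (rule summable_on_subset) auto
  note int = integral_infsum_nonneg[of "K - F" \<mu> "\<lambda>k x. (cmod (b k x))\<^sup>2", OF cKF _ _ smKF]
  have S: "integrable \<mu> S" "(LINT x|\<mu>. S x) = \<tau>"
    unfolding S_def \<tau>_def J_def using int(2,3) b unfolding square_integrable_def by auto
  have S0: "0 \<le> S x" for x unfolding S_def by (intro infsum_nonneg) auto
  define X where "X = (\<lambda>u. vscale (of_real \<alpha>) (g.restrict_fin u))"
  define P where "P = (\<lambda>h. (\<forall>p\<in>set h. 0 < fst p \<and> snd p \<in> G) \<and>
     (\<Sum>p\<leftarrow>h. fst p * S (snd p)) \<le> length h * \<kappa> \<and>
     (\<exists>R. g.inv_pair (g.barrier X \<delta> (- 1) h) R \<and> g.\<phi> R \<le> \<epsilon>))"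
  have PI: "P h" if "\<forall>p\<in>set h. 0 < fst p \<and> snd p \<in> G" "(\<Sum>p\<leftarrow>h. fst p * S (snd p)) \<le> length h * \<kappa>"
    "\<exists>R. g.inv_pair (g.barrier X \<delta> (- 1) h) R \<and> g.\<phi> R \<le> \<epsilon>" for h
    using that unfolding P_def by blast
  have PD: "\<forall>p\<in>set h. 0 < fst p \<and> snd p \<in> G" "(\<Sum>p\<leftarrow>h. fst p * S (snd p)) \<le> length h * \<kappa>"
    "\<exists>R. g.inv_pair (g.barrier X \<delta> (- 1) h) R \<and> g.\<phi> R \<le> \<epsilon>" if "P h" for h
    using that unfolding P_def by blast+
  have qX: "g.qform (g.barrier X \<delta> (- 1) h) u = \<alpha> * g.normsq u + length h * \<delta> * g.qform g.H u - g.energy h u" for h u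
    unfolding g.qform_barrier X_def g.qform_vscale g.qform_restrict_fin by simp
  have "P []"
  proof (rule PI)
    have "g.\<phi> g.restrict_fin = sum J F"
      unfolding g.\<phi>_def g.qform_restrict_fin g.normsq_def J_def
      using g.sqi unfolding square_integrable_def by (intro Bochner_Integration.integral_sum) auto
    also have "\<dots> \<le> T" unfolding TJ using F J0 by (intro finite_sum_le_infsum Jsm) auto
    finally have "g.\<phi> (\<lambda>u. vscale (of_real (1 / \<alpha>)) (g.restrict_fin u)) \<le> 1 / \<alpha> * T"
      unfolding g.\<phi>_vscale using e0 by (intro mult_left_mono) auto
    also have "\<dots> = \<epsilon>" unfolding \<alpha>_def using e0 T0 by simp
    finally show "\<exists>R. g.inv_pair (g.barrier X \<delta> (- 1) []) R \<and> g.\<phi> R \<le> \<epsilon>"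
      using g.inv_pair_vscale[OF g.inv_pair_restrict_fin e0(2)] unfolding X_def g.barrier.simps by blast
  qed auto
  moreover have "\<exists>U. integrable \<mu> U \<and> (\<forall>x. 0 \<le> U x) \<and> (LINT x|\<mu>. U x) \<le> (1::real) \<and>
       (\<forall>x\<in>G. \<forall>t. 0 < t \<longrightarrow> t * U x \<le> 1 \<longrightarrow> P ((t, x) # h))" if h: "P h" and len: "length h < n" for h
  proof -
    note h = PD[OF h]
    obtain R where R: "g.inv_pair (g.barrier X \<delta> (- 1) h) R" "g.\<phi> R \<le> \<epsilon>" using h(3) by blast
    have bound: "g.qform (g.barrier X \<delta> (- 1) h) u + \<delta> * g.qform g.H u \<le> C * g.normsq u" for u
    proof -
      have en: "0 \<le> g.energy h u" unfolding g.energy_def using h(1)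
        by (intro sum_list_nonneg) (auto simp: less_imp_le)
      have H0: "0 \<le> g.qform g.H u" using g.pos_semidefD(2)[OF g.pos_semidef_H] .
      have "real (Suc (length h)) * \<delta> \<le> n * (1 + p)"
        by (rule mult_mono) (use len d in auto)
      then have "real (Suc (length h)) * \<delta> * g.qform g.H u \<le> n * (1 + p) * (\<Lambda> * g.normsq u)"
        by (rule mult_mono) (use HL[of u] H0 p n in auto)
      then show ?thesis unfolding qX C_def using en by (simp add: algebra_simps)
    qed
    obtain U where U: "integrable \<mu> U" "\<And>x. 0 \<le> U x"
      "(LINT x|\<mu>. U x) \<le> 1 / \<delta> + \<epsilon> - \<delta> * (g.qform g.H e / C)\<^sup>2"
      "\<And>x t. 0 < t \<Longrightarrow> t * U x \<le> 1 \<Longrightarrow>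
        \<exists>R. g.inv_pair (\<lambda>u. g.barrier X \<delta> (- 1) h u + vscale (of_real \<delta>) (g.H u) + vscale (of_real (- t)) (g.rank1 (\<lambda>k. b k x) u)) R \<and> g.\<phi> R \<le> \<epsilon>"
      using g.upper_barrier_step[OF R d(2) bound e(1)] by blast
    have "\<eta> \<le> \<delta> * (g.qform g.H e / C)\<^sup>2"
      unfolding e(2) \<eta>_def using d by (intro mult_right_mono) auto
    moreover have "\<tau> / \<kappa> \<le> \<eta> / 2" using tau_le kap by (simp add: field_simps)
    moreover have "1 / (1 + p) + \<epsilon> = 1" unfolding \<epsilon>_def using p by (simp add: add_divide_distrib[symmetric])
    moreover have "(LINT x|\<mu>. U x + S x / \<kappa>) = (LINT x|\<mu>. U x) + \<tau> / \<kappa>"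
      using U(1) S by simp
    ultimately have "(LINT x|\<mu>. U x + S x / \<kappa>) \<le> 1"
      using U(3) d2 by linarith
    moreover have "P ((t, x) # h)" if x: "x \<in> G" and t: "0 < t" and tU: "t * (U x + S x / \<kappa>) \<le> 1" for x t
    proof (rule PI)
      have "0 \<le> t * U x" "0 \<le> t * (S x / \<kappa>)" using t U(2) S0 kap by auto
      then have "t * U x \<le> 1" "t * (S x / \<kappa>) \<le> 1" using tU by (auto simp: distrib_left)
      then have "t * S x \<le> \<kappa>" using kap by (simp add: field_simps)
      then show "(\<Sum>p\<leftarrow>(t, x) # h. fst p * S (snd p)) \<le> length ((t, x) # h) * \<kappa>"
        using h(2) by (simp add: algebra_simps)
      show "\<exists>R. g.inv_pair (g.barrier X \<delta> (- 1) ((t, x) # h)) R \<and> g.\<phi> R \<le> \<epsilon>"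
        using U(4)[OF t \<open>t * U x \<le> 1\<close>] by simp
    qed (use x t h(1) in auto)
    ultimately show ?thesis using U(1,2) S(1) S0 kap
      by (intro exI[of _ "\<lambda>x. U x + S x / \<kappa>"]) auto
  qed
  moreover have "(\<Sum>p\<leftarrow>h. fst p * (cmod (\<Sum>k\<in>F'. cnj (w k) * b k (snd p)))\<^sup>2)
         \<le> n * (1 + p)\<^sup>2 * \<Lambda> * (\<Sum>k\<in>F'. (cmod (w k))\<^sup>2)"
    if h: "P h" and len: "length h = n" and F': "finite F'" "F' \<subseteq> K" for h F' and w :: "'k \<Rightarrow> complex"
  proof -
    note h = PD[OF h]
    obtain R where R: "g.inv_pair (g.barrier X \<delta> (- 1) h) R" "g.\<phi> R \<le> \<epsilon>" using h(3) by blast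
    have en: "g.energy h u \<le> CF * g.normsq u" for u
    proof -
      have "g.qform g.H u \<le> g.\<phi> R * g.qform (g.barrier X \<delta> (- 1) h) u" by (rule g.H_le_potential[OF R(1)])
      also have "\<dots> \<le> \<epsilon> * g.qform (g.barrier X \<delta> (- 1) h) u"
        using R(2) g.pos_semidefD(2)[OF g.inv_pair_pos_semidef[OF R(1)]] by (intro mult_right_mono) auto
      finally have "1 / \<epsilon> * g.qform g.H u \<le> g.qform (g.barrier X \<delta> (- 1) h) u"
        using e0(1) by (simp add: field_simps)
      then have "g.energy h u \<le> \<alpha> * g.normsq u + c * g.qform g.H u"
        unfolding qX len c_def by (simp add: algebra_simps)
      also have "\<dots> \<le> \<alpha> * g.normsq u + c * (\<Lambda> * g.normsq u)"
        using mult_left_mono[OF HL c] by simp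
      finally show ?thesis unfolding CF_def by (simp add: algebra_simps)
    qed
    define u where "u = (\<lambda>k. if k \<in> F' then w k else 0)"
    define W2 where "W2 = (\<Sum>k\<in>F' - F. (cmod (w k))\<^sup>2)"
    have W: "(\<Sum>k\<in>F'. (cmod (w k))\<^sup>2) = g.normsq u + W2"
    proof -
      have "g.normsq u = (\<Sum>k\<in>F' \<inter> F. (cmod (w k))\<^sup>2)"
        unfolding g.normsq_def u_def using F by (intro sum.mono_neutral_cong_right) auto
      moreover have "(\<Sum>k\<in>F'. (cmod (w k))\<^sup>2) = (\<Sum>k\<in>F' \<inter> F. (cmod (w k))\<^sup>2) + W2"
        unfolding W2_def using sum.Int_Diff[OF F'(1)] .
      ultimately show ?thesis by simp
    qed
    define z where "z = (\<lambda>x. \<Sum>k\<in>F' - F. cnj (w k) * b k x)"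
    have split: "(\<Sum>k\<in>F'. cnj (w k) * b k x) = g.inner_fin u (\<lambda>k. b k x) + z x" for x
    proof -
      have "g.inner_fin u (\<lambda>k. b k x) = (\<Sum>k\<in>F' \<inter> F. cnj (w k) * b k x)"
        unfolding g.inner_fin_def u_def using F by (intro sum.mono_neutral_cong_right) auto
      moreover have "(\<Sum>k\<in>F'. cnj (w k) * b k x) = (\<Sum>k\<in>F' \<inter> F. cnj (w k) * b k x) + z x"
        unfolding z_def using sum.Int_Diff[OF F'(1)] .
      ultimately show ?thesis by simp
    qed
    \<comment> \<open>With this ratio both blocks receive the same factor \<open>CF + n \<kappa>\<close>.\<close>
    define s where "s = n * \<kappa> / CF"
    have s: "0 < s" using n kap CF unfolding s_def by simp
    have W20: "0 \<le> W2" unfolding W2_def by (intro sum_nonneg) auto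
    have "(\<Sum>p\<leftarrow>h. fst p * (cmod (\<Sum>k\<in>F'. cnj (w k) * b k (snd p)))\<^sup>2)
      \<le> (\<Sum>p\<leftarrow>h. (1 + s) * (fst p * (cmod (g.inner_fin u (\<lambda>k. b k (snd p))))\<^sup>2) + (1 + 1 / s) * W2 * (fst p * S (snd p)))"
    proof (rule sum_list_mono)
      fix q assume "q \<in> set h"
      then have q: "0 < fst q" "snd q \<in> G" using h(1) by auto
      have "(\<lambda>k. (cmod (b k (snd q)))\<^sup>2) summable_on K" using q(2) unfolding G_def ell2_def by simp
      then have "(\<lambda>k. (cmod (b k (snd q)))\<^sup>2) summable_on (K - F)" by (rule summable_on_subset) auto
      then have "(\<Sum>k\<in>F' - F. (cmod (b k (snd q)))\<^sup>2) \<le> S (snd q)"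
        unfolding S_def using F' by (intro finite_sum_le_infsum) auto
      then have "W2 * (\<Sum>k\<in>F' - F. (cmod (b k (snd q)))\<^sup>2) \<le> W2 * S (snd q)"
        using W20 by (rule mult_left_mono)
      then have "(cmod (z (snd q)))\<^sup>2 \<le> W2 * S (snd q)"
        using finite_Cauchy_Schwarz[of w "\<lambda>k. b k (snd q)" "F' - F"] unfolding z_def W2_def by linarith
      then have "(1 + 1 / s) * (cmod (z (snd q)))\<^sup>2 \<le> (1 + 1 / s) * (W2 * S (snd q))"
        using s by (intro mult_left_mono) auto
      then have "(cmod (\<Sum>k\<in>F'. cnj (w k) * b k (snd q)))\<^sup>2
        \<le> (1 + s) * (cmod (g.inner_fin u (\<lambda>k. b k (snd q))))\<^sup>2 + (1 + 1 / s) * (W2 * S (snd q))"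
        unfolding split using norm_square_add_le[OF s, of "g.inner_fin u (\<lambda>k. b k (snd q))" "z (snd q)"] by linarith
      from mult_left_mono[OF this less_imp_le[OF q(1)]]
      show "fst q * (cmod (\<Sum>k\<in>F'. cnj (w k) * b k (snd q)))\<^sup>2
        \<le> (1 + s) * (fst q * (cmod (g.inner_fin u (\<lambda>k. b k (snd q))))\<^sup>2) + (1 + 1 / s) * W2 * (fst q * S (snd q))"
        by (simp only: distrib_left mult_ac)
    qed
    also have "\<dots> = (1 + s) * g.energy h u + (1 + 1 / s) * W2 * (\<Sum>p\<leftarrow>h. fst p * S (snd p))"
      unfolding g.energy_def by (simp only: sum_list_addf sum_list_const_mult)
    also have "\<dots> \<le> (1 + s) * (CF * g.normsq u) + (1 + 1 / s) * W2 * (n * \<kappa>)"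
      by (rule add_mono; rule mult_left_mono) (use s W20 en[of u] h(2) len in auto)
    also have "\<dots> = ((1 + s) * CF) * g.normsq u + ((1 + 1 / s) * (n * \<kappa>)) * W2" by (simp only: mult_ac)
    also have "(1 + s) * CF = CF + n * \<kappa>" unfolding s_def using CF by (simp add: field_simps)
    also have "(1 + 1 / s) * (n * \<kappa>) = CF + n * \<kappa>" unfolding s_def using CF n kap by (simp add: field_simps)
    also have "(CF + n * \<kappa>) * g.normsq u + (CF + n * \<kappa>) * W2 = n * (1 + p)\<^sup>2 * \<Lambda> * (\<Sum>k\<in>F'. (cmod (w k))\<^sup>2)"
      unfolding final W by (simp only: distrib_left)
    finally show ?thesis .
  qed
  ultimately show ?thesis by (intro exI[of _ P]) auto
qed

section \<open>Gram matrices of functions and of samples\<close>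

lemma summable_on_sum:
  fixes f :: "'i \<Rightarrow> 'k \<Rightarrow> real"
  assumes "\<And>i. i \<in> A \<Longrightarrow> f i summable_on K"
  shows "(\<lambda>k. \<Sum>i\<in>A. f i k) summable_on K"
  using assms by (induction A rule: infinite_finite_induct) (auto intro: summable_on_add)

lemma gram_Cauchy_Schwarz:
  fixes b :: "'k \<Rightarrow> 'x \<Rightarrow> complex"
  assumes "square_integrable \<mu> (b k)" "square_integrable \<mu> (b l)"
  shows "(cmod (integral_gram \<mu> b k l))\<^sup>2 \<le> (LINT x|\<mu>. (cmod (b k x))\<^sup>2) * (LINT x|\<mu>. (cmod (b l x))\<^sup>2)"
proof -
  interpret gram "{k, l}" \<mu> b by unfold_locales (use assms in auto)
  define e :: "'k \<Rightarrow> 'k \<Rightarrow> complex" where "e = (\<lambda>j i. if i = j then 1 else 0)"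
  have inner_fin: "inner_fin (e j) u = u j" if "j \<in> {k, l}" for j u
    unfolding e_def by (rule inner_fin_unit[OF that])
  have q: "qform H (e j) = (LINT x|\<mu>. (cmod (b j x))\<^sup>2)" if "j \<in> {k, l}" for j
    unfolding qform_H inner_fin[OF that] ..
  have "inner_fin (e k) (H (e l)) = integral_gram \<mu> b k l"
    unfolding e_def by (subst inner_fin_unit) (auto intro: H_unit)
  then show ?thesis using pos_semidef_Cauchy_Schwarz[OF pos_semidef_H, of "e k" "e l"] q[of k] q[of l] by simp
qed

lemma gram_hilbert_schmidt:
  assumes "\<And>k. k \<in> K \<Longrightarrow> square_integrable \<mu> (b k)"
    and "(\<lambda>k. LINT x|\<mu>. (cmod (b k x))\<^sup>2) summable_on K"
  shows "hilbert_schmidt K (integral_gram \<mu> b)"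
  by (rule hilbert_schmidtI[OF assms(2)]) (auto intro: gram_Cauchy_Schwarz assms(1) integral_nonneg)

lemma gram_pd_finite:
  assumes b: "\<And>k. k \<in> K \<Longrightarrow> square_integrable \<mu> (b k)"
    and sm: "(\<lambda>k. LINT x|\<mu>. (cmod (b k x))\<^sup>2) summable_on K"
    and pd: "positive_definite K (integral_gram \<mu> b)"
    and F: "finite F" "F \<subseteq> K" and w: "0 < (\<Sum>k\<in>F. (cmod (w k))\<^sup>2)"
  shows "0 < Re (\<Sum>k\<in>F. \<Sum>l\<in>F. cnj (w k) * integral_gram \<mu> b k l * w l)"
proof -
  let ?u = "\<lambda>k. if k \<in> F then w k else 0"
  have u: "?u \<in> ell2 K" by (rule ell2_form_finite_support(1)[OF F])
  have "\<exists>k\<in>F. w k \<noteq> 0"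
  proof (rule ccontr)
    assume "\<not> ?thesis"
    then have "(\<Sum>k\<in>F. (cmod (w k))\<^sup>2) = 0" by (intro sum.neutral) auto
    then show False using w by simp
  qed
  then have "\<exists>k\<in>K. ?u k \<noteq> 0" using F by auto
  with pd[unfolded positive_definite_def, THEN conjunct2, rule_format, OF u]
  have "0 < Re (quad_form K (integral_gram \<mu> b) ?u)" by simp
  also have "quad_form K (integral_gram \<mu> b) ?u = ell2_form K (integral_gram \<mu> b) ?u ?u"
    unfolding quad_form_def by (rule ell2_form_iterated[OF gram_hilbert_schmidt[OF b sm] u u, symmetric])
  finally show ?thesis unfolding ell2_form_finite_support(2)[OF F] .
qed

lemma gram_le_trace:
  assumes b: "\<And>k. k \<in> K \<Longrightarrow> square_integrable \<mu> (b k)"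
    and sm: "(\<lambda>k. LINT x|\<mu>. (cmod (b k x))\<^sup>2) summable_on K"
    and F: "finite F" "F \<subseteq> K"
  shows "Re (\<Sum>k\<in>F. \<Sum>l\<in>F. cnj (w k) * integral_gram \<mu> b k l * w l)
    \<le> (\<Sum>\<^sub>\<infinity>k\<in>K. (LINT x|\<mu>. (cmod (b k x))\<^sup>2)) * (\<Sum>k\<in>F. (cmod (w k))\<^sup>2)"
proof -
  interpret gram F \<mu> b by unfold_locales (use F b in auto)
  have int: "integrable \<mu> (\<lambda>x. (cmod (b k x))\<^sup>2)" if "k \<in> F" for k
    using sqi[OF that] unfolding square_integrable_def by simp
  have "qform H w \<le> (LINT x|\<mu>. normsq w * (\<Sum>k\<in>F. (cmod (b k x))\<^sup>2))"
    unfolding qform_H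
  proof (rule integral_mono[OF qform_H_integrable])
    show "integrable \<mu> (\<lambda>x. normsq w * (\<Sum>k\<in>F. (cmod (b k x))\<^sup>2))"
      using int by (intro integrable_mult_right Bochner_Integration.integrable_sum) auto
    show "(cmod (inner_fin w (\<lambda>k. b k x)))\<^sup>2 \<le> normsq w * (\<Sum>k\<in>F. (cmod (b k x))\<^sup>2)" for x
      using Cauchy_Schwarz[of w "\<lambda>k. b k x"] unfolding normsq_def .
  qed
  also have "\<dots> = normsq w * (LINT x|\<mu>. (\<Sum>k\<in>F. (cmod (b k x))\<^sup>2))" by simp
  also have "(LINT x|\<mu>. (\<Sum>k\<in>F. (cmod (b k x))\<^sup>2)) = (\<Sum>k\<in>F. (LINT x|\<mu>. (cmod (b k x))\<^sup>2))"
    using int by (rule Bochner_Integration.integral_sum)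
  also have "normsq w * (\<Sum>k\<in>F. (LINT x|\<mu>. (cmod (b k x))\<^sup>2)) \<le> normsq w * (\<Sum>\<^sub>\<infinity>k\<in>K. (LINT x|\<mu>. (cmod (b k x))\<^sup>2))"
    using F by (intro mult_left_mono finite_sum_le_infsum sm) (auto intro: integral_nonneg)
  finally show ?thesis unfolding qform_H_sum normsq_def by (simp only: mult.commute)
qed

lemma sample_gram_form:
  "(\<Sum>k\<in>F. \<Sum>l\<in>F. cnj (u k) * sample_gram n w x f k l * u l)
    = complex_of_real (\<Sum>i = 1..n. w i * (cmod (\<Sum>k\<in>F. cnj (u k) * f k (x i)))\<^sup>2)"
proof -
  define z where "z = (\<lambda>i. \<Sum>k\<in>F. cnj (u k) * f k (x i))"
  have "(\<Sum>k\<in>F. \<Sum>l\<in>F. cnj (u k) * sample_gram n w x f k l * u l)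
    = (\<Sum>k\<in>F. \<Sum>l\<in>F. \<Sum>i = 1..n. of_real (w i) * ((cnj (u k) * f k (x i)) * cnj (cnj (u l) * f l (x i))))"
    unfolding sample_gram_def sum_distrib_left sum_distrib_right
    by (intro sum.cong refl) (simp add: mult_ac)
  also have "\<dots> = (\<Sum>k\<in>F. \<Sum>i = 1..n. \<Sum>l\<in>F. of_real (w i) * ((cnj (u k) * f k (x i)) * cnj (cnj (u l) * f l (x i))))"
    by (intro sum.cong refl sum.swap)
  also have "\<dots> = (\<Sum>i = 1..n. \<Sum>k\<in>F. \<Sum>l\<in>F. of_real (w i) * ((cnj (u k) * f k (x i)) * cnj (cnj (u l) * f l (x i))))"
    by (rule sum.swap)
  also have "\<dots> = (\<Sum>i = 1..n. of_real (w i) * (z i * cnj (z i)))"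
  proof (intro sum.cong refl)
    fix i
    have "z i * cnj (z i) = (\<Sum>k\<in>F. \<Sum>l\<in>F. (cnj (u k) * f k (x i)) * cnj (cnj (u l) * f l (x i)))"
      unfolding z_def cnj_sum sum_product ..
    then show "(\<Sum>k\<in>F. \<Sum>l\<in>F. of_real (w i) * ((cnj (u k) * f k (x i)) * cnj (cnj (u l) * f l (x i))))
      = of_real (w i) * (z i * cnj (z i))"
      by (simp only: sum_distrib_left)
  qed
  also have "\<dots> = complex_of_real (\<Sum>i = 1..n. w i * (cmod (z i))\<^sup>2)"
    by (simp add: complex_norm_square del: of_real_power)
  finally show ?thesis unfolding z_def .
qed

lemma sample_gram_hermitian: "sample_gram n w x f k l = cnj (sample_gram n w x f l k)"
  unfolding sample_gram_def by (simp add: mult_ac)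

lemma sample_gram_diag: "sample_gram n w x f k k = complex_of_real (\<Sum>i = 1..n. w i * (cmod (f k (x i)))\<^sup>2)"
  using sample_gram_form[where F = "{k}" and u = "\<lambda>_. 1" and f = f and n = n and w = w and x = x] by simp

lemma sample_gram_Cauchy_Schwarz:
  assumes "\<And>i. i \<in> {1..n} \<Longrightarrow> 0 \<le> w i"
  shows "(cmod (sample_gram n w x f k l))\<^sup>2 \<le> (\<Sum>i = 1..n. w i * (cmod (f k (x i)))\<^sup>2) * (\<Sum>i = 1..n. w i * (cmod (f l (x i)))\<^sup>2)"
proof -
  let ?g = "\<lambda>k i. of_real (sqrt (w i)) * f k (x i)"
  have "(\<Sum>i = 1..n. cnj (?g l i) * ?g k i) = sample_gram n w x f k l"
    unfolding sample_gram_def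
  proof (intro sum.cong refl)
    fix i assume "i \<in> {1..n}"
    then have "complex_of_real (sqrt (w i)) * of_real (sqrt (w i)) = of_real (w i)"
      using assms by (simp flip: of_real_mult)
    then show "cnj (?g l i) * ?g k i = of_real (w i) * (f k (x i) * cnj (f l (x i)))"
      by (simp add: mult_ac)
  qed
  moreover have "(\<Sum>i = 1..n. (cmod (?g k i))\<^sup>2) = (\<Sum>i = 1..n. w i * (cmod (f k (x i)))\<^sup>2)" for k
    using assms by (intro sum.cong refl) (simp add: norm_mult power_mult_distrib)
  ultimately show ?thesis using finite_Cauchy_Schwarz[of "?g l" "?g k" "{1..n}"] by (simp only: mult.commute)
qed

section \<open>Points and weights\<close>

theorem theorem3:
  fixes \<mu> :: "'x measure"
    and m n :: nat
    and K :: "'k set"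
    and a :: "nat \<Rightarrow> 'x \<Rightarrow> complex"
    and b :: "'k \<Rightarrow> 'x \<Rightarrow> complex"
    and I :: "nat \<Rightarrow> nat \<Rightarrow> complex"
    and J :: "'k \<Rightarrow> 'k \<Rightarrow> complex"
    and TrJ M :: real
  assumes "m \<ge> 1"
    and "countable K" and "K \<noteq> {}"
    and "\<And>j. j \<in> {1..m} \<Longrightarrow> square_integrable \<mu> (a j)"
    and "\<And>k. k \<in> K \<Longrightarrow> square_integrable \<mu> (b k)"
    and "I = integral_gram \<mu> a"
    and "J = integral_gram \<mu> b"
    and "positive_definite {1..m} I"
    and "positive_definite K J"
    and "(\<lambda>k. LINT x|\<mu>. (cmod (b k x))\<^sup>2) summable_on K"
    and "TrJ = (\<Sum>\<^sub>\<infinity>k\<in>K. LINT x|\<mu>. (cmod (b k x))\<^sup>2)"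
    and "M = TrJ / lambda_max K J"
    and "n \<ge> m"
  shows "\<exists>(x :: nat \<Rightarrow> 'x) (w :: nat \<Rightarrow> real).
           (\<forall>i\<in>{1..n}. x i \<in> space \<mu> \<and> (\<lambda>k. b k (x i)) \<in> ell2 K \<and> w i > 0) \<and>
           lambda_min {1..m} (sample_gram n w x a)
             \<ge> (1 - sqrt ((real m - 1) / real n))\<^sup>2 * lambda_min {1..m} I \<and>
           lambda_max K (sample_gram n w x b)
             \<le> (1 + sqrt ((M - 1) / real n))\<^sup>2 * lambda_max K J"
proof -
  note m = assms(1) and K = assms(2,3) and a = assms(4) and b = assms(5) and n = assms(13)
    and sm = assms(10) and IJ = assms(6,7)
  note pdI = assms(8)[unfolded IJ] and pdJ = assms(9)[unfolded IJ]
  have n0: "0 < real n" using m n by simp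
  have T: "TrJ = (\<Sum>\<^sub>\<infinity>k\<in>K. (LINT x|\<mu>. (cmod (b k x))\<^sup>2))" by (rule assms(11))
  have sma: "(\<lambda>k. LINT x|\<mu>. (cmod (a k x))\<^sup>2) summable_on {1..m}" by simp
  define \<Lambda> where "\<Lambda> = lambda_max K J"
  obtain k0 where k0: "k0 \<in> K" using K by blast
  have HSJ: "hilbert_schmidt K J" unfolding IJ by (rule gram_hilbert_schmidt[OF b sm])
  have hJ: "J k l = cnj (J l k)" for k l unfolding IJ by (rule gram_hermitian)
  have pJ: "0 < Re (J k0 k0)"
    using gram_pd_finite[OF b sm pdJ, of "{k0}" "\<lambda>_. 1"] k0 unfolding IJ by simp
  have L0: "0 < \<Lambda>" unfolding \<Lambda>_def by (rule lambda_max_attained(1)[OF HSJ hJ k0 pJ])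
  have Lev: "is_eigenvalue K J (complex_of_real \<Lambda>)"
    unfolding \<Lambda>_def by (rule lambda_max_attained(2)[OF HSJ hJ k0 pJ])
  have Lle: "Re (\<Sum>k\<in>F. \<Sum>l\<in>F. cnj (w k) * J k l * w l) \<le> \<Lambda> * (\<Sum>k\<in>F. (cmod (w k))\<^sup>2)"
    if "finite F" "F \<subseteq> K" for F w
    unfolding \<Lambda>_def by (rule lambda_max_attained(3)[OF HSJ hJ k0 pJ that])
  \<comment> \<open>This makes \<open>M - 1\<close> nonnegative, so that \<open>p\<close> below really satisfies \<open>n p\<^sup>2 = M - 1\<close>.\<close>
  have LT: "\<Lambda> \<le> TrJ"
    by (rule eigenvalue_le[OF HSJ Lev]) (unfold IJ T, rule gram_le_trace[OF b sm])
  have M: "1 \<le> M" "TrJ = M * \<Lambda>"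
    unfolding assms(12) using LT L0 by (auto simp: \<Lambda>_def[symmetric])
  define p where "p = sqrt ((M - 1) / n)"
  have p: "0 \<le> p" "n * p\<^sup>2 = M - 1" unfolding p_def using M n0 by auto
  have TM: "TrJ = (1 + n * p\<^sup>2) * \<Lambda>" unfolding p(2) M(2) by simp
  have T0: "0 < TrJ" using LT L0 by linarith

  define G where "G = {x \<in> space \<mu>. (\<lambda>k. b k x) \<in> ell2 K}"
  have "AE x in \<mu>. (\<lambda>k. (cmod (b k x))\<^sup>2) summable_on K"
    by (rule integral_infsum_nonneg(1)[OF K(1) _ _ sm]) (use b in \<open>auto simp: square_integrable_def\<close>)
  then have G: "AE x in \<mu>. x \<in> G"
    using AE_space unfolding G_def ell2_def by eventually_elim simp

  interpret ga: pd_gram "{1..m}" \<mu> a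
  proof
    interpret gr: gram "{1..m}" \<mu> a by unfold_locales (use a in auto)
    show "0 < gr.qform gr.H u" if "0 < gr.normsq u" for u
      using gram_pd_finite[OF a sma pdI, of "{1..m}" u] that unfolding gr.qform_H_sum gr.normsq_def by simp
  qed (use a m in auto)

  obtain Q where Q: "Q []" "\<And>h. Q h \<Longrightarrow> (\<exists>L. integrable \<mu> L \<and> 1 \<le> (LINT x|\<mu>. L x) \<and>
       (\<forall>x t. 0 < t \<longrightarrow> 1 \<le> t * L x \<longrightarrow> Q ((t, x) # h)))"
    "\<And>h u. Q h \<Longrightarrow> length h = n \<Longrightarrow>
       n * (1 - sqrt ((real m - 1) / n))\<^sup>2 * ga.qform ga.H u \<le> ga.energy h u"
    using ga.lower_sampling[of n] n by auto

  have "\<exists>P. P [] \<and>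
    (\<forall>h. P h \<longrightarrow> length h < n \<longrightarrow> (\<exists>U. integrable \<mu> U \<and> (\<forall>x. 0 \<le> U x) \<and> (LINT x|\<mu>. U x) \<le> (1::real) \<and>
       (\<forall>x\<in>G. \<forall>t. 0 < t \<longrightarrow> t * U x \<le> 1 \<longrightarrow> P ((t, x) # h)))) \<and>
    (\<forall>h F w. P h \<longrightarrow> length h = n \<longrightarrow> finite F \<longrightarrow> F \<subseteq> K \<longrightarrow>
       (\<Sum>p\<leftarrow>h. fst p * (cmod (\<Sum>k\<in>F. cnj (w k) * b k (snd p)))\<^sup>2)
         \<le> n * (1 + p)\<^sup>2 * \<Lambda> * (\<Sum>k\<in>F. (cmod (w k))\<^sup>2))"
  \<comment> \<open>For \<open>n p \<le> 1\<close> the trace bound suffices because \<open>M = 1 + n p\<^sup>2 \<le> 1 + p\<close>.\<close>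
  proof (cases "n * p \<le> 1")
    case True
    have "n * p\<^sup>2 \<le> p" using mult_right_mono[OF True p(1)] by (simp add: power2_eq_square mult.assoc)
    moreover have "(1 + p)\<^sup>2 = 1 + 2 * p + p\<^sup>2" by (simp add: power2_sum)
    ultimately have "1 + n * p\<^sup>2 \<le> (1 + p)\<^sup>2" using p(1) zero_le_power2[of p] by linarith
    then have "(1 + n * p\<^sup>2) * \<Lambda> \<le> (1 + p)\<^sup>2 * \<Lambda>" using L0 by (intro mult_right_mono) auto
    then have nT: "n * TrJ \<le> n * (1 + p)\<^sup>2 * \<Lambda>" unfolding TM mult.assoc using n0 by (intro mult_left_mono) auto
    obtain P where P: "P []" "\<forall>h. P h \<longrightarrow> (\<exists>U. integrable \<mu> U \<and> (\<forall>x. 0 \<le> U x) \<and> (LINT x|\<mu>. U x) \<le> (1::real) \<and>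
       (\<forall>x\<in>G. \<forall>t. 0 < t \<longrightarrow> t * U x \<le> 1 \<longrightarrow> P ((t, x) # h)))"
      "\<And>h F w. P h \<Longrightarrow> finite F \<Longrightarrow> F \<subseteq> K \<Longrightarrow>
       (\<Sum>p\<leftarrow>h. fst p * (cmod (\<Sum>k\<in>F. cnj (w k) * b k (snd p)))\<^sup>2)
         \<le> length h * TrJ * (\<Sum>k\<in>F. (cmod (w k))\<^sup>2)"
      using upper_sampling_trace[OF K(1) b sm T T0] unfolding G_def by blast
    have "(\<Sum>p\<leftarrow>h. fst p * (cmod (\<Sum>k\<in>F. cnj (w k) * b k (snd p)))\<^sup>2)
         \<le> n * (1 + p)\<^sup>2 * \<Lambda> * (\<Sum>k\<in>F. (cmod (w k))\<^sup>2)"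
      if "P h" "length h = n" "finite F" "F \<subseteq> K" for h F w
    proof -
      have "n * TrJ * (\<Sum>k\<in>F. (cmod (w k))\<^sup>2) \<le> n * (1 + p)\<^sup>2 * \<Lambda> * (\<Sum>k\<in>F. (cmod (w k))\<^sup>2)"
        using nT by (intro mult_right_mono sum_nonneg) auto
      then show ?thesis using P(3)[OF that(1,3,4), of w] unfolding that(2) by linarith
    qed
    then show ?thesis using P(1,2) by (intro exI[of _ P]) blast
  next
    case False
    then have "0 < p" "1 < n * p" using p(1) by (auto simp: less_le)
    from upper_sampling_barrier[OF K(1) k0 b sm T gram_pd_finite[OF b sm pdJ] L0 Lle[unfolded IJ] this TM]
    show ?thesis unfolding G_def .
  qed
  then obtain P where P0: "P [] \<and>
    (\<forall>h. P h \<longrightarrow> length h < n \<longrightarrow> (\<exists>U. integrable \<mu> U \<and> (\<forall>x. 0 \<le> U x) \<and> (LINT x|\<mu>. U x) \<le> (1::real) \<and>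
       (\<forall>x\<in>G. \<forall>t. 0 < t \<longrightarrow> t * U x \<le> 1 \<longrightarrow> P ((t, x) # h)))) \<and>
    (\<forall>h F w. P h \<longrightarrow> length h = n \<longrightarrow> finite F \<longrightarrow> F \<subseteq> K \<longrightarrow>
       (\<Sum>p\<leftarrow>h. fst p * (cmod (\<Sum>k\<in>F. cnj (w k) * b k (snd p)))\<^sup>2)
         \<le> n * (1 + p)\<^sup>2 * \<Lambda> * (\<Sum>k\<in>F. (cmod (w k))\<^sup>2))" by (rule exE)
  note P = P0[THEN conjunct1] P0[THEN conjunct2, THEN conjunct1, rule_format]
    P0[THEN conjunct2, THEN conjunct2, rule_format]

  have low: "\<exists>L. integrable \<mu> L \<and> 1 \<le> (LINT x|\<mu>. L x) \<and>
       (\<forall>x\<in>G. \<forall>t. 0 < t \<longrightarrow> 1 \<le> t * L x \<longrightarrow> Q ((t, x) # h))" if "Q h" for h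
    using Q(2)[OF that] by (elim exE conjE, intro exI conjI) auto
  have "\<exists>h. length h = n \<and> P h \<and> Q h \<and> (\<forall>p\<in>set h. 0 < fst p \<and> snd p \<in> G)"
    by (rule interleave_barriers[OF Q(1) P(1) low P(2) G])
  then obtain h where hh: "length h = n \<and> P h \<and> Q h \<and> (\<forall>p\<in>set h. 0 < fst p \<and> snd p \<in> G)" by (rule exE)
  then have h: "length h = n" "P h" "Q h" and hG: "\<And>q. q \<in> set h \<Longrightarrow> 0 < fst q \<and> snd q \<in> G"
    by simp_all

  define x where "x = (\<lambda>i. snd (h ! (i - 1)))"
  define w where "w = (\<lambda>i. fst (h ! (i - 1)) / n)"
  have xw: "x i \<in> G \<and> 0 < w i" if "i \<in> {1..n}" for i
  proof -
    have "h ! (i - 1) \<in> set h" by (rule nth_mem) (use h(1) that in auto)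
    from hG[OF this] show ?thesis unfolding x_def w_def using divide_pos_pos[OF _ n0] by blast
  qed
  have hsum: "(\<Sum>i = 1..n. w i * g (x i)) = (\<Sum>q\<leftarrow>h. fst q * g (snd q)) / n" for g :: "'x \<Rightarrow> real"
  proof -
    have "(\<Sum>q\<leftarrow>h. fst q * g (snd q)) = (\<Sum>i = 0..<n. fst (h ! i) * g (snd (h ! i)))"
      unfolding sum_list_sum_nth using h(1) by simp
    also have "\<dots> = (\<Sum>i = 1..n. fst (h ! (i - 1)) * g (snd (h ! (i - 1))))"
      by (rule sum.reindex_bij_witness[of _ "\<lambda>i. i - 1" Suc]) auto
    finally show ?thesis unfolding w_def x_def by (simp add: sum_divide_distrib)
  qed

  have lower: "(1 - sqrt ((real m - 1) / n))\<^sup>2 * lambda_min {1..m} I \<le> lambda_min {1..m} (sample_gram n w x a)"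
  proof (rule lambda_min_attained(2))
    show "finite {1..m}" "{1..m} \<noteq> {}" using m by auto
    show "sample_gram n w x a k l = cnj (sample_gram n w x a l k)" for k l by (rule sample_gram_hermitian)
    fix u :: "nat \<Rightarrow> complex"
    let ?q = "(1 - sqrt ((real m - 1) / n))\<^sup>2"
    have "lambda_min {1..m} I * (\<Sum>k = 1..m. (cmod (u k))\<^sup>2) \<le> Re (\<Sum>k\<in>{1..m}. \<Sum>l\<in>{1..m}. cnj (u k) * I k l * u l)"
      by (rule lambda_min_attained(1)) (use m in \<open>auto simp: IJ intro: gram_hermitian\<close>)
    then have "lambda_min {1..m} I * (\<Sum>k = 1..m. (cmod (u k))\<^sup>2) \<le> ga.qform ga.H u"
      unfolding ga.qform_H_sum IJ .
    then have "?q * (lambda_min {1..m} I * (\<Sum>k = 1..m. (cmod (u k))\<^sup>2)) \<le> ?q * ga.qform ga.H u"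
      by (intro mult_left_mono) auto
    also have "\<dots> \<le> ga.energy h u / n" using Q(3)[OF h(3,1), of u] n0 by (simp add: field_simps)
    also have "\<dots> = Re (\<Sum>k = 1..m. \<Sum>l = 1..m. cnj (u k) * sample_gram n w x a k l * u l)"
      unfolding sample_gram_form Re_complex_of_real ga.energy_def ga.inner_fin_def
      by (rule hsum[symmetric])
    finally show "?q * lambda_min {1..m} I * (\<Sum>k = 1..m. (cmod (u k))\<^sup>2)
      \<le> Re (\<Sum>k = 1..m. \<Sum>l = 1..m. cnj (u k) * sample_gram n w x a k l * u l)"
      by (simp only: mult.assoc)
  qed

  have upper: "lambda_max K (sample_gram n w x b) \<le> (1 + p)\<^sup>2 * \<Lambda>"
  proof (rule lambda_max_le)
    let ?g = "\<lambda>k. \<Sum>i = 1..n. w i * (cmod (b k (x i)))\<^sup>2"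
    have w0: "0 \<le> w i" if "i \<in> {1..n}" for i using xw[OF that] by simp
    show "?g summable_on K"
      by (intro summable_on_sum summable_on_cmult_right) (use xw in \<open>auto simp: G_def ell2_def\<close>)
    show "0 \<le> ?g k" for k using w0 by (intro sum_nonneg mult_nonneg_nonneg) auto
    show "Re (sample_gram n w x b k k) = ?g k" for k unfolding sample_gram_diag by simp
    show "(cmod (sample_gram n w x b k l))\<^sup>2 \<le> ?g k * ?g l" for k l
      by (rule sample_gram_Cauchy_Schwarz[OF w0])
    show "sample_gram n w x b k l = cnj (sample_gram n w x b l k)" for k l by (rule sample_gram_hermitian)
    show "K \<noteq> {}" by (rule K(2))
    fix F and u :: "'k \<Rightarrow> complex" assume F: "finite F" "F \<subseteq> K"
    have "Re (\<Sum>k\<in>F. \<Sum>l\<in>F. cnj (u k) * sample_gram n w x b k l * u l)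
      = (\<Sum>q\<leftarrow>h. fst q * (cmod (\<Sum>k\<in>F. cnj (u k) * b k (snd q)))\<^sup>2) / n"
      unfolding sample_gram_form Re_complex_of_real by (rule hsum)
    also have "\<dots> \<le> (n * (1 + p)\<^sup>2 * \<Lambda> * (\<Sum>k\<in>F. (cmod (u k))\<^sup>2)) / n"
      by (rule divide_right_mono[OF P(3)[OF h(2,1) F]]) simp
    also have "\<dots> = (1 + p)\<^sup>2 * \<Lambda> * (\<Sum>k\<in>F. (cmod (u k))\<^sup>2)" using n0 by simp
    finally show "Re (\<Sum>k\<in>F. \<Sum>l\<in>F. cnj (u k) * sample_gram n w x b k l * u l)
      \<le> (1 + p)\<^sup>2 * \<Lambda> * (\<Sum>k\<in>F. (cmod (u k))\<^sup>2)" .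
  qed
  show ?thesis
    using xw lower upper unfolding G_def p_def \<Lambda>_def by (intro exI[of _ x] exI[of _ w]) auto
qed

end
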